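(* Let $T_0>0$, $\xi\in\mathbb R$, and consider a point with Cartesian coordinates $(t,x,y,z)$, $r^2=x^2+y^2$. For real $\phi$ put $$T_I^{\mu\nu}(\phi)=\sum_{n=1}^\infty\frac{T_0^4\phi^4}{\pi^2\left(n^2\phi^2+4\sin^2\!\left(\frac{n\phi}2\right)r^2T_0^2\phi^2\right)^3}\,\Theta_n^{\mu\nu},$$ where the non-vanishing components of the symmetric $\Theta_n^{\mu\nu}$ are $$\Theta^{00}_n=(n\phi)^2(4\xi+2)+\cos(n\phi)\big[(n\phi)^2(1-4\xi)+2(8\xi-1)r^2T_0^2\phi^2\big]-\cos(2n\phi)(4\xi-1)r^2T_0^2\phi^2-(12\xi-1)r^2T_0^2\phi^2,$$ $$\Theta^{xx}_n=(n\phi)^2(1-2\xi)+2\cos(n\phi)\big[(n\phi)^2\xi+(4\xi-1)T_0^2\phi^2(x^2-3y^2)\big]-2(3\xi-1)T_0^2\phi^2(x^2-3y^2)+2T_0^2\phi^2\big[xy(\sin(2n\phi)-2\sin(n\phi))-\xi(x^2-3y^2)\cos(2n\phi)\big],$$ $$\Theta^{yy}_n=(n\phi)^2(1-2\xi)+\cos(n\phi)\big[2(n\phi)^2\xi-2(4\xi-1)T_0^2\phi^2(3x^2-y^2)\big]+2(3\xi-1)T_0^2\phi^2(3x^2-y^2)+2T_0^2\phi^2\big[xy(2\sin(n\phi)-\sin(2n\phi))+\xi(3x^2-y^2)\cos(2n\phi)\big],$$ $$\Theta^{zz}_n=(n\phi)^2(2-4\xi)-\cos(n\phi)\big[(n\phi)^2(1-4\xi)-2(4\xi-1)r^2T_0^2\phi^2\cos(n\phi)+2(8\xi-1)r^2T_0^2\phi^2\big]+8\xi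 r^2T_0^2\phi^2,$$ $$\Theta^{0x}_n=-2i(n\phi)(T_0\phi)\big[x(\cos(n\phi)-1)-2y\sin(n\phi)\big],\qquad \Theta^{0y}_n=2i(n\phi)(T_0\phi)\big[-2x\sin(n\phi)-y(\cos(n\phi)-1)\big],$$ $$\Theta^{xy}_n=4T_0^2\phi^2\sin^2\!\left(\tfrac{n\phi}2\right)\big[4xy(1-2\xi+2\xi\cos(n\phi))+(x-y)(x+y)\sin(n\phi)\big].$$ Let $\omega>0$ with $r\omega<1$, and let $T^{\mu\nu}$ be obtained by taking the analytic distillate of $T_I^{\mu\nu}(\phi)$ at $\phi=0$, continuing it to $\phi=i\omega/T_0$, and finally taking the real part. Then, with $\Delta^{\mu\nu}=g^{\mu\nu}-u^\mu u^\nu$, $$\begin{aligned}T^{\mu\nu}=&\ \rho\,u^\mu u^\nu-p\,\Delta^{\mu\nu}+W\,w^\mu w^\nu+\mathcal A\,\alpha^\mu\alpha^\nu+G^l\,l^\mu l^\nu+G(l^\mu u^\nu+l^\nu u^\mu)+\mathbb A(\alpha^\mu u^\nu+\alpha^\nu u^\mu)\\&+G^\alpha(l^\mu\alpha^\nu+l^\nu\alpha^\mu)+\mathbb W(w^\mu u^\nu+w^\nu u^\mu)+A^w(\alpha^\mu w^\nu+\alpha^\nu w^\mu)+G^w(l^\mu w^\nu+l^\nu w^\mu),\end{aligned}$$ where $$\rho=\frac1{\beta^4}\Big[\frac{\pi^2}{30}+\frac{4\xi-1}{12}w^2+\frac{6\xi-1}{12}\alpha^2+\frac{4\xi-1}{48\pi^2}w^4+\frac{60\xi-11}{480\pi^2}\alpha^4+\frac{270\xi-61}{720\pi^2}\alpha^2w^2\Big],$$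 $$p=\frac1{\beta^4}\Big[\frac{\pi^2}{90}-\frac{\xi}{6}w^2+\frac{1-6\xi}{18}\alpha^2-\frac{\xi}{24\pi^2}w^4+\frac{19-120\xi}{1440\pi^2}\alpha^4\Big],$$ $$W=\frac1{\beta^4}\Big[\frac{2\xi-1}{12}+\frac{2\xi-1}{48\pi^2}w^2+\frac{120\xi-29}{360\pi^2}\alpha^2\Big],\qquad \mathcal A=\frac1{\beta^4}\Big[\frac{1-6\xi}{12}+\frac{w^2}{360\pi^2}+\frac{1-6\xi}{48\pi^2}\alpha^2\Big],$$ $$G^l=\frac{1-70\xi}{240\pi^2\beta^4},\qquad G=\frac1{\beta^4}\Big[\frac{6\xi+1}{36}+\frac{10\xi-1}{240\pi^2}w^2+\frac{30\xi-7}{720\pi^2}\alpha^2\Big],$$ $$\mathbb A=0,\qquad G^\alpha=0,\qquad G^w=A^w=\mathbb W=0 .$$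
   Context: The metric is $g=\mathrm{diag}(1,-1,-1,-1)$. With $\gamma=(1-r^2\omega^2)^{-1/2}$ the vectors are $$u=\gamma(1,-y\omega,x\omega,0),\quad \alpha=\Big(0,-\frac{\gamma x\omega^2}{T_0},-\frac{\gamma y\omega^2}{T_0},0\Big),\quad w=\Big(0,0,0,\frac{\gamma\omega}{T_0}\Big),\quad l=\Big(\frac{\gamma(\gamma^2-1)\omega^2}{T_0^2},-\frac{\gamma^3y\omega^3}{T_0^2},\frac{\gamma^3x\omega^3}{T_0^2},0\Big),$$ and the scalars are $\beta^2=\frac1{T_0^2\gamma^2}$, $\alpha^2=-(\gamma^2-1)\frac{\omega^2}{T_0^2}$, $w^2=-\gamma^2\frac{\omega^2}{T_0^2}$, with $\beta^4=(\beta^2)^2$, $\alpha^4=(\alpha^2)^2$, $w^4=(w^2)^2$; also $l^2=-\alpha^2w^2$. The eleven coefficients are redundant for $r>0$ (the term $p\,\Delta^{\mu\nu}$ is kept because $\alpha=l=0$ at $r=0$); $p$ and $G^l$ are read off from the projection of $T^{\mu\nu}$ twice along the direction of $l$, which equals $G^l\,l^2-p$, the term proportional to $\alpha^2w^2$ being assigned to $G^l$. $T_I^{\mu\nu}$ is the normal ordered thermal expectation value, at imaginary angular velocity ($\phi=i\omega/T_0$ real), of the stress-energy tensor $\hat T_\xi^{\mu\nu}=\hat T_C^{\mu\nu}-\xi(\partial^\mu\partial^\nu-g^{\mu\nu}\Box)\hat\psi^2$ ($\hat T_C$ the canonical tensor) of the free massless neutral scalar field $\hat\psi$, with density operator $\frac1Z\exp[-\hat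 H/T_0+\omega\hat J_z/T_0]$; $T^{\mu\nu}$ is its value for physical angular velocity $\omega$. Analytic distillate at $0$, for a function $f$ of real $\phi$ considered on the positive and on the negative real axis: if $f(\phi)\sim\sum_na_n^\pm\phi^n$ as $\phi\to0^\pm$ ($n$ integer, possibly negative), put $\bar a_n=a_n^+$ if $a_n^+=a_n^-$ and $\bar a_n=0$ otherwise; if $\sum_{n\ge0}\bar a_n\phi^n$ has a positive radius of convergence, the analytic function it defines is the analytic distillate of $f$ at $0$.
   Formalization: Off the axis some components of T_I contain log φ terms, so their analytic distillate does not exist; the real part is therefore taken first, distilling (T_I(φ)+conj T_I(−φ))/2, which equals T_I in all other components; for T_I itself the formula is claimed only if its distillate exists. *)

theory Defs
  imports "HOL-Analysis.Analysis" "HOL-Library.Landau_Symbols"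
begin

section \<open>Analytic distillate at 0\<close>

text \<open>
  The coefficients are indexed by integers; only finitely many negative powers may occur.
  Used with \<open>G = at_right 0\<close> and \<open>G = at_left 0\<close>.
\<close>
definition has_asymptotic_series ::
    "(real \<Rightarrow> complex) \<Rightarrow> (int \<Rightarrow> complex) \<Rightarrow> real filter \<Rightarrow> bool" where
  "has_asymptotic_series f a G \<longleftrightarrow>
     (\<exists>m. (\<forall>n<m. a n = 0) \<and>
          (\<forall>N\<ge>m. (\<lambda>\<phi>. f \<phi> - (\<Sum>n=m..N. a n * of_real \<phi> powi n))
                     \<in> o[G](\<lambda>\<phi>. of_real \<phi> powi N)))"

definition is_analytic_distillate :: "(real \<Rightarrow> complex) \<Rightarrow> complex fps \<Rightarrow> bool" where
  "is_analytic_distillate f F \<longleftrightarrow>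
     (\<exists>ap am. has_asymptotic_series f ap (at_right 0) \<and>
              has_asymptotic_series f am (at_left 0) \<and>
              F = Abs_fps (\<lambda>n. if ap (int n) = am (int n) then ap (int n) else 0) \<and>
              fps_conv_radius F > 0)"

definition continues_to :: "complex fps \<Rightarrow> complex \<Rightarrow> complex \<Rightarrow> bool" where
  "continues_to F z v \<longleftrightarrow>
     (\<exists>U h. open U \<and> connected U \<and> 0 \<in> U \<and> z \<in> U \<and> h holomorphic_on U \<and>
            (\<forall>\<^sub>F s in nhds 0. h s = eval_fps F s) \<and> h z = v)"

definition distilled_value :: "(real \<Rightarrow> complex) \<Rightarrow> complex \<Rightarrow> complex \<Rightarrow> bool" where
  "distilled_value f z v \<longleftrightarrow> (\<exists>F. is_analytic_distillate f F \<and> continues_to F z v)"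

text \<open>
  For a convergent power series \<open>f\<close> the real part of \<open>f (\<i> * s)\<close>, \<open>s\<close> real, is
  the value at \<open>\<i> * s\<close> of the power series of the following function of real \<open>\<phi>\<close>.
  This makes it possible to take the real part on the imaginary axis before distilling.
  It is needed for the tensor below: off the rotation axis the complementary part
  \<open>(f \<phi> - cnj (f (- \<phi>))) / 2\<close>, which would only yield imaginary values on the
  imaginary axis, has no asymptotic power series at 0 for some components. For the
  component xx, for instance, its expansion contains a non-zero multiple of
  \<open>x * y * \<phi> ^ 5 * ln \<bar>\<phi>\<bar>\<close>.
\<close>
definition imag_axis_real_part :: "(real \<Rightarrow> complex) \<Rightarrow> real \<Rightarrow> complex" where
  "imag_axis_real_part f \<phi> = (f \<phi> + cnj (f (- \<phi>))) / 2"


section \<open>The tensor at imaginary angular velocity\<close>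

datatype idx = It | Ix | Iy | Iz

definition cyl_radius :: "real \<Rightarrow> real \<Rightarrow> real" where
  "cyl_radius x y = sqrt (x^2 + y^2)"

definition Theta ::
    "real \<Rightarrow> real \<Rightarrow> real \<Rightarrow> real \<Rightarrow> real \<Rightarrow> nat \<Rightarrow> idx \<Rightarrow> idx \<Rightarrow> complex" where
  "Theta T0 \<xi> x y \<phi> n \<mu> \<nu> =
    (let r = cyl_radius x y;
         N = real n * \<phi>;
         Ttt = N^2 * (4*\<xi> + 2)
               + cos N * (N^2 * (1 - 4*\<xi>) + 2 * (8*\<xi> - 1) * r^2 * T0^2 * \<phi>^2)
               - cos (2*N) * (4*\<xi> - 1) * r^2 * T0^2 * \<phi>^2
               - (12*\<xi> - 1) * r^2 * T0^2 * \<phi>^2;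
         Txx = N^2 * (1 - 2*\<xi>)
               + 2 * cos N * (N^2 * \<xi> + (4*\<xi> - 1) * T0^2 * \<phi>^2 * (x^2 - 3*y^2))
               - 2 * (3*\<xi> - 1) * T0^2 * \<phi>^2 * (x^2 - 3*y^2)
               + 2 * T0^2 * \<phi>^2
                   * (x * y * (sin (2*N) - 2 * sin N) - \<xi> * (x^2 - 3*y^2) * cos (2*N));
         Tyy = N^2 * (1 - 2*\<xi>)
               + cos N * (2 * N^2 * \<xi> - 2 * (4*\<xi> - 1) * T0^2 * \<phi>^2 * (3*x^2 - y^2))
               + 2 * (3*\<xi> - 1) * T0^2 * \<phi>^2 * (3*x^2 - y^2)
               + 2 * T0^2 * \<phi>^2
                   * (x * y * (2 * sin N - sin (2*N)) + \<xi> * (3*x^2 - y^2) * cos (2*N));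
         Tzz = N^2 * (2 - 4*\<xi>)
               - cos N * (N^2 * (1 - 4*\<xi>)
                          - 2 * (4*\<xi> - 1) * r^2 * T0^2 * \<phi>^2 * cos N
                          + 2 * (8*\<xi> - 1) * r^2 * T0^2 * \<phi>^2)
               + 8 * \<xi> * r^2 * T0^2 * \<phi>^2;
         Ttx = - 2 * \<i> * of_real (N * (T0 * \<phi>) * (x * (cos N - 1) - 2 * y * sin N));
         Tty = 2 * \<i> * of_real (N * (T0 * \<phi>) * (- 2 * x * sin N - y * (cos N - 1)));
         Txy = 4 * T0^2 * \<phi>^2 * (sin (N / 2))^2
                 * (4 * x * y * (1 - 2*\<xi> + 2*\<xi> * cos N) + (x - y) * (x + y) * sin N)
     in case (\<mu>, \<nu>) of
          (It, It) \<Rightarrow> of_real Ttt | (Ix, Ix) \<Rightarrow> of_real Txx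
        | (Iy, Iy) \<Rightarrow> of_real Tyy | (Iz, Iz) \<Rightarrow> of_real Tzz
        | (It, Ix) \<Rightarrow> Ttx | (Ix, It) \<Rightarrow> Ttx
        | (It, Iy) \<Rightarrow> Tty | (Iy, It) \<Rightarrow> Tty
        | (Ix, Iy) \<Rightarrow> of_real Txy | (Iy, Ix) \<Rightarrow> of_real Txy
        | _ \<Rightarrow> 0)"

definition T_I_term ::
    "real \<Rightarrow> real \<Rightarrow> real \<Rightarrow> real \<Rightarrow> idx \<Rightarrow> idx \<Rightarrow> real \<Rightarrow> nat \<Rightarrow> complex" where
  "T_I_term T0 \<xi> x y \<mu> \<nu> \<phi> n =
     of_real (T0^4 * \<phi>^4 /
        (pi^2 * ((real n)^2 * \<phi>^2
                 + 4 * (sin (real n * \<phi> / 2))^2 * (cyl_radius x y)^2 * T0^2 * \<phi>^2)^3))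
     * Theta T0 \<xi> x y \<phi> n \<mu> \<nu>"

definition T_I ::
    "real \<Rightarrow> real \<Rightarrow> real \<Rightarrow> real \<Rightarrow> idx \<Rightarrow> idx \<Rightarrow> real \<Rightarrow> complex" where
  "T_I T0 \<xi> x y \<mu> \<nu> \<phi> = (\<Sum>k. T_I_term T0 \<xi> x y \<mu> \<nu> \<phi> (Suc k))"


section \<open>Decomposition along the tetrad\<close>

primrec four_vec :: "real \<Rightarrow> real \<Rightarrow> real \<Rightarrow> real \<Rightarrow> idx \<Rightarrow> real" where
  "four_vec a b c d It = a"
| "four_vec a b c d Ix = b"
| "four_vec a b c d Iy = c"
| "four_vec a b c d Iz = d"

definition metric :: "idx \<Rightarrow> idx \<Rightarrow> real" where
  "metric \<mu> \<nu> = (if \<mu> = \<nu> then four_vec 1 (-1) (-1) (-1) \<mu> else 0)"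

definition lorentz_gamma :: "real \<Rightarrow> real \<Rightarrow> real \<Rightarrow> real" where
  "lorentz_gamma \<omega> x y = 1 / sqrt (1 - (cyl_radius x y)^2 * \<omega>^2)"

definition u_vec :: "real \<Rightarrow> real \<Rightarrow> real \<Rightarrow> idx \<Rightarrow> real" where
  "u_vec \<omega> x y = (let \<gamma> = lorentz_gamma \<omega> x y in four_vec \<gamma> (- \<gamma> * y * \<omega>) (\<gamma> * x * \<omega>) 0)"

definition \<alpha>_vec :: "real \<Rightarrow> real \<Rightarrow> real \<Rightarrow> real \<Rightarrow> idx \<Rightarrow> real" where
  "\<alpha>_vec T0 \<omega> x y =
     (let \<gamma> = lorentz_gamma \<omega> x y
      in four_vec 0 (- (\<gamma> * x * \<omega>^2 / T0)) (- (\<gamma> * y * \<omega>^2 / T0)) 0)"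

definition w_vec :: "real \<Rightarrow> real \<Rightarrow> real \<Rightarrow> real \<Rightarrow> idx \<Rightarrow> real" where
  "w_vec T0 \<omega> x y = (let \<gamma> = lorentz_gamma \<omega> x y in four_vec 0 0 0 (\<gamma> * \<omega> / T0))"

definition l_vec :: "real \<Rightarrow> real \<Rightarrow> real \<Rightarrow> real \<Rightarrow> idx \<Rightarrow> real" where
  "l_vec T0 \<omega> x y =
     (let \<gamma> = lorentz_gamma \<omega> x y
      in four_vec (\<gamma> * (\<gamma>^2 - 1) * \<omega>^2 / T0^2)
           (- (\<gamma>^3 * y * \<omega>^3 / T0^2)) (\<gamma>^3 * x * \<omega>^3 / T0^2) 0)"

text \<open>
  In the scalars and coefficients below \<open>b2\<close>, \<open>a2\<close>, \<open>w2\<close> stand for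
  \<open>\<beta>\<close>, \<open>\<alpha>\<close>, \<open>w\<close> squared (so \<open>a2, w2 \<le> 0\<close>).
\<close>
definition \<beta>_sq :: "real \<Rightarrow> real \<Rightarrow> real \<Rightarrow> real \<Rightarrow> real" where
  "\<beta>_sq T0 \<omega> x y = 1 / (T0^2 * (lorentz_gamma \<omega> x y)^2)"

definition \<alpha>_sq :: "real \<Rightarrow> real \<Rightarrow> real \<Rightarrow> real \<Rightarrow> real" where
  "\<alpha>_sq T0 \<omega> x y = - (((lorentz_gamma \<omega> x y)^2 - 1) * (\<omega>^2 / T0^2))"

definition w_sq :: "real \<Rightarrow> real \<Rightarrow> real \<Rightarrow> real \<Rightarrow> real" where
  "w_sq T0 \<omega> x y = - ((lorentz_gamma \<omega> x y)^2 * (\<omega>^2 / T0^2))"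

definition rho_coeff :: "real \<Rightarrow> real \<Rightarrow> real \<Rightarrow> real \<Rightarrow> real" where
  "rho_coeff \<xi> b2 a2 w2 = 1 / b2^2 *
     (pi^2 / 30 + (4*\<xi> - 1) / 12 * w2 + (6*\<xi> - 1) / 12 * a2
      + (4*\<xi> - 1) / (48 * pi^2) * w2^2 + (60*\<xi> - 11) / (480 * pi^2) * a2^2
      + (270*\<xi> - 61) / (720 * pi^2) * (a2 * w2))"

definition p_coeff :: "real \<Rightarrow> real \<Rightarrow> real \<Rightarrow> real \<Rightarrow> real" where
  "p_coeff \<xi> b2 a2 w2 = 1 / b2^2 *
     (pi^2 / 90 - \<xi> / 6 * w2 + (1 - 6*\<xi>) / 18 * a2
      - \<xi> / (24 * pi^2) * w2^2 + (19 - 120*\<xi>) / (1440 * pi^2) * a2^2)"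

definition W_coeff :: "real \<Rightarrow> real \<Rightarrow> real \<Rightarrow> real \<Rightarrow> real" where
  "W_coeff \<xi> b2 a2 w2 = 1 / b2^2 *
     ((2*\<xi> - 1) / 12 + (2*\<xi> - 1) / (48 * pi^2) * w2 + (120*\<xi> - 29) / (360 * pi^2) * a2)"

definition A_coeff :: "real \<Rightarrow> real \<Rightarrow> real \<Rightarrow> real \<Rightarrow> real" where
  "A_coeff \<xi> b2 a2 w2 = 1 / b2^2 *
     ((1 - 6*\<xi>) / 12 + w2 / (360 * pi^2) + (1 - 6*\<xi>) / (48 * pi^2) * a2)"

definition Gl_coeff :: "real \<Rightarrow> real \<Rightarrow> real" where
  "Gl_coeff \<xi> b2 = (1 - 70*\<xi>) / (240 * pi^2 * b2^2)"

definition G_coeff :: "real \<Rightarrow> real \<Rightarrow> real \<Rightarrow> real \<Rightarrow> real" where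
  "G_coeff \<xi> b2 a2 w2 = 1 / b2^2 *
     ((6*\<xi> + 1) / 36 + (10*\<xi> - 1) / (240 * pi^2) * w2 + (30*\<xi> - 7) / (720 * pi^2) * a2)"

text \<open>
  \<open>Aq\<close> is the coefficient of \<open>\<alpha>\<alpha>\<close>, \<open>Au\<close> that of the
  symmetrised \<open>\<alpha>u\<close>, \<open>Wq\<close> and \<open>Wu\<close> likewise for \<open>w\<close>.
\<close>
definition decomposition ::
    "(idx \<Rightarrow> real) \<Rightarrow> (idx \<Rightarrow> real) \<Rightarrow> (idx \<Rightarrow> real) \<Rightarrow> (idx \<Rightarrow> real)
     \<Rightarrow> real \<Rightarrow> real \<Rightarrow> real \<Rightarrow> real \<Rightarrow> real \<Rightarrow> real \<Rightarrow> real \<Rightarrow> real \<Rightarrow> real \<Rightarrow> real \<Rightarrow> real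
     \<Rightarrow> idx \<Rightarrow> idx \<Rightarrow> real" where
  "decomposition u a w l \<rho> p Wq Aq Gl G Au Ga Wu Aw Gw \<mu> \<nu> =
     \<rho> * u \<mu> * u \<nu> - p * (metric \<mu> \<nu> - u \<mu> * u \<nu>) + Wq * w \<mu> * w \<nu> + Aq * a \<mu> * a \<nu>
     + Gl * l \<mu> * l \<nu> + G * (l \<mu> * u \<nu> + l \<nu> * u \<mu>) + Au * (a \<mu> * u \<nu> + a \<nu> * u \<mu>)
     + Ga * (l \<mu> * a \<nu> + l \<nu> * a \<mu>) + Wu * (w \<mu> * u \<nu> + w \<nu> * u \<mu>)
     + Aw * (a \<mu> * w \<nu> + a \<nu> * w \<mu>) + Gw * (l \<mu> * w \<nu> + l \<nu> * w \<mu>)"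

end

theory Submission
  imports Defs "HOL-Complex_Analysis.Complex_Analysis"
    "HOL-Computational_Algebra.Fundamental_Theorem_Algebra"
begin

text \<open>
  Write \<open>t = n \<phi>\<close> and \<open>\<rho> = r T\<^sub>0\<close>. Every component of the tensor is a combination of sums over
  \<open>n\<close> of \<open>E t / (t\<^sup>2 (1 + \<rho>\<^sup>2 \<phi>\<^sup>2 q t))\<^sup>3\<close> with \<open>E\<close> elementary and
  \<open>q t = (sin (t / 2) / (t / 2))\<^sup>2\<close>. Expanding in powers of \<open>\<rho>\<^sup>2 \<phi>\<^sup>2\<close> leaves sums
  \<open>\<Sum>n. H (n \<phi>)\<close> with \<open>H\<close> a combination of \<open>cos (m t) / t\<^sup>2\<^sup>j\<close> and
  \<open>sin (m t) / t\<^sup>2\<^sup>j\<^sup>+\<^sup>1\<close>. By the Fourier series of the Bernoulli polynomials such a sum is, for small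
  \<open>\<phi> > 0\<close>, exactly \<open>\<Sum>i. h i * \<zeta>(2 i) / \<phi>\<^sup>2\<^sup>i + C / \<phi>\<close>, where \<open>h i\<close> is the
  coefficient of \<open>1 / t\<^sup>2\<^sup>i\<close> in the Laurent series of \<open>H\<close>. The terms \<open>C / \<phi>\<close> have the wrong parity
  and are removed by distilling; the others add up to a rational function whose only poles are at
  \<open>\<phi> = \<plusminus>\<i> / \<rho>\<close>, beyond \<open>\<i> \<omega> / T\<^sub>0\<close>.

  The parts of the components which are purely imaginary on the imaginary axis have odd numerators.
  For them the term \<open>1 / t\<close> of \<open>H\<close> produces a harmonic sum, hence a logarithm of \<open>\<phi>\<close>, so that
  a component with such a part has no asymptotic power series at all.
\<close>

section \<open>Fourier series of the Bernoulli polynomials\<close>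

text \<open>The exact evaluation of the k-th lattice sum holds only below a threshold depending on
  k: each factor \<open>sinc_sq\<close> raises the highest frequency by one, and the Bernoulli
  formula needs frequency times \<phi> to be at most 2 pi. Hence only finitely many orders are used
  at a time, and the rational function arises as an asymptotic series, not as an identity for fixed
  \<phi>. The truncation error is uniform in n because 0 \<le> \<open>sinc_sq\<close> \<le> 1 and
  the sum of 1 / n^4 converges. Its denominator has a fifth power because the constant Laurent
  coefficient of E / t^6 times \<open>sinc_sq ^ k\<close> is quadratic in k, which brings in two
  derivatives of (1 + u)^(-3). If a component has a non-zero odd part, the claim about
  \<open>T_I\<close> itself is an implication with a false premise: at \<phi> = 1 / M an asymptotic
  series becomes, after scaling, a polynomial in M up to a bounded error, whereas non-zero multiples
  of the harmonic numbers stay at bounded distance from no polynomial.\<close>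

lemma summable_inverse_Suc_power:
  assumes "k \<ge> 2"
  shows "summable (\<lambda>n. 1 / real (Suc n) ^ k)"
  using summable_Suc_iff[of "\<lambda>n. inverse (real n ^ k)"] inverse_power_summable[OF assms, where 'a = real]
  by (simp add: field_simps)

lemma suminf_deriv_bounded:
  fixes f f' :: "nat \<Rightarrow> real \<Rightarrow> real"
  assumes "\<And>n x. (f n has_field_derivative f' n x) (at x)"
    and "\<And>n x. \<bar>f' n x\<bar> \<le> M n" and "summable M" and "summable (\<lambda>n. f n 0)"
  shows "((\<lambda>x. \<Sum>n. f n x) has_field_derivative (\<Sum>n. f' n x)) (at x)"
proof -
  have "uniformly_convergent_on UNIV (\<lambda>n x. \<Sum>i<n. f' i x)"
    by (rule Weierstrass_m_test'[where M = M]) (use assms in auto)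
  from has_field_derivative_series'(2)[where f = f and f' = f', OF convex_UNIV _ this UNIV_I assms(4)] assms(1)
  show ?thesis by simp
qed

text \<open>The real part of the polylogarithm of order 2 j at exp (i \<theta>);
  \<open>sin_zeta j\<close> is the imaginary part for order 2 j + 1.\<close>

definition cos_zeta :: "nat \<Rightarrow> real \<Rightarrow> real" where
  "cos_zeta j \<theta> = (\<Sum>n. cos (real (Suc n) * \<theta>) / real (Suc n) ^ (2 * j))"

definition sin_zeta :: "nat \<Rightarrow> real \<Rightarrow> real" where
  "sin_zeta j \<theta> = (\<Sum>n. sin (real (Suc n) * \<theta>) / real (Suc n) ^ (2 * j + 1))"

text \<open>\<open>even_zeta j = \<zeta>(2 j)\<close>, including \<open>\<zeta>(0) = - 1 / 2\<close>.\<close>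
definition even_zeta :: "nat \<Rightarrow> real" where
  "even_zeta j = (if j = 0 then - 1 / 2 else (\<Sum>n. 1 / real (Suc n) ^ (2 * j)))"

text \<open>Multiples of Bernoulli polynomials in \<theta> / (2 pi). The sum is the Taylor series of
  the cosine, summed over n term by term with regularised zeta values and cut off because
  \<open>\<zeta>(-2), \<zeta>(-4), ...\<close> vanish; the extra term stems from the pole of zeta at
  1.\<close>

definition cos_zeta_poly :: "nat \<Rightarrow> real \<Rightarrow> real" where
  "cos_zeta_poly j \<theta> = (\<Sum>i\<le>j. (-1) ^ i * \<theta> ^ (2 * i) / fact (2 * i) * even_zeta (j - i))
     + (-1) ^ j * pi * \<theta> ^ (2 * j - 1) / (2 * fact (2 * j - 1))"

definition sin_zeta_poly :: "nat \<Rightarrow> real \<Rightarrow> real" where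
  "sin_zeta_poly j \<theta> = (\<Sum>i\<le>j. (-1) ^ i * \<theta> ^ (2 * i + 1) / fact (2 * i + 1) * even_zeta (j - i))
     + (-1) ^ j * pi * \<theta> ^ (2 * j) / (2 * fact (2 * j))"

lemma summable_cos_zeta:
  assumes "j \<ge> 1"
  shows "summable (\<lambda>n. cos (real (Suc n) * \<theta>) / real (Suc n) ^ (2 * j))"
  by (rule summable_comparison_test'[OF summable_inverse_Suc_power[of "2 * j"], of 0])
     (use assms in \<open>auto simp: divide_simps\<close>)

lemma summable_sin_zeta:
  assumes "j \<ge> 1"
  shows "summable (\<lambda>n. sin (real (Suc n) * \<theta>) / real (Suc n) ^ (2 * j + 1))"
  by (rule summable_comparison_test'[OF summable_inverse_Suc_power[of "2 * j + 1"], of 0])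
     (use assms in \<open>auto simp: divide_simps\<close>)

lemma DERIV_sin_zeta:
  assumes "j \<ge> 1"
  shows "(sin_zeta j has_field_derivative cos_zeta j \<theta>) (at \<theta>)"
proof -
  have "((\<lambda>\<theta>. \<Sum>n. sin (real (Suc n) * \<theta>) / real (Suc n) ^ (2 * j + 1)) has_field_derivative
      (\<Sum>n. cos (real (Suc n) * \<theta>) / real (Suc n) ^ (2 * j))) (at \<theta>)"
  proof (rule suminf_deriv_bounded[where M = "\<lambda>n. 1 / real (Suc n) ^ (2 * j)"])
    show "((\<lambda>\<theta>. sin (real (Suc n) * \<theta>) / real (Suc n) ^ (2 * j + 1)) has_field_derivative
        cos (real (Suc n) * x) / real (Suc n) ^ (2 * j)) (at x)" for n x
      by (auto intro!: derivative_eq_intros simp del: of_nat_Suc)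
    show "\<bar>cos (real (Suc n) * x) / real (Suc n) ^ (2 * j)\<bar> \<le> 1 / real (Suc n) ^ (2 * j)" for n x
      by (simp add: divide_simps)
    show "summable (\<lambda>n. 1 / real (Suc n) ^ (2 * j))"
      by (rule summable_inverse_Suc_power) (use assms in auto)
  qed simp
  thus ?thesis unfolding sin_zeta_def[abs_def] cos_zeta_def .
qed

lemma DERIV_cos_zeta:
  assumes "j \<ge> 1"
  shows "(cos_zeta (Suc j) has_field_derivative - sin_zeta j \<theta>) (at \<theta>)"
proof -
  have "((\<lambda>\<theta>. \<Sum>n. cos (real (Suc n) * \<theta>) / real (Suc n) ^ (2 * Suc j)) has_field_derivative
      (\<Sum>n. - (sin (real (Suc n) * \<theta>) / real (Suc n) ^ (2 * j + 1)))) (at \<theta>)"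
  proof (rule suminf_deriv_bounded[where M = "\<lambda>n. 1 / real (Suc n) ^ (2 * j + 1)"])
    show "((\<lambda>\<theta>. cos (real (Suc n) * \<theta>) / real (Suc n) ^ (2 * Suc j)) has_field_derivative
        - (sin (real (Suc n) * x) / real (Suc n) ^ (2 * j + 1))) (at x)" for n x
      by (auto intro!: derivative_eq_intros simp del: of_nat_Suc simp: power2_eq_square)
    show "\<bar>- (sin (real (Suc n) * x) / real (Suc n) ^ (2 * j + 1))\<bar> \<le> 1 / real (Suc n) ^ (2 * j + 1)" for n x
      by (simp add: divide_simps)
    show "summable (\<lambda>n. 1 / real (Suc n) ^ (2 * j + 1))"
      by (rule summable_inverse_Suc_power) (use assms in auto)
    show "summable (\<lambda>n. cos (real (Suc n) * 0) / real (Suc n) ^ (2 * Suc j))"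
      by (rule summable_cos_zeta) simp
  qed
  also have "(\<Sum>n. - (sin (real (Suc n) * \<theta>) / real (Suc n) ^ (2 * j + 1))) = - sin_zeta j \<theta>"
    unfolding sin_zeta_def by (rule suminf_minus) (rule summable_sin_zeta[OF assms])
  finally show ?thesis unfolding cos_zeta_def[abs_def] .
qed

text \<open>Two shapes, with and without a trailing constant factor, match the summands of the
  polynomials and their extra term. The exponent is tied to its predecessor by an equation because 2
  * j - 1 is not syntactically below a successor.\<close>

lemma DERIV_monomial:
  assumes "k = Suc l"
  shows "((\<lambda>\<theta>. a * \<theta> ^ k / b * c) has_field_derivative a * (real k * \<theta> ^ l) / b * c) (at \<theta>)"
    and "((\<lambda>\<theta>. a * \<theta> ^ k / b) has_field_derivative a * (real k * \<theta> ^ l) / b) (at \<theta>)"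
  using DERIV_cmult[OF DERIV_pow, of "a / b * c" k \<theta> UNIV] DERIV_cmult[OF DERIV_pow, of "a / b" k \<theta> UNIV] assms
  by (simp_all add: mult_ac)

lemma DERIV_sin_zeta_poly:
  assumes "j \<ge> 1"
  shows "(sin_zeta_poly j has_field_derivative cos_zeta_poly j \<theta>) (at \<theta>)"
proof -
  have f: "fact (2 * j) = (2 * real j) * fact (2 * j - 1)"
    using assms by (subst fact_reduce) auto
  have f': "fact (2 * i + 1) = (2 * real i + 1) * fact (2 * i)" for i
    by (simp add: fact_reduce)
  have 1: "(\<Sum>i\<le>j. (-1) ^ i * ((2 * real i + 1) * \<theta> ^ (2 * i)) / fact (2 * i + 1) * even_zeta (j - i))
     = (\<Sum>i\<le>j. (-1) ^ i * \<theta> ^ (2 * i) / fact (2 * i) * even_zeta (j - i))"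
  proof (intro sum.cong refl)
    fix i
    have "2 * real i + 1 \<noteq> 0" by linarith
    thus "(-1) ^ i * ((2 * real i + 1) * \<theta> ^ (2 * i)) / fact (2 * i + 1) * even_zeta (j - i)
        = (-1) ^ i * \<theta> ^ (2 * i) / fact (2 * i) * even_zeta (j - i)"
      unfolding f' by (simp add: divide_simps)
  qed
  have 2: "(-1) ^ j * pi * (2 * real j * \<theta> ^ (2 * j - 1)) / (2 * fact (2 * j))
     = (-1) ^ j * pi * \<theta> ^ (2 * j - 1) / (2 * fact (2 * j - 1))"
    unfolding f using assms by (simp add: divide_simps)
  have "(sin_zeta_poly j has_field_derivative
     (\<Sum>i\<le>j. (-1) ^ i * (real (2 * i + 1) * \<theta> ^ (2 * i)) / fact (2 * i + 1) * even_zeta (j - i))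
     + (-1) ^ j * pi * (real (2 * j) * \<theta> ^ (2 * j - 1)) / (2 * fact (2 * j))) (at \<theta>)"
    unfolding sin_zeta_poly_def[abs_def]
    by (intro DERIV_add DERIV_sum DERIV_monomial) (use assms in simp_all)
  thus ?thesis using 1 2 by (simp add: cos_zeta_poly_def add.commute)
qed

lemma DERIV_cos_zeta_poly:
  assumes "j \<ge> 1"
  shows "(cos_zeta_poly (Suc j) has_field_derivative - sin_zeta_poly j \<theta>) (at \<theta>)"
proof -
  have f': "fact (2 * Suc i) = (2 * real i + 2) * fact (2 * i + 1)" for i
    by (simp add: fact_reduce)
  have f: "fact (2 * j + 1) = (2 * real j + 1) * fact (2 * j)"
    by (simp add: fact_reduce)
  \<comment> \<open>The term i = 0 is constant and is split off first: its derivative has no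
    counterpart in \<open>sin_zeta_poly j\<close>.\<close>
  have eq: "cos_zeta_poly (Suc j) = (\<lambda>\<theta>. even_zeta (Suc j) +
      (\<Sum>i\<le>j. (-1) ^ Suc i * \<theta> ^ (2 * Suc i) / fact (2 * Suc i) * even_zeta (j - i))
       + (-1) ^ Suc j * pi * \<theta> ^ (2 * j + 1) / (2 * fact (2 * j + 1)))"
    unfolding cos_zeta_poly_def by (rule ext, subst sum.atMost_Suc_shift) simp
  have 1: "(\<Sum>i\<le>j. (-1) ^ Suc i * (real (2 * Suc i) * \<theta> ^ (2 * i + 1)) / fact (2 * Suc i) * even_zeta (j - i))
     = - (\<Sum>i\<le>j. (-1) ^ i * \<theta> ^ (2 * i + 1) / fact (2 * i + 1) * even_zeta (j - i))"
    unfolding f' sum_negf[symmetric] by (intro sum.cong refl) (simp add: divide_simps)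
  have 2: "(-1) ^ Suc j * pi * (real (2 * j + 1) * \<theta> ^ (2 * j)) / (2 * fact (2 * j + 1))
     = - ((-1) ^ j * pi * \<theta> ^ (2 * j) / (2 * fact (2 * j)))"
    unfolding f by (simp add: divide_simps)
  have "(cos_zeta_poly (Suc j) has_field_derivative
     (\<Sum>i\<le>j. (-1) ^ Suc i * (real (2 * Suc i) * \<theta> ^ (2 * i + 1)) / fact (2 * Suc i) * even_zeta (j - i))
     + (-1) ^ Suc j * pi * (real (2 * j + 1) * \<theta> ^ (2 * j)) / (2 * fact (2 * j + 1))) (at \<theta>)"
    unfolding eq
    by (intro DERIV_add[of "\<lambda>\<theta>. even_zeta (Suc j) + _ \<theta>", OF DERIV_add[OF DERIV_const, unfolded add_0]]
        DERIV_sum DERIV_monomial) simp_all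
  thus ?thesis unfolding 1 2 sin_zeta_poly_def by (simp add: algebra_simps)
qed

text \<open>Polar form: 1 - exp (i s) = 2 sin (s/2) exp (i (s - pi)/2), whose angle lies in the
  range of the principal logarithm.\<close>

lemma Ln_one_minus_cis:
  assumes "0 < s" "s < 2 * pi"
  shows "1 - cis s \<notin> \<real>\<^sub>\<le>\<^sub>0" "Im (Ln (1 - cis s)) = (s - pi) / 2"
proof -
  have pos: "sin (s / 2) > 0" using assms by (intro sin_gt_zero) auto
  define w where "w = Complex (ln (2 * sin (s / 2))) ((s - pi) / 2)"
  have a1: "cos ((s - pi) / 2) = sin (s / 2)"
    using cos_diff[of "s/2" "pi/2"] by (simp add: diff_divide_distrib)
  have a2: "sin ((s - pi) / 2) = - cos (s / 2)"
    using sin_diff[of "s/2" "pi/2"] by (simp add: diff_divide_distrib)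
  have c1: "cos s = 1 - 2 * sin (s / 2) ^ 2" using cos_double_sin[of "s/2"] by simp
  have c2: "sin s = 2 * sin (s / 2) * cos (s / 2)" using sin_double[of "s/2"] by simp
  have "exp w = 1 - cis s"
    using pos by (simp add: w_def exp_eq_polar complex_eq_iff a1 a2 c1 c2 power2_eq_square)
  moreover have "Ln (exp w) = w"
    using assms by (intro Ln_exp) (auto simp: w_def)
  ultimately show "Im (Ln (1 - cis s)) = (s - pi) / 2" by (simp add: w_def)
  have "Re (1 - cis s) > 0" using pos by (simp add: c1)
  thus "1 - cis s \<notin> \<real>\<^sub>\<le>\<^sub>0" by (auto simp: complex_nonpos_Reals_iff)
qed

lemma even_zeta_0: "even_zeta 0 = - 1 / 2"
  by (simp add: even_zeta_def)

lemma even_zeta_1: "even_zeta (Suc 0) = pi\<^sup>2 / 6"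
proof -
  have "even_zeta (Suc 0) = (\<Sum>n. 1 / (real n + 1) ^ 2)"
    unfolding even_zeta_def by (simp add: add.commute numeral_2_eq_2)
  thus ?thesis using sums_unique[OF inverse_squares_sums] by (simp add: add.commute)
qed

text \<open>Abel summation: the damped series is differentiated termwise into the logarithm, and the
  damping is removed by dominated convergence.\<close>
lemma cos_zeta_1:
  assumes "0 \<le> \<theta>" "\<theta> \<le> 2 * pi"
  shows "cos_zeta 1 \<theta> = pi\<^sup>2 / 6 - pi * \<theta> / 2 + \<theta>\<^sup>2 / 4"
proof -
  \<comment> \<open>Damping factors in (0, 1) tending to 1; the shift by 2 keeps the first one
    positive.\<close>
  define r where "r k = 1 - 1 / real (k + 2)" for k
  have r: "0 < r k" "r k < 1" for k by (auto simp: r_def field_simps)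
  have r_lim: "r \<longlonglongrightarrow> 1"
  proof -
    have "(\<lambda>k. 1 / real (k + 2)) \<longlonglongrightarrow> 0"
      using LIMSEQ_ignore_initial_segment[OF lim_1_over_n, of 2] by simp
    from tendsto_diff[OF tendsto_const[of 1] this] show ?thesis by (simp add: r_def[abs_def])
  qed
  define f where "f k t = (\<Sum>n. r k ^ Suc n * cos (real (Suc n) * t) / real (Suc n) ^ 2)" for k t
  \<comment> \<open>The termwise derivative of the damped series, identified through - Ln (1 - z) =
    sum of z^n / n with z = r exp (i t).\<close>
  define f' where "f' k t = Im (Ln (1 - of_real (r k) * cis t))" for k t
  have f'_sums: "(\<lambda>n. - (r k ^ Suc n * sin (real (Suc n) * t) / real (Suc n))) sums f' k t" for k t
  proof -
    have "(\<lambda>n. - ((of_real (r k) * cis t) ^ n) / of_nat n) sums ln (1 - of_real (r k) * cis t)"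
      using Ln_series'[of "- (of_real (r k) * cis t)"] r[of k] by (simp add: norm_mult)
    from sums_Im[OF this] have "(\<lambda>n. Im (- ((of_real (r k) * cis t) ^ n) / of_nat n)) sums f' k t"
      by (simp add: f'_def)
    hence *: "(\<lambda>n. Im (- ((of_real (r k) * cis t) ^ Suc n) / of_nat (Suc n))) sums f' k t"
      by (subst sums_Suc_iff) simp
    have "Im (cis t ^ Suc n) = sin (real (Suc n) * t)" for n
      by (simp only: Complex.DeMoivre cis.sel)
    hence **: "Im (- ((of_real (r k) * cis t) ^ Suc n) / of_nat (Suc n))
        = - (r k ^ Suc n * sin (real (Suc n) * t) / real (Suc n))" for n
      unfolding power_mult_distrib by (simp add: of_real_power[symmetric] del: power_Suc of_nat_Suc of_real_power)
    show ?thesis using * unfolding ** .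
  qed
  have deriv: "(f k has_field_derivative f' k t) (at t)" for k t
  proof -
    have "(f k has_field_derivative (\<Sum>n. - (r k ^ Suc n * sin (real (Suc n) * t) / real (Suc n)))) (at t)"
      unfolding f_def
    proof (rule suminf_deriv_bounded[where M = "\<lambda>n. r k ^ Suc n"])
      show "((\<lambda>t. r k ^ Suc n * cos (real (Suc n) * t) / real (Suc n) ^ 2) has_field_derivative
          - (r k ^ Suc n * sin (real (Suc n) * x) / real (Suc n))) (at x)" for n x
        by (auto intro!: derivative_eq_intros simp del: of_nat_Suc power_Suc simp: power2_eq_square)
      show "\<bar>- (r k ^ Suc n * sin (real (Suc n) * x) / real (Suc n))\<bar> \<le> r k ^ Suc n" for n x
      proof -
        have "\<bar>sin (real (Suc n) * x)\<bar> / real (Suc n) \<le> 1"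
          using abs_sin_le_one[of "real (Suc n) * x"] by (subst divide_le_eq_1_pos) linarith+
        from mult_left_mono[OF this, of "r k ^ Suc n"] r[of k] show ?thesis
          by (simp add: abs_mult)
      qed
      show "summable (\<lambda>n. r k ^ Suc n)"
        using r[of k] by (subst summable_Suc_iff) (intro summable_geometric, simp)
      show "summable (\<lambda>n. r k ^ Suc n * cos (real (Suc n) * 0) / real (Suc n) ^ 2)"
        by (rule summable_comparison_test'[OF summable_inverse_Suc_power[of 2], of 0])
           (use r[of k] in \<open>auto simp: divide_simps power_le_one simp del: power_Suc\<close>)
    qed
    thus ?thesis using sums_unique[OF f'_sums[of k t]] by simp
  qed
  have int: "integral {0..\<theta>} (f' k) = f k \<theta> - f k 0" "f' k integrable_on {0..\<theta>}" for k
  proof -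
    have "(f' k has_integral f k \<theta> - f k 0) {0..\<theta>}"
      using assms deriv by (intro fundamental_theorem_of_calculus)
        (auto simp: has_real_derivative_iff_has_vector_derivative[symmetric] intro: has_field_derivative_at_within)
    thus "integral {0..\<theta>} (f' k) = f k \<theta> - f k 0" "f' k integrable_on {0..\<theta>}"
      by (auto simp: has_integral_iff)
  qed
  \<comment> \<open>The pointwise limit of \<open>f' k\<close>. At 0 and 2 pi the argument 1 - r is
    a positive real, so the limit is 0 there; these two points do not affect the integral.\<close>
  define g where "g s = (if s = 0 \<or> s = 2 * pi then 0 else (s - pi) / 2)" for s :: real
  have lim1: "(\<lambda>k. integral {0..\<theta>} (f' k)) \<longlonglongrightarrow> integral {0..\<theta>} g"
  \<comment> \<open>The principal argument is bounded by pi whatever the damping, which gives a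
    constant majorant.\<close>
  proof (rule dominated_convergence(2)[where h = "\<lambda>_. pi"])
    show "norm (f' k s) \<le> pi" for k s
    proof -
      have "cmod (of_real (r k) * cis s) < 1" using r[of k] by (simp add: norm_mult)
      hence "1 - of_real (r k) * cis s \<noteq> 0" by auto
      from mpi_less_Im_Ln[OF this] Im_Ln_le_pi[OF this] show ?thesis by (auto simp: f'_def)
    qed
    show "(\<lambda>k. f' k s) \<longlonglongrightarrow> g s" if "s \<in> {0..\<theta>}" for s
    proof (cases "s = 0 \<or> s = 2 * pi")
      case True
      hence "cis s = 1" by (auto simp: complex_eq_iff)
      hence "f' k s = 0" for k using r[of k] Ln_of_real[of "1 - r k"] by (simp add: f'_def)
      thus ?thesis using True by (simp add: g_def)
    next
      case False
      hence s: "0 < s" "s < 2 * pi" using that assms by auto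
      have "(\<lambda>k. f' k s) \<longlonglongrightarrow> Im (Ln (1 - of_real 1 * cis s))"
        unfolding f'_def by (intro tendsto_intros r_lim) (use Ln_one_minus_cis(1)[OF s] in simp)
      thus ?thesis using False Ln_one_minus_cis(2)[OF s] by (simp add: g_def)
    qed
  qed (use int in auto)
  have "integral {0..\<theta>} g = integral {0..\<theta>} (\<lambda>s. (s - pi) / 2)"
    by (rule integral_spike[of "{0, 2 * pi}"]) (auto simp: g_def)
  also have "\<dots> = (\<theta>\<^sup>2 / 4 - pi * \<theta> / 2) - (0\<^sup>2 / 4 - pi * 0 / 2)"
    using assms
    by (intro integral_unique fundamental_theorem_of_calculus)
       (auto simp: has_real_derivative_iff_has_vector_derivative[symmetric] field_simps intro!: derivative_eq_intros)
  finally have int_g: "integral {0..\<theta>} g = \<theta>\<^sup>2 / 4 - pi * \<theta> / 2" by simp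
  have f_lim: "(\<lambda>k. f k t) \<longlonglongrightarrow> cos_zeta 1 t" for t
  proof -
    have "(\<lambda>k. \<Sum>n. r k ^ Suc n * cos (real (Suc n) * t) / real (Suc n) ^ 2) \<longlonglongrightarrow>
        (\<Sum>n. 1 ^ Suc n * cos (real (Suc n) * t) / real (Suc n) ^ 2)"
    proof (rule tannerys_theorem[THEN conjunct2, THEN conjunct2])
      show "((\<lambda>k. r k ^ Suc n * cos (real (Suc n) * t) / real (Suc n) ^ 2) \<longlongrightarrow>
          1 ^ Suc n * cos (real (Suc n) * t) / real (Suc n) ^ 2) sequentially" for n
        by (intro tendsto_intros r_lim) auto
      have "norm (r k ^ Suc n * cos (real (Suc n) * t) / real (Suc n) ^ 2) \<le> 1 / real (Suc n) ^ 2" for n k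
      proof -
        have "r k ^ Suc n \<le> 1" using r[of k] by (intro power_le_one) auto
        hence "r k ^ Suc n * \<bar>cos (real (Suc n) * t)\<bar> \<le> 1 * 1"
          using r[of k] by (intro mult_mono) (auto simp del: power_Suc)
        thus ?thesis using r[of k] by (simp add: abs_mult divide_simps del: power_Suc of_nat_Suc)
      qed
      thus "\<forall>\<^sub>F (n, k) in at_top \<times>\<^sub>F sequentially.
          norm (r k ^ Suc n * cos (real (Suc n) * t) / real (Suc n) ^ 2) \<le> 1 / real (Suc n) ^ 2"
        by (auto intro!: always_eventually simp del: of_nat_Suc power_Suc)
      show "summable (\<lambda>n. 1 / real (Suc n) ^ 2)" by (rule summable_inverse_Suc_power) simp
    qed auto
    thus ?thesis by (simp add: f_def cos_zeta_def)
  qed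
  have "(\<lambda>k. integral {0..\<theta>} (f' k)) \<longlonglongrightarrow> cos_zeta 1 \<theta> - cos_zeta 1 0"
    unfolding int(1) by (intro tendsto_diff f_lim)
  from LIMSEQ_unique[OF this lim1] have "cos_zeta 1 \<theta> - cos_zeta 1 0 = \<theta>\<^sup>2 / 4 - pi * \<theta> / 2"
    using int_g by simp
  moreover have "cos_zeta 1 0 = pi\<^sup>2 / 6"
    using even_zeta_1 by (simp add: cos_zeta_def even_zeta_def)
  ultimately show ?thesis by simp
qed

lemma zeta_antiderivative:
  fixes f g :: "real \<Rightarrow> real"
  assumes "\<And>x. (f has_field_derivative f' x) (at x)" "\<And>x. (g has_field_derivative g' x) (at x)"
    and "\<And>x. 0 \<le> x \<Longrightarrow> x \<le> b \<Longrightarrow> f' x = g' x" and "f 0 = g 0" and "0 \<le> x" "x \<le> b"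
  shows "f x = g x"
proof -
  have "((\<lambda>x. f x - g x) has_field_derivative 0) (at y within {0..b})" if "y \<in> {0..b}" for y
    using DERIV_diff[OF assms(1)[of y] assms(2)[of y]] assms(3)[of y] that
    by (auto intro: has_field_derivative_at_within)
  then obtain c where c: "\<And>y. y \<in> {0..b} \<Longrightarrow> f y - g y = c"
    using has_field_derivative_zero_constant[of "{0..b}" "\<lambda>x. f x - g x"] by auto
  show ?thesis using c[of 0] c[of x] assms by simp
qed

text \<open>Integration from 0 climbs from \<open>cos_zeta 1\<close> to a sine series, then to the
  next cosine series, and so on. The constants of integration are the values at 0, namely 0 for
  sines and \<open>\<zeta>(2 j)\<close> for cosines, so zeta values may stay symbolic.\<close>

lemma cos_sin_zeta_eq_poly:
  assumes "j \<ge> 1" "0 \<le> \<theta>" "\<theta> \<le> 2 * pi"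
  shows "cos_zeta j \<theta> = cos_zeta_poly j \<theta>" and "sin_zeta j \<theta> = sin_zeta_poly j \<theta>"
proof -
  have step: "sin_zeta j \<theta> = sin_zeta_poly j \<theta>"
    if "\<And>\<theta>. 0 \<le> \<theta> \<Longrightarrow> \<theta> \<le> 2 * pi \<Longrightarrow> cos_zeta j \<theta> = cos_zeta_poly j \<theta>" "j \<ge> 1" "0 \<le> \<theta>" "\<theta> \<le> 2 * pi"
    for j \<theta>
    by (rule zeta_antiderivative[OF DERIV_sin_zeta DERIV_sin_zeta_poly _ _ that(3,4)])
       (use that in \<open>auto simp: sin_zeta_def sin_zeta_poly_def\<close>)
  have "\<forall>\<theta>. 0 \<le> \<theta> \<longrightarrow> \<theta> \<le> 2 * pi \<longrightarrow> cos_zeta j \<theta> = cos_zeta_poly j \<theta>" using assms(1)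
  proof (induction j rule: nat_induct_at_least)
    case base
    show ?case using cos_zeta_1
      by (simp add: cos_zeta_poly_def even_zeta_0 even_zeta_1)
  next
    case (Suc j)
    have z: "cos_zeta (Suc j) 0 = cos_zeta_poly (Suc j) 0"
      unfolding cos_zeta_poly_def cos_zeta_def by (subst sum.atMost_Suc_shift) (simp add: even_zeta_def)
    show ?case
      by (intro allI impI, rule zeta_antiderivative[OF DERIV_cos_zeta DERIV_cos_zeta_poly _ z])
         (use Suc step[of j] in auto)
  qed
  thus "cos_zeta j \<theta> = cos_zeta_poly j \<theta>" using assms by blast
  show "sin_zeta j \<theta> = sin_zeta_poly j \<theta>"
    by (rule step) (use assms \<open>\<forall>\<theta>. _ \<theta>\<close> in auto)
qed

text \<open>At \<theta> = pi every sine vanishes, and the polynomial formula becomes a linear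
  equation for \<open>\<zeta>(4)\<close>.\<close>

lemma even_zeta_2: "even_zeta 2 = pi ^ 4 / 90"
proof -
  have "sin_zeta 2 pi = 0" by (simp add: sin_zeta_def sin_npi[simplified] del: of_nat_Suc)
  hence "sin_zeta_poly 2 pi = 0" using cos_sin_zeta_eq_poly(2)[of 2 pi] by simp
  moreover have "{..2 :: nat} = {0, 1, 2}" by auto
  moreover have "fact 3 = (6 :: real)" "fact 4 = (24 :: real)" "fact 5 = (120 :: real)"
    by (simp_all add: fact_numeral)
  ultimately have "pi * pi ^ 4 / 60 + (pi * even_zeta 2 - pi * pi\<^sup>2 * pi\<^sup>2 / 36) = 0"
    by (simp add: sin_zeta_poly_def even_zeta_0 even_zeta_1)
  hence "pi * (even_zeta 2 - pi ^ 4 / 90) = 0" by (simp add: field_simps power_numeral_reduce)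
  thus ?thesis by simp
qed

section \<open>Sums over a lattice of trigonometric Laurent functions\<close>

text \<open>A non-constant polynomial is large far out, and a constant one equals its limit. Both
  the uniqueness of Laurent coefficients and the exclusion of logarithms are reduced to
  this.\<close>

lemma poly_of_nat_tendsto_0_imp_0:
  fixes p :: "'a :: real_normed_field poly"
  assumes "(\<lambda>n. poly p (of_nat n)) \<longlonglongrightarrow> 0"
  shows "p = 0"
proof (cases p)
  case (pCons a q)
  show ?thesis
  proof (cases "q = 0")
    case True
    thus ?thesis using assms pCons by (simp add: LIMSEQ_const_iff)
  next
    case False
    from poly_infinity[OF this, of 1 a] obtain r where r: "\<And>z. r \<le> norm z \<Longrightarrow> 1 \<le> norm (poly p z)"
      using pCons by auto
    have "eventually (\<lambda>n. norm (poly p (of_nat n)) < 1) sequentially"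
      using tendsto_norm[OF assms] by (intro order_tendstoD[of _ 0]) auto
    then obtain N where N: "\<And>n. n \<ge> N \<Longrightarrow> norm (poly p (of_nat n)) < 1"
      by (auto simp: eventually_at_top_linorder)
    obtain n where n: "r \<le> real n"
      using real_arch_simple[of r] by blast
    hence "r \<le> norm (of_nat (max n N) :: 'a)" by (simp only: norm_of_nat)
    from r[OF this] N[of "max n N"] show ?thesis by simp
  qed
qed

section \<open>Taylor remainders of cosine and sine\<close>

lemma cos_remainder:
  "\<bar>cos x - (\<Sum>i\<le>j. (-1) ^ i * x ^ (2 * i) / fact (2 * i))\<bar> \<le> \<bar>x :: real\<bar> ^ (2 * j + 1)"
proof -
  have eq: "(\<Sum>m<2 * j + 1. cos_coeff m * x ^ m) = (\<Sum>i\<le>j. (-1) ^ i * x ^ (2 * i) / fact (2 * i))"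
    by (induction j) (auto simp: cos_coeff_def)
  from Maclaurin_cos_expansion[of x "2 * j + 1"] obtain t where
    "cos x = (\<Sum>m<2 * j + 1. cos_coeff m * x ^ m)
        + cos (t + 1 / 2 * real (2 * j + 1) * pi) / fact (2 * j + 1) * x ^ (2 * j + 1)"
    by blast
  hence "\<bar>cos x - (\<Sum>i\<le>j. (-1) ^ i * x ^ (2 * i) / fact (2 * i))\<bar>
      = \<bar>cos (t + 1 / 2 * real (2 * j + 1) * pi)\<bar> / fact (2 * j + 1) * \<bar>x\<bar> ^ (2 * j + 1)"
    unfolding eq by (simp add: abs_mult power_abs)
  also have "\<dots> \<le> 1 * \<bar>x\<bar> ^ (2 * j + 1)"
    by (intro mult_right_mono) (auto simp: divide_le_eq intro: order_trans[OF abs_cos_le_one fact_ge_1] simp del: fact_Suc)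
  finally show ?thesis by simp
qed

lemma sin_remainder:
  "\<bar>sin x - (\<Sum>i\<le>j. (-1) ^ i * x ^ (2 * i + 1) / fact (2 * i + 1))\<bar> \<le> \<bar>x :: real\<bar> ^ (2 * j + 2)"
proof -
  have eq: "(\<Sum>m<2 * j + 2. sin_coeff m * x ^ m) = (\<Sum>i\<le>j. (-1) ^ i * x ^ (2 * i + 1) / fact (2 * i + 1))"
    by (induction j) (auto simp: sin_coeff_def)
  from Maclaurin_sin_expansion[of x "2 * j + 2"] obtain t where
    "sin x = (\<Sum>m<2 * j + 2. sin_coeff m * x ^ m)
        + sin (t + 1 / 2 * real (2 * j + 2) * pi) / fact (2 * j + 2) * x ^ (2 * j + 2)"
    by blast
  hence "\<bar>sin x - (\<Sum>i\<le>j. (-1) ^ i * x ^ (2 * i + 1) / fact (2 * i + 1))\<bar>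
      = \<bar>sin (t + 1 / 2 * real (2 * j + 2) * pi)\<bar> / fact (2 * j + 2) * \<bar>x\<bar> ^ (2 * j + 2)"
    unfolding eq by (simp add: abs_mult power_abs)
  also have "\<dots> \<le> 1 * \<bar>x\<bar> ^ (2 * j + 2)"
    by (intro mult_right_mono) (auto simp: divide_le_eq intro: order_trans[OF abs_sin_le_one fact_ge_1] simp del: fact_Suc)
  finally show ?thesis by simp
qed

text \<open>The last clause ties \<open>h\<close> to the Laurent expansion of \<open>H\<close> at 0
  and thereby determines it up to J, so the coefficients can be read off later instead of being
  tracked through the construction. Both sums have the form h i times g i, so that one rewriting
  pads them together.\<close>

definition lattice_expansion :: "(real \<Rightarrow> real) \<Rightarrow> nat \<Rightarrow> (nat \<Rightarrow> real) \<Rightarrow> real \<Rightarrow> real \<Rightarrow> bool" where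
  "lattice_expansion H J h C \<delta> \<longleftrightarrow> \<delta> > 0 \<and>
     (\<forall>\<phi>. 0 < \<phi> \<and> \<phi> < \<delta> \<longrightarrow>
        (\<lambda>n. H (real (Suc n) * \<phi>)) sums ((\<Sum>i\<le>J. h i * (even_zeta i / \<phi> ^ (2 * i))) + C / \<phi>)) \<and>
     ((\<lambda>t. H t - (\<Sum>i\<le>J. h i * (1 / t ^ (2 * i)))) \<longlongrightarrow> 0) (at_right 0)"

definition has_lattice_sum :: "(real \<Rightarrow> real) \<Rightarrow> bool" where
  "has_lattice_sum H \<longleftrightarrow> (\<exists>J h C \<delta>. lattice_expansion H J h C \<delta>)"

lemma lattice_expansion_pad:
  assumes "lattice_expansion H J0 h C \<delta>" "J \<ge> J0"
  shows "lattice_expansion H J (\<lambda>i. if i \<le> J0 then h i else 0) C \<delta>"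
proof -
  have eq: "(\<Sum>i\<le>J. (if i \<le> J0 then h i else 0) * g i) = (\<Sum>i\<le>J0. h i * g i)" for g :: "nat \<Rightarrow> real"
    by (rule sum.mono_neutral_cong_right) (use assms(2) in auto)
  show ?thesis using assms(1) unfolding lattice_expansion_def eq .
qed

lemma has_lattice_sum_add:
  assumes "has_lattice_sum f" "has_lattice_sum g"
  shows "has_lattice_sum (\<lambda>t. f t + g t)"
proof -
  obtain J1 h1 C1 d1 where "lattice_expansion f J1 h1 C1 d1"
    using assms(1) unfolding has_lattice_sum_def by blast
  from lattice_expansion_pad[OF this, of "max J1 J2" for J2]
  have 1: "\<exists>h. lattice_expansion f (max J1 J2) h C1 d1" for J2 by auto
  obtain J2 h2 C2 d2 where "lattice_expansion g J2 h2 C2 d2"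
    using assms(2) unfolding has_lattice_sum_def by blast
  from lattice_expansion_pad[OF this, of "max J1 J2"]
  have 2: "\<exists>h. lattice_expansion g (max J1 J2) h C2 d2" by auto
  define J where "J = max J1 J2"
  obtain h1 h2 where h1: "lattice_expansion f J h1 C1 d1" and h2: "lattice_expansion g J h2 C2 d2"
    using 1[of J2] 2 unfolding J_def by blast
  note h1 = h1[unfolded lattice_expansion_def] and h2 = h2[unfolded lattice_expansion_def]
  have sums: "(\<lambda>n. f (real (Suc n) * \<phi>) + g (real (Suc n) * \<phi>)) sums
      ((\<Sum>i\<le>J. (h1 i + h2 i) * (even_zeta i / \<phi> ^ (2 * i))) + (C1 + C2) / \<phi>)"
    if "0 < \<phi>" "\<phi> < min d1 d2" for \<phi>
  proof -
    have "(\<lambda>n. f (real (Suc n) * \<phi>)) sums ((\<Sum>i\<le>J. h1 i * (even_zeta i / \<phi> ^ (2 * i))) + C1 / \<phi>)"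
      "(\<lambda>n. g (real (Suc n) * \<phi>)) sums ((\<Sum>i\<le>J. h2 i * (even_zeta i / \<phi> ^ (2 * i))) + C2 / \<phi>)"
      using h1 h2 that by auto
    from sums_add[OF this] show ?thesis
      by (simp only: sum.distrib add_divide_distrib distrib_right add_ac)
  qed
  have lim: "((\<lambda>t. f t + g t - (\<Sum>i\<le>J. (h1 i + h2 i) * (1 / t ^ (2 * i)))) \<longlongrightarrow> 0) (at_right 0)"
  proof -
    have "(\<lambda>t. f t + g t - (\<Sum>i\<le>J. (h1 i + h2 i) * (1 / t ^ (2 * i)))) =
        (\<lambda>t. (f t - (\<Sum>i\<le>J. h1 i * (1 / t ^ (2 * i)))) + (g t - (\<Sum>i\<le>J. h2 i * (1 / t ^ (2 * i)))))"
      by (simp only: sum.distrib distrib_right) (simp add: algebra_simps)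
    thus ?thesis using tendsto_add[OF h1[THEN conjunct2, THEN conjunct2] h2[THEN conjunct2, THEN conjunct2]]
      by (simp only: add_0)
  qed
  have "lattice_expansion (\<lambda>t. f t + g t) J (\<lambda>i. h1 i + h2 i) (C1 + C2) (min d1 d2)"
    unfolding lattice_expansion_def
    using h1[THEN conjunct1] h2[THEN conjunct1] by (intro conjI allI impI lim sums) simp_all
  thus ?thesis unfolding has_lattice_sum_def by blast
qed

lemma has_lattice_sum_cmult:
  assumes "has_lattice_sum f"
  shows "has_lattice_sum (\<lambda>t. c * f t)"
proof -
  obtain J h C \<delta> where "lattice_expansion f J h C \<delta>"
    using assms unfolding has_lattice_sum_def by blast
  hence *: "\<delta> > 0" "\<And>\<phi>. 0 < \<phi> \<Longrightarrow> \<phi> < \<delta> \<Longrightarrow>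
        (\<lambda>n. f (real (Suc n) * \<phi>)) sums ((\<Sum>i\<le>J. h i * (even_zeta i / \<phi> ^ (2 * i))) + C / \<phi>)"
     "((\<lambda>t. f t - (\<Sum>i\<le>J. h i * (1 / t ^ (2 * i)))) \<longlongrightarrow> 0) (at_right 0)"
    unfolding lattice_expansion_def by auto
  have "(\<lambda>n. c * f (real (Suc n) * \<phi>)) sums ((\<Sum>i\<le>J. (c * h i) * (even_zeta i / \<phi> ^ (2 * i))) + (c * C) / \<phi>)"
    if "0 < \<phi>" "\<phi> < \<delta>" for \<phi>
    using sums_mult[OF *(2)[OF that], of c] by (simp add: distrib_left sum_distrib_left mult.assoc)
  moreover have "((\<lambda>t. c * f t - (\<Sum>i\<le>J. (c * h i) * (1 / t ^ (2 * i)))) \<longlongrightarrow> 0) (at_right 0)"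
    using tendsto_mult_left[OF *(3), of c] by (simp add: right_diff_distrib sum_distrib_left)
  ultimately show ?thesis unfolding has_lattice_sum_def lattice_expansion_def
    using *(1) by (intro exI[of _ J] exI[of _ "\<lambda>i. c * h i"] exI[of _ "c * C"] exI[of _ \<delta>]) auto
qed

lemma sum_atMost_rev: "(\<Sum>i\<le>j. g (j - i)) = (\<Sum>i\<le>(j::nat). g i)"
  by (rule sum.reindex_bij_witness[of _ "\<lambda>i. j - i" "\<lambda>i. j - i"]) auto

text \<open>Dividing \<open>cos_zeta_poly j\<close> at m \<phi> by \<phi>^(2 j) and reversing the
  summation gives the zeta terms, and the odd-degree term becomes C / \<phi>. The same reversal in
  the Taylor polynomial of the cosine yields the same \<open>h\<close>. Evenness covers negative
  m.\<close>

lemma has_lattice_sum_cos: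
  assumes "j \<ge> 1"
  shows "has_lattice_sum (\<lambda>t. cos (m * t) / t ^ (2 * j))"
proof -
  have pos: "has_lattice_sum (\<lambda>t. cos (m * t) / t ^ (2 * j))" if m: "m \<ge> 0" for m
  proof -
    define h where "h i = (-1) ^ (j - i) * m ^ (2 * (j - i)) / fact (2 * (j - i))" for i
    define C where "C = (-1) ^ j * pi * m ^ (2 * j - 1) / (2 * fact (2 * j - 1))"
    \<comment> \<open>The formula needs m \<phi> \<le> 2 pi; adding 1 avoids a zero denominator at m
      = 0.\<close>
    define \<delta> where "\<delta> = 2 * pi / (m + 1)"
    have "(\<lambda>n. cos (m * (real (Suc n) * \<phi>)) / (real (Suc n) * \<phi>) ^ (2 * j)) sums
        ((\<Sum>i\<le>j. h i * (even_zeta i / \<phi> ^ (2 * i))) + C / \<phi>)"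
      if \<phi>: "0 < \<phi>" "\<phi> < \<delta>" for \<phi>
    proof -
      have "m * \<phi> \<le> (m + 1) * \<phi>" using \<phi> by (simp add: distrib_right)
      also have "\<dots> \<le> 2 * pi" using \<phi> m by (simp add: \<delta>_def field_simps)
      finally have "cos_zeta j (m * \<phi>) = cos_zeta_poly j (m * \<phi>)"
        using m \<phi> assms by (intro cos_sin_zeta_eq_poly) auto
      hence "(\<lambda>n. cos (real (Suc n) * (m * \<phi>)) / real (Suc n) ^ (2 * j)) sums cos_zeta_poly j (m * \<phi>)"
        using summable_sums[OF summable_cos_zeta[OF assms, of "m * \<phi>"]] by (simp add: cos_zeta_def)
      from sums_divide[OF this, of "\<phi> ^ (2 * j)"]
      have "(\<lambda>n. cos (m * (real (Suc n) * \<phi>)) / (real (Suc n) * \<phi>) ^ (2 * j)) sums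
          (cos_zeta_poly j (m * \<phi>) / \<phi> ^ (2 * j))"
        by (simp add: power_mult_distrib mult_ac del: of_nat_Suc)
      also have "cos_zeta_poly j (m * \<phi>) / \<phi> ^ (2 * j) =
         (\<Sum>i\<le>j. (-1) ^ i * (m * \<phi>) ^ (2 * i) / fact (2 * i) * even_zeta (j - i) / \<phi> ^ (2 * j))
         + (-1) ^ j * pi * (m * \<phi>) ^ (2 * j - 1) / (2 * fact (2 * j - 1)) / \<phi> ^ (2 * j)"
        by (simp add: cos_zeta_poly_def add_divide_distrib sum_divide_distrib)
      also have "(\<Sum>i\<le>j. (-1) ^ i * (m * \<phi>) ^ (2 * i) / fact (2 * i) * even_zeta (j - i) / \<phi> ^ (2 * j))
         = (\<Sum>i\<le>j. h (j - i) * (even_zeta (j - i) / \<phi> ^ (2 * (j - i))))"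
      proof (intro sum.cong refl)
        fix i assume "i \<in> {..j}"
        hence e: "2 * j = 2 * i + 2 * (j - i)" "j - (j - i) = i" by auto
        have "\<phi> ^ (2 * j) = \<phi> ^ (2 * i) * \<phi> ^ (2 * (j - i))"
          by (subst e(1)) (rule power_add)
        with e(2) show "(-1) ^ i * (m * \<phi>) ^ (2 * i) / fact (2 * i) * even_zeta (j - i) / \<phi> ^ (2 * j)
            = h (j - i) * (even_zeta (j - i) / \<phi> ^ (2 * (j - i)))"
          using \<phi> by (simp add: h_def power_mult_distrib)
      qed
      also have "\<dots> = (\<Sum>i\<le>j. h i * (even_zeta i / \<phi> ^ (2 * i)))" by (rule sum_atMost_rev)
      also have "(-1) ^ j * pi * (m * \<phi>) ^ (2 * j - 1) / (2 * fact (2 * j - 1)) / \<phi> ^ (2 * j) = C / \<phi>"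
      proof -
        have "\<phi> ^ (2 * j) = \<phi> ^ (2 * j - 1) * \<phi>"
          using assms by (simp flip: power_Suc2)
        thus ?thesis using \<phi> by (simp add: C_def power_mult_distrib)
      qed
      finally show ?thesis .
    qed
    moreover have "((\<lambda>t. cos (m * t) / t ^ (2 * j) - (\<Sum>i\<le>j. h i * (1 / t ^ (2 * i)))) \<longlongrightarrow> 0) (at_right 0)"
    proof (rule Lim_null_comparison)
      show "eventually (\<lambda>t. norm (cos (m * t) / t ^ (2 * j) - (\<Sum>i\<le>j. h i * (1 / t ^ (2 * i))))
          \<le> m ^ (2 * j + 1) * t) (at_right 0)"
      proof (intro eventually_at_right_less[THEN eventually_mono])
        fix t :: real assume t: "0 < t"
        have "(\<Sum>i\<le>j. (-1) ^ i * (m * t) ^ (2 * i) / fact (2 * i)) / t ^ (2 * j)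
           = (\<Sum>i\<le>j. h (j - i) * (1 / t ^ (2 * (j - i))))" unfolding sum_divide_distrib
        proof (intro sum.cong refl)
          fix i assume "i \<in> {..j}"
          hence e: "2 * j = 2 * i + 2 * (j - i)" "j - (j - i) = i" by auto
        have "t ^ (2 * j) = t ^ (2 * i) * t ^ (2 * (j - i))"
          by (subst e(1)) (rule power_add)
          with e(2) show "(-1) ^ i * (m * t) ^ (2 * i) / fact (2 * i) / t ^ (2 * j) = h (j - i) * (1 / t ^ (2 * (j - i)))"
            using t by (simp add: h_def power_mult_distrib)
        qed
        also have "\<dots> = (\<Sum>i\<le>j. h i * (1 / t ^ (2 * i)))" by (rule sum_atMost_rev)
        finally have eq: "(\<Sum>i\<le>j. (-1) ^ i * (m * t) ^ (2 * i) / fact (2 * i)) / t ^ (2 * j) = (\<Sum>i\<le>j. h i * (1 / t ^ (2 * i)))" .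
        have "norm (cos (m * t) / t ^ (2 * j) - (\<Sum>i\<le>j. h i * (1 / t ^ (2 * i))))
           = \<bar>cos (m * t) - (\<Sum>i\<le>j. (-1) ^ i * (m * t) ^ (2 * i) / fact (2 * i))\<bar> / t ^ (2 * j)"
          unfolding eq[symmetric] diff_divide_distrib[symmetric] real_norm_def abs_divide
          using t by (simp only: power_abs abs_of_pos)
        also have "\<dots> \<le> \<bar>m * t\<bar> ^ (2 * j + 1) / t ^ (2 * j)"
          using t by (intro divide_right_mono cos_remainder) auto
        also have "\<dots> = m ^ (2 * j + 1) * t" using t m by (simp add: power_mult_distrib abs_mult)
        finally show "norm (cos (m * t) / t ^ (2 * j) - (\<Sum>i\<le>j. h i * (1 / t ^ (2 * i)))) \<le> m ^ (2 * j + 1) * t" .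
      qed
      show "((\<lambda>t. m ^ (2 * j + 1) * t) \<longlongrightarrow> 0) (at_right 0)" by (auto intro!: tendsto_eq_intros)
    qed
    moreover have "\<delta> > 0" using m by (simp add: \<delta>_def)
    ultimately show ?thesis unfolding has_lattice_sum_def lattice_expansion_def by blast
  qed
  show ?thesis using pos[of "\<bar>m\<bar>"] by (cases "m \<ge> 0") auto
qed

text \<open>As for the cosine, with \<open>sin_zeta_poly\<close>; negative frequencies are reached
  by oddness, through the factor -1.\<close>

lemma has_lattice_sum_sin:
  assumes "j \<ge> 1"
  shows "has_lattice_sum (\<lambda>t. sin (m * t) / t ^ (2 * j + 1))"
proof -
  have pos: "has_lattice_sum (\<lambda>t. sin (m * t) / t ^ (2 * j + 1))" if m: "m \<ge> 0" for m
  proof -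
    define h where "h i = (-1) ^ (j - i) * m ^ (2 * (j - i) + 1) / fact (2 * (j - i) + 1)" for i
    define C where "C = (-1) ^ j * pi * m ^ (2 * j) / (2 * fact (2 * j))"
    define \<delta> where "\<delta> = 2 * pi / (m + 1)"
    have "(\<lambda>n. sin (m * (real (Suc n) * \<phi>)) / (real (Suc n) * \<phi>) ^ (2 * j + 1)) sums
        ((\<Sum>i\<le>j. h i * (even_zeta i / \<phi> ^ (2 * i))) + C / \<phi>)"
      if \<phi>: "0 < \<phi>" "\<phi> < \<delta>" for \<phi>
    proof -
      have "m * \<phi> \<le> (m + 1) * \<phi>" using \<phi> by (simp add: distrib_right)
      also have "\<dots> \<le> 2 * pi" using \<phi> m by (simp add: \<delta>_def field_simps)
      finally have "sin_zeta j (m * \<phi>) = sin_zeta_poly j (m * \<phi>)"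
        using m \<phi> assms by (intro cos_sin_zeta_eq_poly) auto
      hence "(\<lambda>n. sin (real (Suc n) * (m * \<phi>)) / real (Suc n) ^ (2 * j + 1)) sums sin_zeta_poly j (m * \<phi>)"
        using summable_sums[OF summable_sin_zeta[OF assms, of "m * \<phi>"]] by (simp add: sin_zeta_def)
      from sums_divide[OF this, of "\<phi> ^ (2 * j + 1)"]
      have "(\<lambda>n. sin (m * (real (Suc n) * \<phi>)) / (real (Suc n) * \<phi>) ^ (2 * j + 1)) sums
          (sin_zeta_poly j (m * \<phi>) / \<phi> ^ (2 * j + 1))"
        by (simp add: power_mult_distrib mult_ac del: of_nat_Suc)
      also have "sin_zeta_poly j (m * \<phi>) / \<phi> ^ (2 * j + 1) =
         (\<Sum>i\<le>j. (-1) ^ i * (m * \<phi>) ^ (2 * i + 1) / fact (2 * i + 1) * even_zeta (j - i) / \<phi> ^ (2 * j + 1))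
         + (-1) ^ j * pi * (m * \<phi>) ^ (2 * j) / (2 * fact (2 * j)) / \<phi> ^ (2 * j + 1)"
        by (simp add: sin_zeta_poly_def add_divide_distrib sum_divide_distrib)
      also have "(\<Sum>i\<le>j. (-1) ^ i * (m * \<phi>) ^ (2 * i + 1) / fact (2 * i + 1) * even_zeta (j - i) / \<phi> ^ (2 * j + 1))
         = (\<Sum>i\<le>j. h (j - i) * (even_zeta (j - i) / \<phi> ^ (2 * (j - i))))"
      proof (intro sum.cong refl)
        fix i assume "i \<in> {..j}"
        hence e: "2 * j + 1 = 2 * i + 1 + 2 * (j - i)" "j - (j - i) = i" by auto
        have "\<phi> ^ (2 * j + 1) = \<phi> ^ (2 * i + 1) * \<phi> ^ (2 * (j - i))"
          by (subst e(1)) (rule power_add)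
        with e(2) show "(-1) ^ i * (m * \<phi>) ^ (2 * i + 1) / fact (2 * i + 1) * even_zeta (j - i) / \<phi> ^ (2 * j + 1)
            = h (j - i) * (even_zeta (j - i) / \<phi> ^ (2 * (j - i)))"
          using \<phi> by (simp add: h_def power_mult_distrib del: fact_Suc)
      qed
      also have "\<dots> = (\<Sum>i\<le>j. h i * (even_zeta i / \<phi> ^ (2 * i)))" by (rule sum_atMost_rev)
      also have "(-1) ^ j * pi * (m * \<phi>) ^ (2 * j) / (2 * fact (2 * j)) / \<phi> ^ (2 * j + 1) = C / \<phi>"
        using \<phi> by (simp add: C_def power_mult_distrib)
      finally show ?thesis .
    qed
    moreover have "((\<lambda>t. sin (m * t) / t ^ (2 * j + 1) - (\<Sum>i\<le>j. h i * (1 / t ^ (2 * i)))) \<longlongrightarrow> 0) (at_right 0)"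
    proof (rule Lim_null_comparison)
      show "eventually (\<lambda>t. norm (sin (m * t) / t ^ (2 * j + 1) - (\<Sum>i\<le>j. h i * (1 / t ^ (2 * i))))
          \<le> m ^ (2 * j + 2) * t) (at_right 0)"
      proof (intro eventually_at_right_less[THEN eventually_mono])
        fix t :: real assume t: "0 < t"
        have "(\<Sum>i\<le>j. (-1) ^ i * (m * t) ^ (2 * i + 1) / fact (2 * i + 1)) / t ^ (2 * j + 1)
           = (\<Sum>i\<le>j. h (j - i) * (1 / t ^ (2 * (j - i))))" unfolding sum_divide_distrib
        proof (intro sum.cong refl)
          fix i assume "i \<in> {..j}"
          hence e: "2 * j + 1 = 2 * i + 1 + 2 * (j - i)" "j - (j - i) = i" by auto
        have "t ^ (2 * j + 1) = t ^ (2 * i + 1) * t ^ (2 * (j - i))"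
          by (subst e(1)) (rule power_add)
          with e(2) show "(-1) ^ i * (m * t) ^ (2 * i + 1) / fact (2 * i + 1) / t ^ (2 * j + 1)
              = h (j - i) * (1 / t ^ (2 * (j - i)))"
            using t by (simp add: h_def power_mult_distrib del: fact_Suc)
        qed
        also have "\<dots> = (\<Sum>i\<le>j. h i * (1 / t ^ (2 * i)))" by (rule sum_atMost_rev)
        finally have eq: "(\<Sum>i\<le>j. (-1) ^ i * (m * t) ^ (2 * i + 1) / fact (2 * i + 1)) / t ^ (2 * j + 1) = (\<Sum>i\<le>j. h i * (1 / t ^ (2 * i)))" .
        have "norm (sin (m * t) / t ^ (2 * j + 1) - (\<Sum>i\<le>j. h i * (1 / t ^ (2 * i))))
           = \<bar>sin (m * t) - (\<Sum>i\<le>j. (-1) ^ i * (m * t) ^ (2 * i + 1) / fact (2 * i + 1))\<bar> / t ^ (2 * j + 1)"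
          unfolding eq[symmetric] diff_divide_distrib[symmetric] real_norm_def abs_divide
          using t by (simp only: power_abs abs_of_pos)
        also have "\<dots> \<le> \<bar>m * t\<bar> ^ (2 * j + 2) / t ^ (2 * j + 1)"
          using t by (intro divide_right_mono sin_remainder) auto
        also have "\<dots> = m ^ (2 * j + 2) * t" using t m by (simp add: power_mult_distrib abs_mult)
        finally show "norm (sin (m * t) / t ^ (2 * j + 1) - (\<Sum>i\<le>j. h i * (1 / t ^ (2 * i)))) \<le> m ^ (2 * j + 2) * t" .
      qed
      show "((\<lambda>t. m ^ (2 * j + 2) * t) \<longlongrightarrow> 0) (at_right 0)" by (auto intro!: tendsto_eq_intros)
    qed
    moreover have "\<delta> > 0" using m by (simp add: \<delta>_def)
    ultimately show ?thesis unfolding has_lattice_sum_def lattice_expansion_def by blast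
  qed
  show ?thesis using pos[of "\<bar>m\<bar>"] has_lattice_sum_cmult[OF pos[of "\<bar>m\<bar>"], of "-1"] by (cases "m \<ge> 0") auto
qed

text \<open>A syntactic class: unlike \<open>has_lattice_sum\<close>, it is visibly stable under
  multiplication by \<open>sinc_sq\<close>. The condition on j makes the sums converge absolutely,
  and pairing cosines with even and sines with odd powers makes every member an even
  function.\<close>

inductive trig_laurent :: "(real \<Rightarrow> real) \<Rightarrow> bool" where
  cos: "j \<ge> 1 \<Longrightarrow> trig_laurent (\<lambda>t. cos (m * t) / t ^ (2 * j))"
| sin: "j \<ge> 1 \<Longrightarrow> trig_laurent (\<lambda>t. sin (m * t) / t ^ (2 * j + 1))"
| add: "trig_laurent f \<Longrightarrow> trig_laurent g \<Longrightarrow> trig_laurent (\<lambda>t. f t + g t)"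
| cmult: "trig_laurent f \<Longrightarrow> trig_laurent (\<lambda>t. c * f t)"

lemma trig_laurent_has_lattice_sum: "trig_laurent H \<Longrightarrow> has_lattice_sum H"
proof (induction rule: trig_laurent.induct)
  case (cos j m)
  thus ?case by (rule has_lattice_sum_cos)
next
  case (sin j m)
  thus ?case by (rule has_lattice_sum_sin)
next
  case (add f g)
  show ?case by (rule has_lattice_sum_add[OF add.IH])
next
  case (cmult f c)
  show ?case by (rule has_lattice_sum_cmult[OF cmult.IH])
qed

text \<open>\<open>sinc_sq t = (sin (t / 2) / (t / 2))\<^sup>2\<close>\<close>
definition sinc_sq :: "real \<Rightarrow> real" where
  "sinc_sq t = (2 - 2 * cos t) / t\<^sup>2"

text \<open>Product-to-sum formulas: the factor 2 - 2 cos t shifts the frequency by one in both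
  directions, and the denominator raises j by one.\<close>

lemma trig_laurent_mult_sinc_sq:
  "trig_laurent H \<Longrightarrow> trig_laurent (\<lambda>t. H t * sinc_sq t)"
proof (induction rule: trig_laurent.induct)
  case (cos j m)
  have *: "cos (m * t) * (2 - 2 * cos t) = 2 * cos (m * t) - cos ((m + 1) * t) - cos ((m - 1) * t)" for t
    by (simp add: cos_add cos_diff distrib_right left_diff_distrib right_diff_distrib)
  have "cos (m * t) / t ^ (2 * j) * sinc_sq t = cos (m * t) * (2 - 2 * cos t) / t ^ (2 * Suc j)" for t
    by (simp add: sinc_sq_def power2_eq_square mult_ac)
  hence eq: "(\<lambda>t. cos (m * t) / t ^ (2 * j) * sinc_sq t) = (\<lambda>t. 2 * (cos (m * t) / t ^ (2 * Suc j)) +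
     (-1 * (cos ((m + 1) * t) / t ^ (2 * Suc j)) + -1 * (cos ((m - 1) * t) / t ^ (2 * Suc j))))"
    unfolding * by (simp only: diff_divide_distrib) (simp add: algebra_simps)
  show ?case unfolding eq
    by (intro trig_laurent.add trig_laurent.cmult trig_laurent.cos) auto
next
  case (sin j m)
  have *: "sin (m * t) * (2 - 2 * cos t) = 2 * sin (m * t) - sin ((m + 1) * t) - sin ((m - 1) * t)" for t
    by (simp add: sin_add sin_diff distrib_right left_diff_distrib right_diff_distrib)
  have "sin (m * t) / t ^ (2 * j + 1) * sinc_sq t = sin (m * t) * (2 - 2 * cos t) / t ^ (2 * Suc j + 1)" for t
    by (simp add: sinc_sq_def power2_eq_square mult_ac)
  hence eq: "(\<lambda>t. sin (m * t) / t ^ (2 * j + 1) * sinc_sq t) = (\<lambda>t. 2 * (sin (m * t) / t ^ (2 * Suc j + 1)) +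
     (-1 * (sin ((m + 1) * t) / t ^ (2 * Suc j + 1)) + -1 * (sin ((m - 1) * t) / t ^ (2 * Suc j + 1))))"
    unfolding * by (simp only: diff_divide_distrib) (simp add: algebra_simps)
  show ?case unfolding eq
    by (intro trig_laurent.add trig_laurent.cmult trig_laurent.sin) auto
next
  case (add f g)
  show ?case using trig_laurent.add[OF add.IH] by (simp only: distrib_right)
next
  case (cmult f c)
  show ?case using trig_laurent.cmult[OF cmult.IH, of c] by (simp only: mult.assoc)
qed

lemma trig_laurent_mult_sinc_sq_power:
  "trig_laurent H \<Longrightarrow> trig_laurent (\<lambda>t. H t * sinc_sq t ^ k)"
proof (induction k)
  case (Suc k)
  thus ?case using trig_laurent_mult_sinc_sq[OF Suc.IH] by (simp add: mult_ac)
qed simp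

text \<open>Substituting t = 1 / sqrt n turns the Laurent polynomial into a polynomial evaluated at
  n.\<close>

lemma laurent_tendsto_0_imp_0:
  fixes d :: "nat \<Rightarrow> real"
  assumes "((\<lambda>t. \<Sum>i\<le>J. d i * (1 / t ^ (2 * i))) \<longlongrightarrow> 0) (at_right 0)" and "i \<le> J"
  shows "d i = 0"
proof -
  define p where "p = (\<Sum>i\<le>J. monom (d i) i)"
  have "filterlim (\<lambda>n. 1 / sqrt (real n)) (at_right 0) sequentially"
    unfolding filterlim_at
    by (intro conjI tendsto_divide_0[OF tendsto_const] filterlim_at_top_imp_at_infinity
          filterlim_compose[OF sqrt_at_top filterlim_real_sequentially])
       (auto simp: eventually_at_top_linorder intro!: exI[of _ 1])
  from filterlim_compose[OF assms(1) this]
  have "(\<lambda>n. \<Sum>i\<le>J. d i * (1 / (1 / sqrt (real n)) ^ (2 * i))) \<longlonglongrightarrow> 0" .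
  also have "(\<lambda>n. \<Sum>i\<le>J. d i * (1 / (1 / sqrt (real n)) ^ (2 * i))) = (\<lambda>n. poly p (real n))"
    by (rule ext) (simp add: p_def poly_sum poly_monom power_divide power_mult)
  finally have "p = 0" by (rule poly_of_nat_tendsto_0_imp_0)
  hence "coeff p i = 0" by simp
  thus ?thesis using assms(2) by (simp add: p_def coeff_sum)
qed

text \<open>The odd Laurent coefficients and \<open>\<zeta>(-2), \<zeta>(-4), \<dots>\<close> vanish, which is why only
  three terms and the multiple of \<open>1 / \<phi>\<close> survive.\<close>
lemma trig_laurent_sums:
  assumes "trig_laurent H"
    and lim: "((\<lambda>t. H t - (h2 / t ^ 4 + h1 / t ^ 2 + h0)) \<longlongrightarrow> 0) (at_right 0)"
  shows "\<exists>C. \<exists>\<delta>>0. \<forall>\<phi>. 0 < \<phi> \<and> \<phi> < \<delta> \<longrightarrow> (\<lambda>n. H (real (Suc n) * \<phi>)) sums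
     (pi ^ 4 / 90 * h2 / \<phi> ^ 4 + pi\<^sup>2 / 6 * h1 / \<phi> ^ 2 - h0 / 2 + C / \<phi>)"
proof -
  obtain J0 h0' C \<delta> where "lattice_expansion H J0 h0' C \<delta>"
    using trig_laurent_has_lattice_sum[OF assms(1)] unfolding has_lattice_sum_def by blast
  define h where "h i = (if i \<le> J0 then h0' i else 0)" for i
  \<comment> \<open>Padding by two guarantees that the indices 0, 1 and 2 are in range.\<close>
  define J where "J = Suc (Suc J0)"
  have "lattice_expansion H J h C \<delta>"
    unfolding h_def[abs_def]
    by (rule lattice_expansion_pad[OF \<open>lattice_expansion H J0 h0' C \<delta>\<close>]) (simp add: J_def)
  note h = this[unfolded lattice_expansion_def]
  define d where "d i = (if i = 0 then h0 else if i = 1 then h1 else if i = 2 then h2 else 0)" for i :: nat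
  have sum3: "(\<Sum>i\<le>J. d i * g i) = h0 * g 0 + h1 * g 1 + h2 * g 2" for g :: "nat \<Rightarrow> real"
  proof -
    have "(\<Sum>i\<le>J. d i * g i) = (\<Sum>i\<in>{0, 1, 2}. d i * g i)"
      by (rule sum.mono_neutral_right) (auto simp: J_def d_def)
    thus ?thesis by (simp add: d_def)
  qed
  have "((\<lambda>t. \<Sum>i\<le>J. (d i - h i) * (1 / t ^ (2 * i))) \<longlongrightarrow> 0) (at_right 0)"
    using tendsto_diff[OF h[THEN conjunct2, THEN conjunct2] lim]
    by (simp only: left_diff_distrib sum_subtractf sum3) (simp add: algebra_simps power2_eq_square)
  from laurent_tendsto_0_imp_0[OF this] have hd: "h i = d i" if "i \<le> J" for i using that by force
  have eq: "(\<Sum>i\<le>J. h i * (even_zeta i / \<phi> ^ (2 * i))) =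
      pi ^ 4 / 90 * h2 / \<phi> ^ 4 + pi\<^sup>2 / 6 * h1 / \<phi> ^ 2 - h0 / 2" for \<phi>
    using sum3[of "\<lambda>i. even_zeta i / \<phi> ^ (2 * i)"] hd
    by (simp add: even_zeta_0 even_zeta_1 even_zeta_2 mult.commute)
  show ?thesis using h unfolding eq by blast
qed

section \<open>Asymptotic expansion of the mode sums\<close>

text \<open>The tail is x^N times the shifted power series, which has the same radius of convergence
  and is bounded near 0 by continuity.\<close>

lemma has_fps_expansion_bigo:
  fixes f :: "'a :: {banach, real_normed_field} \<Rightarrow> 'a"
  assumes "f has_fps_expansion F"
  shows "(\<lambda>x. f x - (\<Sum>n<N. fps_nth F n * x ^ n)) \<in> O[nhds 0](\<lambda>x. x ^ N)"
proof -
  define G where "G = fps_shift N F"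
  have rad: "fps_conv_radius F > 0" and ev: "eventually (\<lambda>x. eval_fps F x = f x) (nhds 0)"
    using assms by (auto simp: has_fps_expansion_def)
  have radG: "fps_conv_radius G = fps_conv_radius F"
    by (simp add: G_def fps_conv_radius_def fps_shift_def conv_radius_shift)
  have "isCont (eval_fps G) 0"
    using rad radG by (intro continuous_eval_fps) (auto simp: zero_ereal_def)
  hence "eval_fps G \<in> O[nhds 0](\<lambda>_. 1)"
    by (intro bigoI_tendsto[of _ _ "eval_fps G 0"]) (auto simp: isCont_def tendsto_at_iff_tendsto_nhds)
  hence bigo: "(\<lambda>x. eval_fps G x * x ^ N) \<in> O[nhds 0](\<lambda>x. 1 * x ^ N)"
    by (intro landau_o.big.mult) auto
  have "eventually (\<lambda>x. f x - (\<Sum>n<N. fps_nth F n * x ^ n) = eval_fps G x * x ^ N) (nhds 0)"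
  proof -
    have "eventually (\<lambda>x. x \<in> eball 0 (fps_conv_radius F)) (nhds 0)"
      using rad by (intro eventually_nhds_in_open) (auto simp: zero_ereal_def)
    with ev show ?thesis
    proof eventually_elim
      case (elim x)
      have "summable (\<lambda>n. fps_nth F n * x ^ n)"
        using elim by (intro summable_fps) auto
      hence "eval_fps F x = (\<Sum>n. fps_nth F (n + N) * x ^ (n + N)) + (\<Sum>n<N. fps_nth F n * x ^ n)"
        unfolding eval_fps_def by (rule suminf_split_initial_segment)
      also have "(\<Sum>n. fps_nth F (n + N) * x ^ (n + N)) = (\<Sum>n. fps_nth G n * x ^ n * x ^ N)"
        by (simp add: G_def power_add mult_ac)
      also have "\<dots> = eval_fps G x * x ^ N"
        unfolding eval_fps_def
        by (rule suminf_mult2[symmetric], rule summable_fps) (use elim radG in auto)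
      finally show ?case using elim by simp
    qed
  qed
  from landau_o.big.in_cong[OF this] bigo show ?thesis by simp
qed

text \<open>Real-valued and from the right only: the behaviour on the left is supplied later by
  parity.\<close>

definition asym_series :: "(real \<Rightarrow> real) \<Rightarrow> (nat \<Rightarrow> real) \<Rightarrow> bool" where
  "asym_series f a \<longleftrightarrow> (\<forall>N. (\<lambda>\<phi>. f \<phi> - (\<Sum>n<N. a n * \<phi> ^ n)) \<in> O[at_right 0](\<lambda>\<phi>. \<phi> ^ N))"

lemma power_bigo_at_right_0:
  assumes "m \<le> n"
  shows "(\<lambda>\<phi>::real. \<phi> ^ n) \<in> O[at_right 0](\<lambda>\<phi>. \<phi> ^ m)"
proof (rule bigoI[of _ 1])
  have "eventually (\<lambda>\<phi>::real. \<phi> \<in> {0<..<1}) (at_right 0)"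
    by (rule eventually_at_right_real) simp
  thus "eventually (\<lambda>\<phi>::real. norm (\<phi> ^ n) \<le> 1 * norm (\<phi> ^ m)) (at_right 0)"
    by eventually_elim (use assms in \<open>auto intro: power_decreasing\<close>)
qed

text \<open>Surplus terms of a longer partial sum are absorbed into the error. The expansions of
  mode sums come with 2 K + 3 terms and an error of order 2 K, so lengths and orders do not match
  directly.\<close>

lemma asym_seriesI:
  assumes "\<And>N. \<exists>M\<ge>N. \<exists>L\<ge>N. (\<lambda>\<phi>. f \<phi> - (\<Sum>n<M. a n * \<phi> ^ n)) \<in> O[at_right 0](\<lambda>\<phi>. \<phi> ^ L)"
  shows "asym_series f a"
  unfolding asym_series_def
proof
  fix N
  obtain M L where le: "M \<ge> N" "L \<ge> N"
    and bd: "(\<lambda>\<phi>. f \<phi> - (\<Sum>n<M. a n * \<phi> ^ n)) \<in> O[at_right 0](\<lambda>\<phi>. \<phi> ^ L)"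
    using assms by blast
  have "(\<lambda>\<phi>. \<Sum>n\<in>{N..<M}. a n * \<phi> ^ n) \<in> O[at_right 0](\<lambda>\<phi>. \<phi> ^ N)"
  proof (rule big_sum_in_bigo)
    fix n assume "n \<in> {N..<M}"
    hence "(\<lambda>\<phi>::real. \<phi> ^ n) \<in> O[at_right 0](\<lambda>\<phi>. \<phi> ^ N)"
      by (intro power_bigo_at_right_0) simp
    moreover have "(\<lambda>\<phi>. a n * \<phi> ^ n) \<in> O[at_right 0](\<lambda>\<phi>. \<phi> ^ n)"
      by (rule bigoI[of _ "\<bar>a n\<bar>"]) (simp add: abs_mult)
    ultimately show "(\<lambda>\<phi>. a n * \<phi> ^ n) \<in> O[at_right 0](\<lambda>\<phi>. \<phi> ^ N)"
      using landau_o.big.trans by blast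
  qed
  from sum_in_bigo(1)[OF landau_o.big.trans[OF bd power_bigo_at_right_0[OF le(2)]] this]
  have "(\<lambda>\<phi>. f \<phi> - (\<Sum>n<M. a n * \<phi> ^ n) + (\<Sum>n\<in>{N..<M}. a n * \<phi> ^ n)) \<in> O[at_right 0](\<lambda>\<phi>. \<phi> ^ N)" .
  moreover have "(\<Sum>n<M. a n * \<phi> ^ n) = (\<Sum>n<N. a n * \<phi> ^ n) + (\<Sum>n\<in>{N..<M}. a n * \<phi> ^ n)" for \<phi>
    using le(1) by (metis (no_types, lifting) lessThan_atLeast0 sum.atLeastLessThan_concat zero_le)
  ultimately show "(\<lambda>\<phi>. f \<phi> - (\<Sum>n<N. a n * \<phi> ^ n)) \<in> O[at_right 0](\<lambda>\<phi>. \<phi> ^ N)" by simp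
qed

lemma asym_series_add:
  assumes "asym_series f a" "asym_series g b"
  shows "asym_series (\<lambda>\<phi>. f \<phi> + g \<phi>) (\<lambda>n. a n + b n)"
  unfolding asym_series_def
proof
  fix N
  have "(\<lambda>\<phi>. (f \<phi> - (\<Sum>n<N. a n * \<phi> ^ n)) + (g \<phi> - (\<Sum>n<N. b n * \<phi> ^ n))) \<in> O[at_right 0](\<lambda>\<phi>. \<phi> ^ N)"
    by (rule sum_in_bigo(1)[OF assms(1)[unfolded asym_series_def, rule_format] assms(2)[unfolded asym_series_def, rule_format]])
  thus "(\<lambda>\<phi>. f \<phi> + g \<phi> - (\<Sum>n<N. (a n + b n) * \<phi> ^ n)) \<in> O[at_right 0](\<lambda>\<phi>. \<phi> ^ N)"
    by (simp add: algebra_simps sum.distrib)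
qed

lemma asym_series_mult_power:
  assumes "asym_series f a"
  shows "asym_series (\<lambda>\<phi>. \<phi> ^ m * f \<phi>) (\<lambda>n. if n < m then 0 else a (n - m))"
proof (rule asym_seriesI)
  fix N
  have "(\<lambda>\<phi>. \<phi> ^ m * (f \<phi> - (\<Sum>n<N. a n * \<phi> ^ n))) \<in> O[at_right 0](\<lambda>\<phi>. \<phi> ^ m * \<phi> ^ N)"
    using assms unfolding asym_series_def by (intro landau_o.big.mult) auto
  moreover have "(\<Sum>n<m + N. (if n < m then 0 else a (n - m)) * \<phi> ^ n) = (\<Sum>n<N. a n * \<phi> ^ n) * \<phi> ^ m" for \<phi>
  proof -
    have "(\<Sum>n<m + N. (if n < m then 0 else a (n - m)) * \<phi> ^ n) = (\<Sum>n\<in>{m..<m + N}. a (n - m) * \<phi> ^ n)"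
      by (rule sum.mono_neutral_cong_right) auto
    also have "\<dots> = (\<Sum>n<N. a n * \<phi> ^ (n + m))"
      by (rule sum.reindex_bij_witness[of _ "\<lambda>n. n + m" "\<lambda>n. n - m"]) auto
    finally show ?thesis by (simp add: power_add sum_distrib_left mult_ac)
  qed
  ultimately show "\<exists>M\<ge>N. \<exists>L\<ge>N. (\<lambda>\<phi>. \<phi> ^ m * f \<phi> - (\<Sum>n<M. (if n < m then 0 else a (n - m)) * \<phi> ^ n))
      \<in> O[at_right 0](\<lambda>\<phi>. \<phi> ^ L)"
    by (intro exI[of _ "m + N"]) (auto intro!: exI[of _ "m + N"] simp: power_add algebra_simps)
qed

text \<open>An expansion a + b t^2 + c t^4 with error o(t^4). Applied to E / t^2, its three
  coefficients are those of t^-4, t^-2 and t^0 in E / t^6, which multiply \<open>\<zeta>(4)\<close>,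
  \<open>\<zeta>(2)\<close> and \<open>\<zeta>(0)\<close>.\<close>

definition expands :: "(real \<Rightarrow> real) \<Rightarrow> real \<Rightarrow> real \<Rightarrow> real \<Rightarrow> bool" where
  "expands f a b c \<longleftrightarrow> ((\<lambda>t. (f t - (a + b * t\<^sup>2 + c * t ^ 4)) / t ^ 4) \<longlongrightarrow> 0) (at_right 0)"

lemma expands_mult:
  assumes "expands f a b c" "expands g a' b' c'"
  shows "expands (\<lambda>t. f t * g t) (a * a') (a * b' + b * a') (a * c' + b * b' + c * a')"
proof -
  define p where "p t = a + b * t\<^sup>2 + c * t ^ 4" for t :: real
  define p' where "p' t = a' + b' * t\<^sup>2 + c' * t ^ 4" for t :: real
  define r where "r t = (f t - p t) / t ^ 4" for t
  define r' where "r' t = (g t - p' t) / t ^ 4" for t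
  have r: "(r \<longlongrightarrow> 0) (at_right 0)" "(r' \<longlongrightarrow> 0) (at_right 0)"
    using assms by (simp_all add: expands_def r_def[abs_def] r'_def[abs_def] p_def p'_def)
  \<comment> \<open>This is the scaled error of the product, written out: \<open>r\<close> and
    \<open>r'\<close> are the scaled errors of the factors, and the overflow terms b c' + c b' and c
    c' carry positive powers of t.\<close>
  have "((\<lambda>t. r t * (p' t + r' t * t ^ 4) + p t * r' t + (b * c' + c * b') * t\<^sup>2 + c * c' * t ^ 4) \<longlongrightarrow>
      0 * ((a' + b' * 0\<^sup>2 + c' * 0 ^ 4) + 0 * 0 ^ 4) + (a + b * 0\<^sup>2 + c * 0 ^ 4) * 0 + (b * c' + c * b') * 0\<^sup>2 + c * c' * 0 ^ 4) (at_right 0)"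
    unfolding p_def p'_def by (intro tendsto_intros r)
  moreover have "eventually (\<lambda>t. r t * (p' t + r' t * t ^ 4) + p t * r' t + (b * c' + c * b') * t\<^sup>2 + c * c' * t ^ 4
      = (f t * g t - (a * a' + (a * b' + b * a') * t\<^sup>2 + (a * c' + b * b' + c * a') * t ^ 4)) / t ^ 4) (at_right 0)"
  proof (intro eventually_at_right_less[THEN eventually_mono])
    fix t :: real assume t: "0 < t"
    have f: "f t = p t + r t * t ^ 4" and g: "g t = p' t + r' t * t ^ 4" using t by (simp_all add: r_def r'_def)
    have "f t * g t - (a * a' + (a * b' + b * a') * t\<^sup>2 + (a * c' + b * b' + c * a') * t ^ 4) =
       (r t * (p' t + r' t * t ^ 4) + p t * r' t + (b * c' + c * b') * t\<^sup>2 + c * c' * t ^ 4) * t ^ 4"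
      unfolding f g unfolding p_def p'_def by algebra
    thus "r t * (p' t + r' t * t ^ 4) + p t * r' t + (b * c' + c * b') * t\<^sup>2 + c * c' * t ^ 4
      = (f t * g t - (a * a' + (a * b' + b * a') * t\<^sup>2 + (a * c' + b * b' + c * a') * t ^ 4)) / t ^ 4"
      using t by (simp add: field_simps)
  qed
  ultimately show ?thesis unfolding expands_def using Lim_transform_eventually by (simp cong: filterlim_cong)
qed

text \<open>From |sin x| \<le> |x|. Both bounds also hold at t = 0, where division by zero makes the
  value 0.\<close>

lemma sinc_sq_bounds: "0 \<le> sinc_sq t" "sinc_sq t \<le> 1"
proof -
  have "(sin (t / 2))\<^sup>2 \<le> (t / 2)\<^sup>2"
    using abs_sin_x_le_abs_x[of "t / 2"] by (simp only: abs_le_square_iff)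
  hence "1 - t\<^sup>2 / 2 \<le> cos t" using cos_double_sin[of "t / 2"] by (simp add: power_divide)
  thus "0 \<le> sinc_sq t" "sinc_sq t \<le> 1"
    by (auto simp: sinc_sq_def divide_le_eq)
qed

lemma expandsI:
  assumes "\<And>t. 0 < t \<Longrightarrow> t < 1 \<Longrightarrow> \<bar>f t - (a + b * t\<^sup>2 + c * t ^ 4)\<bar> \<le> C * t ^ 5"
  shows "expands f a b c"
  unfolding expands_def
proof (rule Lim_null_comparison)
  have "eventually (\<lambda>\<phi>::real. \<phi> \<in> {0<..<1}) (at_right 0)"
    by (rule eventually_at_right_real) simp
  thus "eventually (\<lambda>t. norm ((f t - (a + b * t\<^sup>2 + c * t ^ 4)) / t ^ 4) \<le> C * t) (at_right 0)"
  proof eventually_elim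
    case (elim t)
    thus ?case using assms[of t] by (simp add: divide_le_eq power_numeral_reduce mult_ac)
  qed
  show "((\<lambda>t. C * t) \<longlongrightarrow> 0) (at_right 0)" by (auto intro!: tendsto_eq_intros)
qed

lemma expands_sinc_sq: "expands sinc_sq 1 (- 1 / 12) (1 / 360)"
proof (rule expandsI[where C = 2])
  fix t :: real assume t: "0 < t" "t < 1"
  have "{..3::nat} = {0, 1, 2, 3}" by auto
  moreover have "fact 4 = (24 :: real)" "fact 6 = (720 :: real)" by (simp_all add: fact_numeral)
  ultimately have "\<bar>cos t - (1 - t ^ 2 / 2 + t ^ 4 / 24 - t ^ 6 / 720)\<bar> \<le> \<bar>t\<bar> ^ 7"
    using cos_remainder[of t 3] by simp
  hence "2 * \<bar>cos t - (1 - t ^ 2 / 2 + t ^ 4 / 24 - t ^ 6 / 720)\<bar> / t\<^sup>2 \<le> 2 * t ^ 5"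
    using t by (simp add: divide_le_eq power_numeral_reduce mult_ac)
  also have "2 * \<bar>cos t - (1 - t ^ 2 / 2 + t ^ 4 / 24 - t ^ 6 / 720)\<bar> / t\<^sup>2
     = \<bar>2 * (cos t - (1 - t ^ 2 / 2 + t ^ 4 / 24 - t ^ 6 / 720)) / t\<^sup>2\<bar>"
    unfolding abs_divide abs_mult by simp
  also have "2 * (cos t - (1 - t ^ 2 / 2 + t ^ 4 / 24 - t ^ 6 / 720)) / t\<^sup>2
     = - (sinc_sq t - (1 + - 1 / 12 * t\<^sup>2 + 1 / 360 * t ^ 4))"
    using t by (simp add: sinc_sq_def field_simps power_numeral_reduce)
  finally show "\<bar>sinc_sq t - (1 + - 1 / 12 * t\<^sup>2 + 1 / 360 * t ^ 4)\<bar> \<le> 2 * t ^ 5" by simp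
qed

text \<open>At order t^4 either one factor contributes 1/360, in k ways, or two factors contribute
  1/12 each up to sign, in k (k - 1) / 2 ways.\<close>

lemma expands_sinc_sq_power:
  "expands (\<lambda>t. sinc_sq t ^ k) 1 (- real k / 12) (real k / 360 + real k * (real k - 1) / 288)"
proof (induction k)
  case 0
  show ?case by (simp add: expands_def)
next
  case (Suc k)
  have e: "1 * (- real k / 12) + (- 1 / 12) * 1 = - real (Suc k) / 12"
    "1 * (real k / 360 + real k * (real k - 1) / 288) + (- 1 / 12) * (- real k / 12) + (1 / 360) * 1
     = real (Suc k) / 360 + real (Suc k) * (real (Suc k) - 1) / 288"
    by (simp_all add: field_simps)
  show ?case using expands_mult[OF expands_sinc_sq Suc.IH] unfolding e by simp
qed

text \<open>A summand of \<open>T_I\<close> without the factor T0^4 / pi^2, for \<rho> = r T0 and a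
  numerator \<open>E\<close> taken at the multiple of \<phi>; the index is shifted by one so that
  sums start at 0.\<close>

abbreviation mode_term :: "real \<Rightarrow> (real \<Rightarrow> real) \<Rightarrow> real \<Rightarrow> nat \<Rightarrow> real" where
  "mode_term \<rho> E \<phi> n \<equiv> \<phi> ^ 4 * E (real (Suc n) * \<phi>) /
     ((real (Suc n))\<^sup>2 * \<phi>\<^sup>2 + 4 * (sin (real (Suc n) * \<phi> / 2))\<^sup>2 * \<rho>\<^sup>2 * \<phi>\<^sup>2) ^ 3"

definition mode_sum :: "real \<Rightarrow> (real \<Rightarrow> real) \<Rightarrow> real \<Rightarrow> real" where
  "mode_sum \<rho> E \<phi> = (\<Sum>n. mode_term \<rho> E \<phi> n)"

lemma mode_term_eq:
  assumes "\<phi> \<noteq> 0"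
  shows "mode_term \<rho> E \<phi> n
    = \<phi> ^ 4 * (E (real (Suc n) * \<phi>) / (real (Suc n) * \<phi>) ^ 6 *
        (1 / (1 + \<rho>\<^sup>2 * \<phi>\<^sup>2 * sinc_sq (real (Suc n) * \<phi>)) ^ 3))"
proof -
  define t where "t = real (Suc n) * \<phi>"
  have t: "t \<noteq> 0" using assms by (simp add: t_def del: of_nat_Suc)
  have "4 * (sin (t / 2))\<^sup>2 = sinc_sq t * t\<^sup>2"
    using t cos_double_sin[of "t / 2"] by (simp add: sinc_sq_def)
  hence "(real (Suc n))\<^sup>2 * \<phi>\<^sup>2 + 4 * (sin (t / 2))\<^sup>2 * \<rho>\<^sup>2 * \<phi>\<^sup>2
     = t\<^sup>2 * (1 + \<rho>\<^sup>2 * \<phi>\<^sup>2 * sinc_sq t)"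
    by (simp add: t_def power_mult_distrib algebra_simps del: of_nat_Suc)
  hence "((real (Suc n))\<^sup>2 * \<phi>\<^sup>2 + 4 * (sin (t / 2))\<^sup>2 * \<rho>\<^sup>2 * \<phi>\<^sup>2) ^ 3
     = t ^ 6 * (1 + \<rho>\<^sup>2 * \<phi>\<^sup>2 * sinc_sq t) ^ 3"
    by (simp add: power_mult_distrib flip: power_mult)
  thus ?thesis by (simp add: t_def)
qed

text \<open>The denominator is at least t^6, so a numerator of order t^p leaves an inverse power 6 -
  p of the summation index, and p \<le> 4 keeps it at least 2. Even numerators use p = 2, odd ones p
  = 3.\<close>

lemma mode_sum_summable:
  assumes "\<phi> \<noteq> 0" and "\<And>t. \<bar>E t\<bar> \<le> c * \<bar>t\<bar> ^ p" and "p \<le> 4"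
  shows "summable (\<lambda>n. mode_term \<rho> E \<phi> n)"
proof (rule summable_comparison_test')
  have c: "c \<ge> 0" using assms(2)[of 1] by auto
  show "summable (\<lambda>n. \<phi> ^ 4 * (c * \<bar>\<phi>\<bar> ^ p / \<phi> ^ 6) * (1 / real (Suc n) ^ (6 - p)))"
    by (intro summable_mult summable_inverse_Suc_power) (use assms in auto)
  fix n
  define t where "t = real (Suc n) * \<phi>"
  have t: "t \<noteq> 0" using assms by (simp add: t_def del: of_nat_Suc)
  have f: "0 \<le> 1 / (1 + \<rho>\<^sup>2 * \<phi>\<^sup>2 * sinc_sq t) ^ 3" "1 / (1 + \<rho>\<^sup>2 * \<phi>\<^sup>2 * sinc_sq t) ^ 3 \<le> 1"
  proof -
    have "1 \<le> 1 + \<rho>\<^sup>2 * \<phi>\<^sup>2 * sinc_sq t" using sinc_sq_bounds[of t] by simp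
    moreover have "0 \<le> 1 / d \<and> 1 / d \<le> 1" if "1 \<le> d" for d :: real using that by auto
    ultimately show "0 \<le> 1 / (1 + \<rho>\<^sup>2 * \<phi>\<^sup>2 * sinc_sq t) ^ 3"
      "1 / (1 + \<rho>\<^sup>2 * \<phi>\<^sup>2 * sinc_sq t) ^ 3 \<le> 1" using one_le_power by blast+
  qed
  have "\<bar>E t / t ^ 6 * (1 / (1 + \<rho>\<^sup>2 * \<phi>\<^sup>2 * sinc_sq t) ^ 3)\<bar> \<le> (c * \<bar>t\<bar> ^ p / t ^ 6) * 1"
    unfolding abs_mult using f assms(2)[of t] t c
    by (intro mult_mono) (auto simp: divide_right_mono)
  also have "\<dots> = c * \<bar>\<phi>\<bar> ^ p / \<phi> ^ 6 * (1 / real (Suc n) ^ (6 - p))"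
  proof -
    have "real (Suc n) ^ 6 = real (Suc n) ^ p * real (Suc n) ^ (6 - p)"
      using assms(3) by (simp flip: power_add)
    thus ?thesis by (simp add: t_def power_mult_distrib abs_mult del: of_nat_Suc)
  qed
  finally have "\<phi> ^ 4 * \<bar>E t / t ^ 6 * (1 / (1 + \<rho>\<^sup>2 * \<phi>\<^sup>2 * sinc_sq t) ^ 3)\<bar> \<le>
     \<phi> ^ 4 * (c * \<bar>\<phi>\<bar> ^ p / \<phi> ^ 6 * (1 / real (Suc n) ^ (6 - p)))"
    by (rule mult_left_mono) simp
  thus "norm (mode_term \<rho> E \<phi> n)
    \<le> \<phi> ^ 4 * (c * \<bar>\<phi>\<bar> ^ p / \<phi> ^ 6) * (1 / real (Suc n) ^ (6 - p))"
    unfolding mode_term_eq[OF assms(1)] t_def by (simp only: real_norm_def abs_mult mult.assoc) (simp add: abs_mult)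
qed

text \<open>\<open>rat_num e2 e4 e6 \<rho> s / (1 + u)^5\<close>, \<open>u = \<rho>\<^sup>2 s\<^sup>2\<close>, collects the terms with \<open>\<zeta>(4)\<close>, \<open>\<zeta>(2)\<close>
  and \<open>\<zeta>(0)\<close> of all orders: the sums over \<open>k\<close> of \<open>c k * u^k\<close>, \<open>k * c k * u^k\<close> and
  \<open>k * (k - 1) * c k * u^k\<close>, where \<open>c k\<close> are the coefficients of \<open>(1 + u)^(-3)\<close>, are
  \<open>(1 + u)^(-3)\<close>, \<open>- 3 u (1 + u)^(-4)\<close> and \<open>12 u\<^sup>2 (1 + u)^(-5)\<close>.\<close>
definition rat_num :: "real \<Rightarrow> real \<Rightarrow> real \<Rightarrow> real \<Rightarrow> 'a \<Rightarrow> 'a :: real_normed_field" where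
  "rat_num e2 e4 e6 \<rho> s = (let u = of_real (\<rho>\<^sup>2) * s\<^sup>2 in
     of_real (pi ^ 4 / 90 * e2) * (1 + u)\<^sup>2
     + of_real (pi\<^sup>2 / 6) * s\<^sup>2 * (of_real e4 * (1 + u)\<^sup>2 + of_real (e2 / 4) * (u * (1 + u)))
     - of_real (1 / 2) * s ^ 4 * (of_real e6 * (1 + u)\<^sup>2 + of_real (e4 / 4) * (u * (1 + u))
         + of_real e2 * (of_real (1 / 24) * u\<^sup>2 - of_real (1 / 120) * (u * (1 + u)))))"

text \<open>With G = 1 / (1 + X) the rule G' = - G^2 gives all derivatives of G^3. The weights k and
  k (k - 1) on the coefficients are produced by X d/dX and X^2 d^2/dX^2.\<close>

lemma inverse_cube_expansions:
  fixes F :: "real fps"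
  defines "F \<equiv> inverse ((1 + fps_X) ^ 3)"
  shows "(\<lambda>u. 1 / (1 + u) ^ 3 - (\<Sum>k<K. fps_nth F k * u ^ k)) \<in> O[nhds 0](\<lambda>u. u ^ K)"
    and "(\<lambda>u. - 3 * u / (1 + u) ^ 4 - (\<Sum>k<K. real k * fps_nth F k * u ^ k)) \<in> O[nhds 0](\<lambda>u. u ^ K)"
    and "(\<lambda>u. 12 * u\<^sup>2 / (1 + u) ^ 5 - (\<Sum>k<K. real k * (real k - 1) * fps_nth F k * u ^ k)) \<in> O[nhds 0](\<lambda>u. u ^ K)"
proof -
  define G :: "real fps" where "G = inverse (1 + fps_X)"
  have c: "(1 + fps_X) * G = 1" unfolding G_def by (rule inverse_mult_eq_1') simp
  have F: "F = G ^ 3" unfolding F_def G_def by (rule fps_inverse_power)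
  have dG: "fps_deriv G = - G\<^sup>2"
    unfolding G_def by (simp add: fps_inverse_deriv)
  have d1: "fps_deriv F = - 3 * G ^ 4"
    unfolding F fps_deriv_power' dG by (simp add: power_numeral_reduce)
  have d2: "fps_deriv (fps_deriv F) = 12 * G ^ 5"
    unfolding d1 by (simp add: fps_deriv_power' dG power_numeral_reduce)
  have "(\<lambda>u. inverse (1 + u)) has_fps_expansion G"
    unfolding G_def by (intro fps_expansion_intros) auto
  hence G: "(\<lambda>u. inverse (1 + u) ^ m) has_fps_expansion G ^ m" for m
    by (induction m) (auto intro!: fps_expansion_intros)
  have "(\<lambda>u. inverse (1 + u) ^ 3) has_fps_expansion F" unfolding F by (rule G)
  from has_fps_expansion_bigo[OF this, of K]
  show "(\<lambda>u. 1 / (1 + u) ^ 3 - (\<Sum>k<K. fps_nth F k * u ^ k)) \<in> O[nhds 0](\<lambda>u. u ^ K)"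
    by (simp add: inverse_eq_divide power_divide)
  have "(\<lambda>u. u * (- 3 * inverse (1 + u) ^ 4)) has_fps_expansion fps_X * fps_deriv F"
    unfolding d1 by (intro fps_expansion_intros G)
  moreover have "fps_nth (fps_X * fps_deriv F) k = real k * fps_nth F k" for k
    by (cases k) auto
  ultimately show "(\<lambda>u. - 3 * u / (1 + u) ^ 4 - (\<Sum>k<K. real k * fps_nth F k * u ^ k)) \<in> O[nhds 0](\<lambda>u. u ^ K)"
    using has_fps_expansion_bigo[of _ "fps_X * fps_deriv F" K] by (fastforce simp: inverse_eq_divide power_divide mult_ac)
  have "(\<lambda>u. u * (u * (12 * inverse (1 + u) ^ 5))) has_fps_expansion fps_X * (fps_X * fps_deriv (fps_deriv F))"
    unfolding d2 by (intro fps_expansion_intros G)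
  from has_fps_expansion_bigo[OF this, of K]
  show "(\<lambda>u. 12 * u\<^sup>2 / (1 + u) ^ 5 - (\<Sum>k<K. real k * (real k - 1) * fps_nth F k * u ^ k)) \<in> O[nhds 0](\<lambda>u. u ^ K)"
  proof -
    have "fps_nth (fps_X * (fps_X * fps_deriv (fps_deriv F))) k = real k * (real k - 1) * fps_nth F k" for k
      by (cases k; cases "k - 1") (auto simp: algebra_simps)
    thus "(\<lambda>u. u * (u * (12 * inverse (1 + u) ^ 5)) - (\<Sum>n<K. (fps_X * (fps_X * fps_deriv (fps_deriv F))) $ n * u ^ n))
        \<in> O[nhds 0](\<lambda>x. x ^ K) \<Longrightarrow> ?thesis"
      by (simp add: inverse_eq_divide power_divide power2_eq_square mult_ac)
  qed
qed

lemma bigo_nhds_0_compose: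
  fixes f :: "real \<Rightarrow> real"
  assumes "f \<in> O[nhds 0](\<lambda>u. u ^ K)"
  shows "(\<lambda>\<phi>. f (\<rho>\<^sup>2 * \<phi>\<^sup>2)) \<in> O[at_right 0](\<lambda>\<phi>. \<phi> ^ (2 * K))"
proof -
  have "((\<lambda>\<phi>. \<rho>\<^sup>2 * \<phi>\<^sup>2) \<longlongrightarrow> \<rho>\<^sup>2 * 0\<^sup>2) (at_right 0)" by (intro tendsto_intros)
  hence "filterlim (\<lambda>\<phi>. \<rho>\<^sup>2 * \<phi>\<^sup>2) (nhds 0) (at_right 0)" by simp
  from landau_o.big.compose[OF assms this]
  have "(\<lambda>\<phi>. f (\<rho>\<^sup>2 * \<phi>\<^sup>2)) \<in> O[at_right 0](\<lambda>\<phi>. (\<rho>\<^sup>2 * \<phi>\<^sup>2) ^ K)" .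
  moreover have "(\<lambda>\<phi>. (\<rho>\<^sup>2 * \<phi>\<^sup>2) ^ K) \<in> O[at_right 0](\<lambda>\<phi>. \<phi> ^ (2 * K))"
    by (rule bigoI[of _ "\<bar>(\<rho>\<^sup>2) ^ K\<bar>"]) (simp add: power_mult_distrib abs_mult power_mult)
  ultimately show ?thesis using landau_o.big.trans by blast
qed

text \<open>For fixed K the factor (1 + v)^(-3), with v = \<rho>^2 \<phi>^2
  \<open>sinc_sq t\<close>, is replaced by its Taylor polynomial of degree below K. Each of the K
  lattice sums is exact for small \<phi>, and finitely many thresholds can be met at once. The
  result splits into a truncation of the rational function and the odd powers coming from C /
  \<phi>.\<close>

lemma mode_sum_asym_series:
  assumes tl: "trig_laurent (\<lambda>t. E t / t ^ 6)"
    and bound: "\<And>t. \<bar>E t\<bar> \<le> c * t\<^sup>2"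
    and exp: "expands (\<lambda>t. E t / t\<^sup>2) e2 e4 e6"
  shows "\<exists>a. (\<forall>n. even n \<longrightarrow> a n = 0) \<and>
    asym_series (\<lambda>\<phi>. mode_sum \<rho> E \<phi> - rat_num e2 e4 e6 \<rho> \<phi> / (1 + \<rho>\<^sup>2 * \<phi>\<^sup>2) ^ 5) a"
proof -
  define F :: "real fps" where "F = inverse ((1 + fps_X) ^ 3)"
  \<comment> \<open>The Laurent coefficients at t^-2 and t^0 of E / t^6 times
    \<open>sinc_sq ^ k\<close>; the one at t^-4 is e2 for every k.\<close>
  define h1 where "h1 k = e4 - real k * e2 / 12" for k
  define h0 where "h0 k = e6 - real k * e4 / 12 + e2 * (real k / 360 + real k * (real k - 1) / 288)" for k
  define H where "H k t = E t / t ^ 6 * sinc_sq t ^ k" for k t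
  have "\<exists>C. \<exists>\<delta>>0. \<forall>\<phi>. 0 < \<phi> \<and> \<phi> < \<delta> \<longrightarrow> (\<lambda>n. H k (real (Suc n) * \<phi>)) sums
     (pi ^ 4 / 90 * e2 / \<phi> ^ 4 + pi\<^sup>2 / 6 * h1 k / \<phi> ^ 2 - h0 k / 2 + C / \<phi>)" for k
  proof (rule trig_laurent_sums)
    show "trig_laurent (H k)" unfolding H_def[abs_def] by (rule trig_laurent_mult_sinc_sq_power[OF tl])
    have coeffs: "e2 * 1 = e2" "e2 * (- real k / 12) + e4 * 1 = h1 k"
      "e2 * (real k / 360 + real k * (real k - 1) / 288) + e4 * (- real k / 12) + e6 * 1 = h0 k"
      by (simp_all add: h1_def h0_def)
    have "((\<lambda>t. (E t / t\<^sup>2 * sinc_sq t ^ k - (e2 + h1 k * t\<^sup>2 + h0 k * t ^ 4)) / t ^ 4) \<longlongrightarrow> 0) (at_right 0)"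
      using expands_mult[OF exp expands_sinc_sq_power[of k]] unfolding coeffs expands_def .
    moreover have "eventually (\<lambda>t. (E t / t\<^sup>2 * sinc_sq t ^ k - (e2 + h1 k * t\<^sup>2 + h0 k * t ^ 4)) / t ^ 4
        = H k t - (e2 / t ^ 4 + h1 k / t ^ 2 + h0 k)) (at_right 0)"
      by (intro eventually_at_right_less[THEN eventually_mono])
         (simp add: H_def diff_divide_distrib add_divide_distrib power_numeral_reduce)
    ultimately show "((\<lambda>t. H k t - (e2 / t ^ 4 + h1 k / t ^ 2 + h0 k)) \<longlongrightarrow> 0) (at_right 0)"
      using Lim_transform_eventually by (simp cong: filterlim_cong)
  qed
  then obtain C \<delta> where \<delta>: "\<And>k. \<delta> k > 0" and H_sums: "\<And>k \<phi>. 0 < \<phi> \<Longrightarrow> \<phi> < \<delta> k \<Longrightarrow>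
     (\<lambda>n. H k (real (Suc n) * \<phi>)) sums
     (pi ^ 4 / 90 * e2 / \<phi> ^ 4 + pi\<^sup>2 / 6 * h1 k / \<phi> ^ 2 - h0 k / 2 + C k / \<phi>)"
    by metis
  \<comment> \<open>The product of \<phi>^4, \<phi>^(2 k) and C k / \<phi> has the odd exponent 2 k
    + 3.\<close>
  define a where "a n = (if odd n \<and> n \<ge> 3 then
     fps_nth F ((n - 3) div 2) * (\<rho>\<^sup>2) ^ ((n - 3) div 2) * C ((n - 3) div 2) else 0)" for n
  have a_sum: "(\<Sum>n<2 * K + 3. a n * \<phi> ^ n) = (\<Sum>k<K. fps_nth F k * (\<rho>\<^sup>2 * \<phi>\<^sup>2) ^ k * (C k * \<phi> ^ 3))" for K \<phi>
  proof (induction K)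
    case 0
    have "{..<3 :: nat} = {0, 1, 2}" by auto
    thus ?case by (simp add: a_def)
  next
    case (Suc K)
    have "(\<Sum>n<2 * Suc K + 3. a n * \<phi> ^ n) = (\<Sum>n<2 * K + 3. a n * \<phi> ^ n) + a (2 * K + 3) * \<phi> ^ (2 * K + 3)
        + a (2 * K + 4) * \<phi> ^ (2 * K + 4)"
      by (simp add: eval_nat_numeral)
    also have "a (2 * K + 4) = 0" by (simp add: a_def)
    also have "a (2 * K + 3) * \<phi> ^ (2 * K + 3) = fps_nth F K * (\<rho>\<^sup>2 * \<phi>\<^sup>2) ^ K * (C K * \<phi> ^ 3)"
      by (simp add: a_def power_add power_mult power_mult_distrib)
    finally show ?case using Suc.IH by simp
  qed
  define u where "u \<phi> = \<rho>\<^sup>2 * \<phi>\<^sup>2" for \<phi>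
  define R where "R K \<phi> = (\<Sum>k<K. fps_nth F k * u \<phi> ^ k *
     (pi ^ 4 / 90 * e2 + pi\<^sup>2 / 6 * h1 k * \<phi>\<^sup>2 - h0 k / 2 * \<phi> ^ 4))" for K \<phi>
  have main: "(\<lambda>\<phi>. mode_sum \<rho> E \<phi> - (R K \<phi> + (\<Sum>n<2 * K + 3. a n * \<phi> ^ n))) \<in> O[at_right 0](\<lambda>\<phi>. \<phi> ^ (2 * K))" for K
  proof -
    from inverse_cube_expansions(1)[of K] obtain M where M: "M > 0"
      "eventually (\<lambda>u. norm (1 / (1 + u) ^ 3 - (\<Sum>k<K. fps_nth F k * u ^ k)) \<le> M * norm (u ^ K)) (nhds 0)"
      unfolding F_def by (elim landau_o.bigE)
    then obtain d where d: "d > 0"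
      "\<And>u. \<bar>u\<bar> < d \<Longrightarrow> \<bar>1 / (1 + u) ^ 3 - (\<Sum>k<K. fps_nth F k * u ^ k)\<bar> \<le> M * \<bar>u\<bar> ^ K"
      by (auto simp: eventually_nhds_metric dist_norm power_abs)
    have "c \<ge> 0" using bound[of 1] by auto
    \<comment> \<open>Since \<phi>^4 E(t) / t^6 is at most c \<phi>^4 / t^4 = c / (n + 1)^4 in
      modulus, the errors add up to a multiple of this number.\<close>
    define Z where "Z = (\<Sum>n. 1 / real (Suc n) ^ 4)"
    have "((\<lambda>\<phi>. u \<phi>) \<longlongrightarrow> \<rho>\<^sup>2 * 0\<^sup>2) (at_right 0)" unfolding u_def by (intro tendsto_intros)
    hence ev_u: "eventually (\<lambda>\<phi>. u \<phi> < d) (at_right 0)" using d(1) by (intro order_tendstoD) auto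
    have ev_\<delta>: "eventually (\<lambda>\<phi>. \<forall>k<K. \<phi> < \<delta> k) (at_right 0)"
      using \<delta> by (auto intro!: eventually_ball_finite[of "{..<K}", simplified Ball_def, simplified]
          order_tendstoD[of _ 0] tendsto_ident_at)
    have bnd: "\<bar>mode_sum \<rho> E \<phi> - (R K \<phi> + (\<Sum>n<2 * K + 3. a n * \<phi> ^ n))\<bar> \<le> c * M * (\<rho>\<^sup>2) ^ K * Z * \<phi> ^ (2 * K)"
      if \<phi>: "0 < \<phi>" and u_less: "u \<phi> < d" and \<delta>_less: "\<forall>k<K. \<phi> < \<delta> k" for \<phi>
    proof -
      define t where "t n = real (Suc n) * \<phi>" for n
      have t: "t n > 0" for n using \<phi> by (simp add: t_def)
      define f where "f n = \<phi> ^ 4 * (E (t n) / t n ^ 6 * (1 / (1 + u \<phi> * sinc_sq (t n)) ^ 3))" for n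
      define g where "g n = (\<Sum>k<K. fps_nth F k * u \<phi> ^ k * \<phi> ^ 4 * H k (t n))" for n
      have f_sums: "f sums mode_sum \<rho> E \<phi>"
      proof -
        have "f = (\<lambda>n. mode_term \<rho> E \<phi> n)"
          using \<phi> by (intro ext, subst mode_term_eq) (auto simp only: f_def t_def u_def)
        moreover have "summable (\<lambda>n. mode_term \<rho> E \<phi> n)"
          by (rule mode_sum_summable[of \<phi> E c 2]) (use \<phi> bound in auto)
        ultimately show ?thesis using summable_sums by (simp only: mode_sum_def)
      qed
      have "g sums (\<Sum>k<K. fps_nth F k * u \<phi> ^ k * \<phi> ^ 4 *
         (pi ^ 4 / 90 * e2 / \<phi> ^ 4 + pi\<^sup>2 / 6 * h1 k / \<phi> ^ 2 - h0 k / 2 + C k / \<phi>))"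
        unfolding g_def[abs_def] t_def using \<phi> \<delta>_less by (intro sums_sum sums_mult H_sums) auto
      also have "(\<Sum>k<K. fps_nth F k * u \<phi> ^ k * \<phi> ^ 4 *
         (pi ^ 4 / 90 * e2 / \<phi> ^ 4 + pi\<^sup>2 / 6 * h1 k / \<phi> ^ 2 - h0 k / 2 + C k / \<phi>))
         = (\<Sum>k<K. fps_nth F k * u \<phi> ^ k *
     (pi ^ 4 / 90 * e2 + pi\<^sup>2 / 6 * h1 k * \<phi>\<^sup>2 - h0 k / 2 * \<phi> ^ 4) + fps_nth F k * u \<phi> ^ k * (C k * \<phi> ^ 3))"
      proof (intro sum.cong refl)
        fix k
        have "\<phi> ^ 4 * (pi ^ 4 / 90 * e2 / \<phi> ^ 4 + pi\<^sup>2 / 6 * h1 k / \<phi> ^ 2 - h0 k / 2 + C k / \<phi>)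
           = (pi ^ 4 / 90 * e2 + pi\<^sup>2 / 6 * h1 k * \<phi>\<^sup>2 - h0 k / 2 * \<phi> ^ 4) + C k * \<phi> ^ 3"
          using \<phi> by (simp add: distrib_left right_diff_distrib power_numeral_reduce mult_ac)
        thus "fps_nth F k * u \<phi> ^ k * \<phi> ^ 4 *
         (pi ^ 4 / 90 * e2 / \<phi> ^ 4 + pi\<^sup>2 / 6 * h1 k / \<phi> ^ 2 - h0 k / 2 + C k / \<phi>) = fps_nth F k * u \<phi> ^ k *
     (pi ^ 4 / 90 * e2 + pi\<^sup>2 / 6 * h1 k * \<phi>\<^sup>2 - h0 k / 2 * \<phi> ^ 4) + fps_nth F k * u \<phi> ^ k * (C k * \<phi> ^ 3)"
          by (simp only: mult.assoc distrib_left[symmetric])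
      qed
      also have "\<dots> = R K \<phi> + (\<Sum>n<2 * K + 3. a n * \<phi> ^ n)"
        unfolding a_sum R_def u_def by (simp only: sum.distrib)
      finally have fg: "(\<lambda>n. f n - g n) sums (mode_sum \<rho> E \<phi> - (R K \<phi> + (\<Sum>n<2 * K + 3. a n * \<phi> ^ n)))"
        by (rule sums_diff[OF f_sums])
      have fg_bound: "\<bar>f n - g n\<bar> \<le> c * M * (\<rho>\<^sup>2) ^ K * \<phi> ^ (2 * K) * (1 / real (Suc n) ^ 4)" for n
      proof -
        define v where "v = u \<phi> * sinc_sq (t n)"
        have v: "0 \<le> v" "v \<le> u \<phi>"
          using sinc_sq_bounds[of "t n"] by (auto simp: v_def u_def intro: mult_left_le)
        have "f n - g n = \<phi> ^ 4 * (E (t n) / t n ^ 6) * (1 / (1 + v) ^ 3 - (\<Sum>k<K. fps_nth F k * v ^ k))"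
          by (simp add: f_def g_def H_def v_def power_mult_distrib algebra_simps sum_distrib_left sum_divide_distrib)
        also have "\<bar>\<dots>\<bar> = \<phi> ^ 4 * (\<bar>E (t n)\<bar> / t n ^ 6) * \<bar>1 / (1 + v) ^ 3 - (\<Sum>k<K. fps_nth F k * v ^ k)\<bar>"
          using \<phi> t[of n] by (simp add: abs_mult)
        also have "\<dots> \<le> \<phi> ^ 4 * (c * (t n)\<^sup>2 / t n ^ 6) * (M * u \<phi> ^ K)"
        proof (intro mult_mono mult_left_mono divide_right_mono bound)
          have "\<bar>1 / (1 + v) ^ 3 - (\<Sum>k<K. fps_nth F k * v ^ k)\<bar> \<le> M * \<bar>v\<bar> ^ K"
            using v u_less by (intro d(2)) auto
          also have "\<dots> \<le> M * u \<phi> ^ K" using v M(1) by (intro mult_left_mono power_mono) auto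
          finally show "\<bar>1 / (1 + v) ^ 3 - (\<Sum>k<K. fps_nth F k * v ^ k)\<bar> \<le> M * u \<phi> ^ K" .
        qed (use \<phi> t[of n] \<open>c \<ge> 0\<close> in auto)
        also have "\<dots> = c * M * (\<rho>\<^sup>2) ^ K * \<phi> ^ (2 * K) * (\<phi> ^ 4 * ((t n)\<^sup>2 / t n ^ 6))"
          by (simp add: u_def power_mult_distrib power_mult)
        also have "\<phi> ^ 4 * ((t n)\<^sup>2 / t n ^ 6) = 1 / real (Suc n) ^ 4"
          using \<phi> by (simp add: t_def power_mult_distrib power_numeral_reduce del: of_nat_Suc)
        finally show ?thesis .
      qed
      have "summable (\<lambda>n. c * M * (\<rho>\<^sup>2) ^ K * \<phi> ^ (2 * K) * (1 / real (Suc n) ^ 4))"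
        by (intro summable_mult summable_inverse_Suc_power) simp
      from norm_sums_le[OF fg summable_sums[OF this]] fg_bound
      have "\<bar>mode_sum \<rho> E \<phi> - (R K \<phi> + (\<Sum>n<2 * K + 3. a n * \<phi> ^ n))\<bar>
         \<le> (\<Sum>n. c * M * (\<rho>\<^sup>2) ^ K * \<phi> ^ (2 * K) * (1 / real (Suc n) ^ 4))"
        by simp
      also have "\<dots> = c * M * (\<rho>\<^sup>2) ^ K * Z * \<phi> ^ (2 * K)"
        unfolding Z_def by (subst suminf_mult[OF summable_inverse_Suc_power]) (simp, simp only: mult_ac)
      finally show ?thesis .
    qed
    show ?thesis
    proof (rule bigoI)
      show "eventually (\<lambda>\<phi>. norm (mode_sum \<rho> E \<phi> - (R K \<phi> + (\<Sum>n<2 * K + 3. a n * \<phi> ^ n)))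
          \<le> c * M * (\<rho>\<^sup>2) ^ K * Z * norm (\<phi> ^ (2 * K))) (at_right 0)"
        using ev_u ev_\<delta> eventually_at_right_less[of 0]
      proof eventually_elim
        case (elim \<phi>)
        thus ?case using bnd[of \<phi>] by simp
      qed
    qed
  qed
  have rat: "(\<lambda>\<phi>. rat_num e2 e4 e6 \<rho> \<phi> / (1 + \<rho>\<^sup>2 * \<phi>\<^sup>2) ^ 5 - R K \<phi>) \<in> O[at_right 0](\<lambda>\<phi>. \<phi> ^ (2 * K))" for K
  proof -
    \<comment> \<open>Truncation errors of the three generating functions. The coefficients in
      \<open>R K\<close> are at most quadratic in k, so the difference is a combination of
      these.\<close>
    define s0 where "s0 v = 1 / (1 + v) ^ 3 - (\<Sum>k<K. fps_nth F k * v ^ k)" for v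
    define s1 where "s1 v = - 3 * v / (1 + v) ^ 4 - (\<Sum>k<K. real k * fps_nth F k * v ^ k)" for v
    define s2 where "s2 v = 12 * v\<^sup>2 / (1 + v) ^ 5 - (\<Sum>k<K. real k * (real k - 1) * fps_nth F k * v ^ k)" for v
    have s: "(\<lambda>\<phi>. s0 (\<rho>\<^sup>2 * \<phi>\<^sup>2)) \<in> O[at_right 0](\<lambda>\<phi>. \<phi> ^ (2 * K))"
      "(\<lambda>\<phi>. s1 (\<rho>\<^sup>2 * \<phi>\<^sup>2)) \<in> O[at_right 0](\<lambda>\<phi>. \<phi> ^ (2 * K))"
      "(\<lambda>\<phi>. s2 (\<rho>\<^sup>2 * \<phi>\<^sup>2)) \<in> O[at_right 0](\<lambda>\<phi>. \<phi> ^ (2 * K))"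
      by (rule bigo_nhds_0_compose; unfold s0_def s1_def s2_def F_def; rule inverse_cube_expansions)+
    have 1: "(\<lambda>\<phi>. \<phi> ^ m * g \<phi>) \<in> O[at_right 0](\<lambda>\<phi>. \<phi> ^ (2 * K))"
      if "g \<in> O[at_right 0](\<lambda>\<phi>. \<phi> ^ (2 * K))" for m and g :: "real \<Rightarrow> real"
      using landau_o.big.mult[OF power_bigo_at_right_0[of 0 m] that] by simp
    have 2: "(\<lambda>\<phi>. b * g \<phi>) \<in> O[at_right 0](\<lambda>\<phi>. \<phi> ^ (2 * K))"
      if "g \<in> O[at_right 0](\<lambda>\<phi>. \<phi> ^ (2 * K))" for b and g :: "real \<Rightarrow> real"
      using that by (cases "b = 0") auto
    have "(\<lambda>\<phi>. pi ^ 4 / 90 * e2 * s0 (\<rho>\<^sup>2 * \<phi>\<^sup>2)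
       + \<phi> ^ 2 * (pi\<^sup>2 / 6 * (e4 * s0 (\<rho>\<^sup>2 * \<phi>\<^sup>2) + (- e2 / 12) * s1 (\<rho>\<^sup>2 * \<phi>\<^sup>2)))
       + \<phi> ^ 4 * ((- 1 / 2) * (e6 * s0 (\<rho>\<^sup>2 * \<phi>\<^sup>2) + (- e4 / 12) * s1 (\<rho>\<^sup>2 * \<phi>\<^sup>2)
           + e2 * (1 / 360 * s1 (\<rho>\<^sup>2 * \<phi>\<^sup>2) + 1 / 288 * s2 (\<rho>\<^sup>2 * \<phi>\<^sup>2))))) \<in> O[at_right 0](\<lambda>\<phi>. \<phi> ^ (2 * K))"
      (is "?g \<in> _")
      by (intro sum_in_bigo(1) 1 2 s)
    moreover have "?g \<phi> = rat_num e2 e4 e6 \<rho> \<phi> / (1 + \<rho>\<^sup>2 * \<phi>\<^sup>2) ^ 5 - R K \<phi>" for \<phi>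
    proof -
      define v where "v = \<rho>\<^sup>2 * \<phi>\<^sup>2"
      define S0 where "S0 = (\<Sum>k<K. fps_nth F k * v ^ k)"
      define S1 where "S1 = (\<Sum>k<K. real k * fps_nth F k * v ^ k)"
      define S2 where "S2 = (\<Sum>k<K. real k * (real k - 1) * fps_nth F k * v ^ k)"
      have "v \<ge> 0" by (simp add: v_def)
      hence v: "1 + v \<noteq> 0" by linarith
      have R: "R K \<phi> = pi ^ 4 / 90 * e2 * S0 + \<phi> ^ 2 * (pi\<^sup>2 / 6 * (e4 * S0 + (- e2 / 12) * S1))
         + \<phi> ^ 4 * ((- 1 / 2) * (e6 * S0 + (- e4 / 12) * S1 + e2 * (1 / 360 * S1 + 1 / 288 * S2)))"
        unfolding R_def S0_def S1_def S2_def sum_distrib_left sum.distrib[symmetric] u_def v_def[symmetric]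
        by (intro sum.cong refl) (simp add: h0_def h1_def field_simps)
      define A where "A = 1 / (1 + v) ^ 3"
      define B where "B = - 3 * v / (1 + v) ^ 4"
      define D where "D = 12 * v\<^sup>2 / (1 + v) ^ 5"
      \<comment> \<open>The factors -3 in B and 12 in D turn 1/12, 1/288 and 1/360 into the
        constants 1/4, 1/24 and 1/120 of \<open>rat_num\<close>.\<close>
      have "rat_num e2 e4 e6 \<rho> \<phi> / (1 + v) ^ 5 = pi ^ 4 / 90 * e2 * A
         + \<phi> ^ 2 * (pi\<^sup>2 / 6 * (e4 * A + (- e2 / 12) * B))
         + \<phi> ^ 4 * ((- 1 / 2) * (e6 * A + (- e4 / 12) * B + e2 * (1 / 360 * B + 1 / 288 * D)))"
      proof -
        define y where "y = inverse ((1 + v) ^ 5)"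
        have y: "A = (1 + v)\<^sup>2 * y" "B = - 3 * (v * (1 + v)) * y" "D = 12 * v\<^sup>2 * y"
          "rat_num e2 e4 e6 \<rho> \<phi> / (1 + v) ^ 5 = rat_num e2 e4 e6 \<rho> \<phi> * y"
        proof -
          have w: "1 / w ^ 3 = w\<^sup>2 * inverse (w ^ 5)" "b / w ^ 4 = b * w * inverse (w ^ 5)"
            if "w \<noteq> 0" for w b :: real
            using that by (simp_all add: field_simps power_numeral_reduce)
          show "A = (1 + v)\<^sup>2 * y" "B = - 3 * (v * (1 + v)) * y"
            unfolding A_def B_def y_def w[OF v] by simp_all
        qed (simp_all only: D_def y_def divide_inverse)
        show ?thesis unfolding y unfolding rat_num_def v_def[symmetric] Let_def of_real_eq_id id_apply
          by (simp add: algebra_simps power2_eq_square add_divide_distrib diff_divide_distrib)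
      qed
      thus ?thesis unfolding R unfolding v_def[symmetric] s0_def s1_def s2_def S0_def[symmetric] S1_def[symmetric] S2_def[symmetric]
          A_def[symmetric] B_def[symmetric] D_def[symmetric]
        by (simp add: algebra_simps add_divide_distrib diff_divide_distrib)
    qed
    ultimately show ?thesis by simp
  qed
  have "asym_series (\<lambda>\<phi>. mode_sum \<rho> E \<phi> - rat_num e2 e4 e6 \<rho> \<phi> / (1 + \<rho>\<^sup>2 * \<phi>\<^sup>2) ^ 5) a"
  proof (rule asym_seriesI)
    fix K
    have "(\<lambda>\<phi>. mode_sum \<rho> E \<phi> - rat_num e2 e4 e6 \<rho> \<phi> / (1 + \<rho>\<^sup>2 * \<phi>\<^sup>2) ^ 5 - (\<Sum>n<2 * K + 3. a n * \<phi> ^ n))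
        \<in> O[at_right 0](\<lambda>\<phi>. \<phi> ^ (2 * K))"
      using sum_in_bigo(2)[OF main[of K] rat[of K]] by (simp add: algebra_simps)
    thus "\<exists>M\<ge>K. \<exists>L\<ge>K. (\<lambda>\<phi>. mode_sum \<rho> E \<phi> - rat_num e2 e4 e6 \<rho> \<phi> / (1 + \<rho>\<^sup>2 * \<phi>\<^sup>2) ^ 5 - (\<Sum>n<M. a n * \<phi> ^ n))
        \<in> O[at_right 0](\<lambda>\<phi>. \<phi> ^ L)"
      by (intro exI[of _ "2 * K + 3"] conjI exI[of _ "2 * K"]) auto
  qed
  thus ?thesis by (intro exI[of _ a]) (auto simp: a_def)
qed

section \<open>Asymptotic series and analytic distillates\<close>

lemma power_int_smallo_at_0:
  assumes "G \<le> at (0 :: real)" "N < m"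
  shows "(\<lambda>\<phi>. complex_of_real \<phi> powi m) \<in> o[G](\<lambda>\<phi>. of_real \<phi> powi N)"
proof (rule smalloI_tendsto)
  define k where "k = nat (m - N)"
  have k: "m = N + int k" "k > 0" using assms(2) by (auto simp: k_def)
  have nz: "eventually (\<lambda>\<phi>::real. \<phi> \<noteq> 0) G"
    by (rule filter_leD[OF assms(1)]) (simp add: eventually_at_filter)
  show "eventually (\<lambda>\<phi>. complex_of_real \<phi> powi N \<noteq> 0) G"
    using nz by eventually_elim simp
  have "((\<lambda>\<phi>. complex_of_real \<phi> ^ k) \<longlongrightarrow> of_real 0 ^ k) (at 0)" by (intro tendsto_intros)
  hence "((\<lambda>\<phi>. complex_of_real \<phi> ^ k) \<longlongrightarrow> 0) G"
    using k(2) by (intro tendsto_mono[OF assms(1)]) (simp add: zero_power)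
  moreover have "eventually (\<lambda>\<phi>. complex_of_real \<phi> ^ k = of_real \<phi> powi m / of_real \<phi> powi N) G"
    using nz by eventually_elim (simp add: k power_int_add)
  ultimately show "((\<lambda>\<phi>. complex_of_real \<phi> powi m / of_real \<phi> powi N) \<longlongrightarrow> 0) G"
    by (rule Lim_transform_eventually)
qed

text \<open>Lowering the starting index makes series comparable that begin at different exponents.
  For N below m all terms vanish, and f is of order \<phi>^m, hence o(\<phi>^N).\<close>

lemma has_asymptotic_series_normalize:
  assumes "has_asymptotic_series f a G" "G \<le> at 0"
  shows "\<exists>m. (\<forall>n<m. a n = 0) \<and> (\<forall>m'\<le>m. \<forall>N\<ge>m'.
     (\<lambda>\<phi>. f \<phi> - (\<Sum>n=m'..N. a n * of_real \<phi> powi n)) \<in> o[G](\<lambda>\<phi>. of_real \<phi> powi N))"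
proof -
  obtain m where m: "\<And>n. n < m \<Longrightarrow> a n = 0"
    "\<And>N. N \<ge> m \<Longrightarrow> (\<lambda>\<phi>. f \<phi> - (\<Sum>n=m..N. a n * of_real \<phi> powi n)) \<in> o[G](\<lambda>\<phi>. of_real \<phi> powi N)"
    using assms(1) unfolding has_asymptotic_series_def by blast
  have "(\<lambda>\<phi>. f \<phi> - (\<Sum>n=m'..N. a n * of_real \<phi> powi n)) \<in> o[G](\<lambda>\<phi>. of_real \<phi> powi N)"
    if "m' \<le> m" "m' \<le> N" for m' N
  proof (cases "N \<ge> m")
    case True
    have "(\<Sum>n=m'..N. a n * of_real \<phi> powi n) = (\<Sum>n=m..N. a n * of_real \<phi> powi n)" for \<phi> :: real
      by (rule sum.mono_neutral_right) (use that m(1) in auto)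
    thus ?thesis using m(2)[OF True] by simp
  next
    case False
    have z: "(\<Sum>n=m'..N. a n * of_real \<phi> powi n) = 0" for \<phi> :: real
      by (rule sum.neutral) (use False m(1) in auto)
    have s: "(\<lambda>\<phi>. complex_of_real \<phi> powi m) \<in> o[G](\<lambda>\<phi>. of_real \<phi> powi N)"
      using False by (intro power_int_smallo_at_0 assms(2)) auto
    have "(\<lambda>\<phi>. f \<phi> - a m * of_real \<phi> powi m) \<in> o[G](\<lambda>\<phi>. of_real \<phi> powi m)"
      using m(2)[of m] by simp
    hence "(\<lambda>\<phi>. f \<phi> - a m * of_real \<phi> powi m) \<in> o[G](\<lambda>\<phi>. of_real \<phi> powi N)"
      using s landau_o.small_trans by blast
    moreover have "(\<lambda>\<phi>. a m * of_real \<phi> powi m) \<in> o[G](\<lambda>\<phi>. of_real \<phi> powi N)"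
      using s by (cases "a m = 0") auto
    ultimately have "(\<lambda>\<phi>. f \<phi> - a m * of_real \<phi> powi m + a m * of_real \<phi> powi m) \<in> o[G](\<lambda>\<phi>. of_real \<phi> powi N)"
      by (rule sum_in_smallo(1))
    thus ?thesis by (simp add: z)
  qed
  thus ?thesis using m(1) by blast
qed

text \<open>At the least exponent N of disagreement the partial sums differ by a non-zero multiple
  of \<phi>^N, yet the difference would have to be o(\<phi>^N).\<close>

lemma has_asymptotic_series_unique:
  assumes f: "has_asymptotic_series f a G" "has_asymptotic_series f b G" and G: "G \<le> at 0" "G \<noteq> bot"
  shows "a = b"
proof (rule ccontr)
  assume "a \<noteq> b"
  then obtain n0 where n0: "a n0 \<noteq> b n0" by blast
  obtain m1 where m1: "\<And>n. n < m1 \<Longrightarrow> a n = 0" "\<And>m' N. m' \<le> m1 \<Longrightarrow> N \<ge> m' \<Longrightarrow>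
     (\<lambda>\<phi>. f \<phi> - (\<Sum>n=m'..N. a n * of_real \<phi> powi n)) \<in> o[G](\<lambda>\<phi>. of_real \<phi> powi N)"
    using has_asymptotic_series_normalize[OF f(1) G(1)] by blast
  obtain m2 where m2: "\<And>n. n < m2 \<Longrightarrow> b n = 0" "\<And>m' N. m' \<le> m2 \<Longrightarrow> N \<ge> m' \<Longrightarrow>
     (\<lambda>\<phi>. f \<phi> - (\<Sum>n=m'..N. b n * of_real \<phi> powi n)) \<in> o[G](\<lambda>\<phi>. of_real \<phi> powi N)"
    using has_asymptotic_series_normalize[OF f(2) G(1)] by blast
  define m where "m = min m1 m2"
  have "n0 \<ge> m" using n0 m1(1)[of n0] m2(1)[of n0]
    by (cases "n0 < m1"; cases "n0 < m2") (auto simp: m_def)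
  hence ex: "a (m + int (nat (n0 - m))) \<noteq> b (m + int (nat (n0 - m)))" using n0 by simp
  \<comment> \<open>The integers are not well-ordered, so the least exponent is taken over natural
    offsets from m.\<close>
  define k where "k = (LEAST k. a (m + int k) \<noteq> b (m + int k))"
  define N where "N = m + int k"
  have N: "a N \<noteq> b N" unfolding N_def k_def by (rule LeastI) (rule ex)
  have less: "a n = b n" if "m \<le> n" "n < N" for n
    using not_less_Least[of "nat (n - m)" "\<lambda>k. a (m + int k) \<noteq> b (m + int k)"] that
    by (auto simp: N_def k_def)
  have mN: "m \<le> N" by (simp add: N_def)
  have "(\<lambda>\<phi>. (f \<phi> - (\<Sum>n=m..N. a n * of_real \<phi> powi n)) - (f \<phi> - (\<Sum>n=m..N. b n * of_real \<phi> powi n)))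
      \<in> o[G](\<lambda>\<phi>. of_real \<phi> powi N)"
    by (intro sum_in_smallo(2) m1(2) m2(2)) (auto simp: m_def N_def)
  also have "(\<lambda>\<phi>. (f \<phi> - (\<Sum>n=m..N. a n * of_real \<phi> powi n)) - (f \<phi> - (\<Sum>n=m..N. b n * of_real \<phi> powi n)))
     = (\<lambda>\<phi>. (b N - a N) * of_real \<phi> powi N)"
  proof
    fix \<phi> :: real
    have "(\<Sum>n=m..N. b n * of_real \<phi> powi n) - (\<Sum>n=m..N. a n * of_real \<phi> powi n)
        = (\<Sum>n=m..N. (b n - a n) * of_real \<phi> powi n)"
      by (simp add: sum_subtractf left_diff_distrib)
    also have "\<dots> = (\<Sum>n\<in>{N}. (b n - a n) * of_real \<phi> powi n)"
      by (rule sum.mono_neutral_right) (use mN less in force)+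
    finally show "(f \<phi> - (\<Sum>n=m..N. a n * of_real \<phi> powi n)) - (f \<phi> - (\<Sum>n=m..N. b n * of_real \<phi> powi n))
       = (b N - a N) * of_real \<phi> powi N" by simp
  qed
  finally have "(\<lambda>\<phi>. complex_of_real \<phi> powi N) \<in> o[G](\<lambda>\<phi>. of_real \<phi> powi N)"
    using N by simp
  hence "eventually (\<lambda>\<phi>. complex_of_real \<phi> powi N = 0) G" by (simp only: landau_o.small_refl_iff)
  moreover have "eventually (\<lambda>\<phi>::real. \<phi> \<noteq> 0) G"
    by (rule filter_leD[OF G(1)]) (simp add: eventually_at_filter)
  ultimately have "eventually (\<lambda>_. False) G" by eventually_elim auto
  thus False using G(2) by simp
qed

lemma has_asymptotic_series_lincomb:
  assumes f: "has_asymptotic_series f a G" "has_asymptotic_series g b G" and G: "G \<le> at 0"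
  shows "has_asymptotic_series (\<lambda>\<phi>. f \<phi> + c * g \<phi>) (\<lambda>n. a n + c * b n) G"
proof -
  obtain m1 where m1: "\<And>n. n < m1 \<Longrightarrow> a n = 0" "\<And>m' N. m' \<le> m1 \<Longrightarrow> N \<ge> m' \<Longrightarrow>
     (\<lambda>\<phi>. f \<phi> - (\<Sum>n=m'..N. a n * of_real \<phi> powi n)) \<in> o[G](\<lambda>\<phi>. of_real \<phi> powi N)"
    using has_asymptotic_series_normalize[OF f(1) G(1)] by blast
  obtain m2 where m2: "\<And>n. n < m2 \<Longrightarrow> b n = 0" "\<And>m' N. m' \<le> m2 \<Longrightarrow> N \<ge> m' \<Longrightarrow>
     (\<lambda>\<phi>. g \<phi> - (\<Sum>n=m'..N. b n * of_real \<phi> powi n)) \<in> o[G](\<lambda>\<phi>. of_real \<phi> powi N)"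
    using has_asymptotic_series_normalize[OF f(2) G(1)] by blast
  define m where "m = min m1 m2"
  have "(\<lambda>\<phi>. f \<phi> + c * g \<phi> - (\<Sum>n=m..N. (a n + c * b n) * of_real \<phi> powi n)) \<in> o[G](\<lambda>\<phi>. of_real \<phi> powi N)"
    if "N \<ge> m" for N
  proof -
    have "(\<lambda>\<phi>. g \<phi> - (\<Sum>n=m..N. b n * of_real \<phi> powi n)) \<in> o[G](\<lambda>\<phi>. of_real \<phi> powi N)"
      using that by (intro m2(2)) (auto simp: m_def)
    hence "(\<lambda>\<phi>. c * (g \<phi> - (\<Sum>n=m..N. b n * of_real \<phi> powi n))) \<in> o[G](\<lambda>\<phi>. of_real \<phi> powi N)"
      by (cases "c = 0") auto
    moreover have "(\<lambda>\<phi>. f \<phi> - (\<Sum>n=m..N. a n * of_real \<phi> powi n)) \<in> o[G](\<lambda>\<phi>. of_real \<phi> powi N)"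
      using that by (intro m1(2)) (auto simp: m_def)
    ultimately have "(\<lambda>\<phi>. (f \<phi> - (\<Sum>n=m..N. a n * of_real \<phi> powi n)) + c * (g \<phi> - (\<Sum>n=m..N. b n * of_real \<phi> powi n)))
       \<in> o[G](\<lambda>\<phi>. of_real \<phi> powi N)" by (intro sum_in_smallo(1))
    thus ?thesis by (simp add: algebra_simps sum.distrib sum_distrib_left)
  qed
  moreover have "a n + c * b n = 0" if "n < m" for n using that m1(1) m2(1) by (simp add: m_def)
  ultimately show ?thesis unfolding has_asymptotic_series_def by blast
qed

lemma has_asymptotic_series_cmult:
  assumes "has_asymptotic_series f a G" "G \<le> at 0"
  shows "has_asymptotic_series (\<lambda>\<phi>. c * f \<phi>) (\<lambda>n. c * a n) G"
proof -
  have "x + (c - 1) * x = c * x" for x by (simp add: algebra_simps)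
  thus ?thesis using has_asymptotic_series_lincomb[OF assms(1,1,2), of "c - 1"] by simp
qed

lemma has_asymptotic_series_cong:
  assumes "eventually (\<lambda>\<phi>. f \<phi> = g \<phi>) G"
  shows "has_asymptotic_series f a G \<longleftrightarrow> has_asymptotic_series g a G"
proof -
  have "(\<lambda>\<phi>. f \<phi> - s \<phi>) \<in> o[G](h) \<longleftrightarrow> (\<lambda>\<phi>. g \<phi> - s \<phi>) \<in> o[G](h)" for s h
    by (rule landau_o.small.in_cong) (use assms in \<open>auto elim: eventually_mono\<close>)
  thus ?thesis unfolding has_asymptotic_series_def by simp
qed

lemma has_asymptotic_series_natI:
  assumes "G \<le> at 0"
    and "\<And>N. (\<lambda>\<phi>. f \<phi> - (\<Sum>n<N. a n * of_real \<phi> ^ n)) \<in> O[G](\<lambda>\<phi>. of_real \<phi> ^ N)"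
  shows "has_asymptotic_series f (\<lambda>n. if n < 0 then 0 else a (nat n)) G"
proof -
  have "(\<lambda>\<phi>. f \<phi> - (\<Sum>n=0..N. (if n < 0 then 0 else a (nat n)) * of_real \<phi> powi n)) \<in> o[G](\<lambda>\<phi>. of_real \<phi> powi N)"
    if "N \<ge> 0" for N
  proof -
    define k where "k = nat N"
    have k: "N = int k" using that by (simp add: k_def)
    have "(\<Sum>n=0..N. (if n < 0 then 0 else a (nat n)) * of_real \<phi> powi n) = (\<Sum>n<Suc k. a n * of_real \<phi> ^ n)"
      for \<phi> :: real
      by (rule sum.reindex_bij_witness[of _ int nat]) (auto simp: k power_int_def)
    hence "(\<lambda>\<phi>. f \<phi> - (\<Sum>n=0..N. (if n < 0 then 0 else a (nat n)) * of_real \<phi> powi n)) \<in> O[G](\<lambda>\<phi>. of_real \<phi> ^ Suc k)"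
      using assms(2)[of "Suc k"] by simp
    moreover have "(\<lambda>\<phi>. complex_of_real \<phi> ^ Suc k) \<in> o[G](\<lambda>\<phi>. of_real \<phi> powi N)"
      using power_int_smallo_at_0[OF assms(1), of N "int (Suc k)"] unfolding k power_int_of_nat by simp
    ultimately show ?thesis by (rule landau_o.big_small_trans)
  qed
  thus ?thesis unfolding has_asymptotic_series_def by (intro exI[of _ 0]) auto
qed

lemma has_asymptotic_series_fps:
  assumes "g has_fps_expansion P" "G \<le> at (0 :: real)"
  shows "has_asymptotic_series (\<lambda>\<phi>. g (of_real \<phi>)) (\<lambda>n. if n < 0 then 0 else fps_nth P (nat n)) G"
proof (rule has_asymptotic_series_natI[OF assms(2)])
  fix N
  have "((\<lambda>\<phi>. complex_of_real \<phi>) \<longlongrightarrow> of_real 0) (at 0)" by (intro tendsto_intros)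
  hence "filterlim (\<lambda>\<phi>. complex_of_real \<phi>) (nhds 0) G"
    using tendsto_mono[OF assms(2)] by simp
  from landau_o.big.compose[OF has_fps_expansion_bigo[OF assms(1)] this]
  show "(\<lambda>\<phi>. g (complex_of_real \<phi>) - (\<Sum>n<N. fps_nth P n * of_real \<phi> ^ n)) \<in> O[G](\<lambda>\<phi>. of_real \<phi> ^ N)" .
qed

lemma has_asymptotic_series_of_real:
  assumes "asym_series h a"
  shows "has_asymptotic_series (\<lambda>\<phi>. of_real (h \<phi>)) (\<lambda>n. if n < 0 then 0 else of_real (a (nat n))) (at_right 0)"
proof (rule has_asymptotic_series_natI)
  show "at_right 0 \<le> at (0 :: real)" by (rule at_le) simp
  fix N
  have "(\<lambda>\<phi>. h \<phi> - (\<Sum>n<N. a n * \<phi> ^ n)) \<in> O[at_right 0](\<lambda>\<phi>. \<phi> ^ N)"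
    using assms by (simp add: asym_series_def)
  hence "(\<lambda>\<phi>. complex_of_real (h \<phi> - (\<Sum>n<N. a n * \<phi> ^ n))) \<in> O[at_right 0](\<lambda>\<phi>. of_real (\<phi> ^ N))"
    by (elim landau_o.bigE) (auto intro!: bigoI simp del: of_real_diff of_real_sum of_real_power)
  thus "(\<lambda>\<phi>. complex_of_real (h \<phi>) - (\<Sum>n<N. of_real (a n) * of_real \<phi> ^ n)) \<in> O[at_right 0](\<lambda>\<phi>. of_real \<phi> ^ N)"
    by simp
qed

lemma has_asymptotic_series_reflect:
  assumes "has_asymptotic_series f a (at_right 0)"
  shows "has_asymptotic_series (\<lambda>\<phi>. f (- \<phi>)) (\<lambda>n. (-1) powi n * a n) (at_left 0)"
proof -
  obtain m where m: "\<And>n. n < m \<Longrightarrow> a n = 0"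
    "\<And>N. N \<ge> m \<Longrightarrow> (\<lambda>\<phi>. f \<phi> - (\<Sum>n=m..N. a n * of_real \<phi> powi n)) \<in> o[at_right 0](\<lambda>\<phi>. of_real \<phi> powi N)"
    using assms unfolding has_asymptotic_series_def by blast
  have filt: "filterlim uminus (at_right 0) (at_left (0 :: real))"
    by (simp add: filterlim_def at_left_minus[of 0] filtermap_filtermap)
  have "(\<lambda>\<phi>. f (- \<phi>) - (\<Sum>n=m..N. ((-1) powi n * a n) * of_real \<phi> powi n)) \<in> o[at_left 0](\<lambda>\<phi>. of_real \<phi> powi N)"
    if "N \<ge> m" for N
  proof -
    have e: "complex_of_real (- \<phi>) powi n = (-1) powi n * of_real \<phi> powi n" for \<phi> n
      using power_int_mult_distrib[of "-1" "complex_of_real \<phi>" n] by simp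
    have "(\<lambda>\<phi>. f (- \<phi>) - (\<Sum>n=m..N. a n * of_real (- \<phi>) powi n)) \<in> o[at_left 0](\<lambda>\<phi>. of_real (- \<phi>) powi N)"
      using landau_o.small.compose[OF m(2)[OF that] filt] .
    also have "(\<lambda>\<phi>. complex_of_real (- \<phi>) powi N) = (\<lambda>\<phi>. (-1) powi N * of_real \<phi> powi N)"
      by (simp only: e)
    finally show ?thesis unfolding e by (simp add: mult_ac)
  qed
  thus ?thesis using m(1) unfolding has_asymptotic_series_def by (intro exI[of _ m]) auto
qed

lemma analytic_distillate_unique:
  assumes "is_analytic_distillate f F" "is_analytic_distillate f F'"
  shows "F = F'"
proof -
  have le: "at_right 0 \<le> at (0 :: real)" "at_left 0 \<le> at (0 :: real)" by (auto intro: at_le)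
  obtain ap am where 1: "has_asymptotic_series f ap (at_right 0)" "has_asymptotic_series f am (at_left 0)"
    "F = Abs_fps (\<lambda>n. if ap (int n) = am (int n) then ap (int n) else 0)"
    using assms(1) unfolding is_analytic_distillate_def by blast
  obtain ap' am' where 2: "has_asymptotic_series f ap' (at_right 0)" "has_asymptotic_series f am' (at_left 0)"
    "F' = Abs_fps (\<lambda>n. if ap' (int n) = am' (int n) then ap' (int n) else 0)"
    using assms(2) unfolding is_analytic_distillate_def by blast
  have "ap = ap'" using has_asymptotic_series_unique[OF 1(1) 2(1) le(1)] by simp
  moreover have "am = am'" using has_asymptotic_series_unique[OF 1(2) 2(2) le(2)] by simp
  ultimately show ?thesis unfolding 1(3) 2(3) by hypsubst (rule refl)
qed

text \<open>The domain U of a continuation may leave the ball and contain zeros of q. The identity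
  theorem is therefore applied to h q and p, which are holomorphic on all of U, and q is divided out
  only at z.\<close>

lemma continues_to_quotient_iff:
  fixes p q :: "complex \<Rightarrow> complex"
  assumes holo: "p holomorphic_on UNIV" "q holomorphic_on UNIV"
    and q: "\<And>s. s \<in> ball 0 R \<Longrightarrow> q s \<noteq> 0" and z: "z \<in> ball 0 R"
    and P: "(\<lambda>s. p s / q s) has_fps_expansion P"
  shows "continues_to P z v \<longleftrightarrow> v = p z / q z"
proof
  have R: "R > 0" using z by (smt (verit) mem_ball norm_ge_zero dist_0_norm)
  have ev: "eventually (\<lambda>s. eval_fps P s = p s / q s) (nhds 0)"
    using P by (simp add: has_fps_expansion_def)
  assume "v = p z / q z"
  thus "continues_to P z v"
    unfolding continues_to_def using q z ev R
    by (intro exI[of _ "ball 0 R"] exI[of _ "\<lambda>s. p s / q s"])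
       (auto intro!: holomorphic_intros holomorphic_on_subset[OF holo(1)] holomorphic_on_subset[OF holo(2)]
         elim: eventually_mono)
next
  have R: "R > 0" using z by (smt (verit) mem_ball norm_ge_zero dist_0_norm)
  have ev: "eventually (\<lambda>s. eval_fps P s = p s / q s) (nhds 0)"
    using P by (simp add: has_fps_expansion_def)
  have ev_ball: "eventually (\<lambda>s :: complex. s \<in> ball 0 R) (nhds 0)"
    using R by (intro eventually_nhds_in_open) auto
  assume "continues_to P z v"
  then obtain U h where U: "open U" "connected U" "0 \<in> U" "z \<in> U" "h holomorphic_on U"
    "eventually (\<lambda>s. h s = eval_fps P s) (nhds 0)" "h z = v"
    unfolding continues_to_def by blast
  have "eventually (\<lambda>s. s \<in> U) (nhds 0)" using U by (intro eventually_nhds_in_open) auto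
  with U(6) ev ev_ball have "eventually (\<lambda>s. s \<in> U \<and> h s * q s = p s) (nhds 0)"
    by eventually_elim (use q in auto)
  then obtain S where S: "open S" "0 \<in> S" "\<And>s. s \<in> S \<Longrightarrow> s \<in> U \<and> h s * q s = p s"
    by (auto simp: eventually_nhds)
  have "h z * q z = p z"
  proof (rule analytic_continuation_open[of S U "\<lambda>s. h s * q s" p])
    show "(\<lambda>s. h s * q s) holomorphic_on U"
      by (intro holomorphic_intros U holomorphic_on_subset[OF holo(2)]) auto
    show "p holomorphic_on U" by (rule holomorphic_on_subset[OF holo(1)]) auto
  qed (use S U in auto)
  thus "v = p z / q z" using U(7) q[OF z] by (simp add: field_simps)
qed

text \<open>By parity, the coefficients on the two half-axes agree exactly for the exponents occurring
  in the Taylor series of \<open>p / q\<close>, so distilling removes the remaining part.\<close>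
lemma distilled_value_quotient:
  fixes p q :: "complex \<Rightarrow> complex" and F g :: "real \<Rightarrow> real"
  assumes f: "\<And>\<phi>. \<phi> \<noteq> 0 \<Longrightarrow> f \<phi> = \<kappa> * of_real (F \<phi>)"
    and \<sigma>: "\<sigma> = 1 \<or> \<sigma> = -1" and parity: "\<And>\<phi>. \<phi> \<noteq> 0 \<Longrightarrow> F (- \<phi>) = \<sigma> * F \<phi>"
    and series: "asym_series (\<lambda>\<phi>. F \<phi> - g \<phi>) a" and a: "\<And>n. \<sigma> * (-1) ^ n = 1 \<Longrightarrow> a n = 0"
    and holo: "p holomorphic_on UNIV" "q holomorphic_on UNIV"
    and q: "\<And>s. s \<in> ball 0 R \<Longrightarrow> q s \<noteq> 0" and z: "z \<in> ball 0 R"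
    and pq: "\<And>\<phi>. \<kappa> * of_real (g \<phi>) = p (of_real \<phi>) / q (of_real \<phi>)"
    and pq_parity: "\<And>s. p (- s) / q (- s) = of_real \<sigma> * (p s / q s)"
  shows "distilled_value f z v \<longleftrightarrow> v = p z / q z"
proof -
  have le: "at_right 0 \<le> at (0 :: real)" "at_left 0 \<le> at (0 :: real)" by (auto intro: at_le)
  have R: "R > 0" using z by (smt (verit) mem_ball norm_ge_zero dist_0_norm)
  have "(\<lambda>s. p s / q s) holomorphic_on ball 0 R"
    using q by (intro holomorphic_intros holomorphic_on_subset[OF holo(1)] holomorphic_on_subset[OF holo(2)]) auto
  hence "(\<lambda>s. p s / q s) analytic_on {0}"
    using R by (intro analytic_at[THEN iffD2]) (auto intro!: exI[of _ "ball 0 R"])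
  then obtain P where P: "(\<lambda>s. p s / q s) has_fps_expansion P"
    using analytic_at_imp_has_fps_expansion_0 by blast
  define b where "b n = (if n < 0 then 0 else fps_nth P (nat n))" for n :: int
  define c where "c n = (if n < 0 then 0 else complex_of_real (a (nat n)))" for n :: int
  have bp: "has_asymptotic_series (\<lambda>\<phi>. p (of_real \<phi>) / q (of_real \<phi>)) b G" if "G \<le> at (0::real)" for G
    unfolding b_def by (rule has_asymptotic_series_fps[OF P that])
  \<comment> \<open>Uniqueness applied to p / q and to its signed reflection forces the coefficients
    of the wrong parity to vanish.\<close>
  have b_parity: "b n = of_real \<sigma> * (-1) powi n * b n" for n
  proof -
    have "has_asymptotic_series (\<lambda>\<phi>. p (of_real (- \<phi>)) / q (of_real (- \<phi>))) (\<lambda>n. (-1) powi n * b n) (at_left 0)"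
      by (rule has_asymptotic_series_reflect[OF bp[OF le(1)]])
    from has_asymptotic_series_cmult[OF this le(2), of "of_real \<sigma>"]
    have "has_asymptotic_series (\<lambda>\<phi>. of_real \<sigma> * (p (of_real (- \<phi>)) / q (of_real (- \<phi>))))
        (\<lambda>n. of_real \<sigma> * ((-1) powi n * b n)) (at_left 0)" .
    moreover have "of_real \<sigma> * (p (of_real (- \<phi>)) / q (of_real (- \<phi>))) = p (of_real \<phi>) / q (of_real \<phi>)" for \<phi>
      unfolding of_real_minus pq_parity using \<sigma> by auto
    ultimately have "has_asymptotic_series (\<lambda>\<phi>. p (of_real \<phi>) / q (of_real \<phi>))
        (\<lambda>n. of_real \<sigma> * ((-1) powi n * b n)) (at_left 0)" by simp
    from fun_cong[OF has_asymptotic_series_unique[OF bp[OF le(2)] this le(2)], of n] show ?thesis by (simp add: mult_ac)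
  qed
  define ap where "ap n = b n + \<kappa> * c n" for n
  have fp: "has_asymptotic_series f ap (at_right 0)"
  proof -
    have "has_asymptotic_series (\<lambda>\<phi>. p (of_real \<phi>) / q (of_real \<phi>) + \<kappa> * of_real (F \<phi> - g \<phi>)) ap (at_right 0)"
      unfolding ap_def c_def
      by (intro has_asymptotic_series_lincomb bp has_asymptotic_series_of_real series le)
    moreover have "eventually (\<lambda>\<phi>. f \<phi> = p (of_real \<phi>) / q (of_real \<phi>) + \<kappa> * of_real (F \<phi> - g \<phi>)) (at_right 0)"
      using eventually_at_right_less[of 0]
      by eventually_elim (simp add: f flip: pq, simp add: algebra_simps)
    ultimately show ?thesis by (rule has_asymptotic_series_cong[THEN iffD2, rotated])
  qed
  define am where "am n = of_real \<sigma> * ((-1) powi n * ap n)" for n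
  have fm: "has_asymptotic_series f am (at_left 0)"
  proof -
    have r: "has_asymptotic_series (\<lambda>\<phi>. f (- \<phi>)) (\<lambda>n. (-1) powi n * ap n) (at_left 0)"
      by (rule has_asymptotic_series_reflect[OF fp])
    from has_asymptotic_series_cmult[OF r le(2), of "of_real \<sigma>"]
    have "has_asymptotic_series (\<lambda>\<phi>. of_real \<sigma> * f (- \<phi>)) am (at_left 0)"
      unfolding am_def[abs_def] .
    moreover have "eventually (\<lambda>\<phi>::real. \<phi> < 0) (at_left 0)"
      by (simp add: eventually_at_filter)
    hence "eventually (\<lambda>\<phi>. f \<phi> = of_real \<sigma> * f (- \<phi>)) (at_left 0)"
      by eventually_elim (use \<sigma> in \<open>auto simp: f parity\<close>)
    ultimately show ?thesis by (rule has_asymptotic_series_cong[THEN iffD2, rotated])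
  qed
  have coeff: "(if ap (int n) = am (int n) then ap (int n) else 0) = fps_nth P n" for n
  proof (cases "\<sigma> * (-1) ^ n = 1")
    case True
    hence "complex_of_real (\<sigma> * (-1) ^ n) = 1" by simp
    hence "of_real \<sigma> * (-1) ^ n = (1 :: complex)" by simp
    hence "am (int n) = ap (int n)" by (simp add: am_def mult.assoc[symmetric])
    thus ?thesis using a[OF True] by (simp add: ap_def b_def c_def)
  next
    case False
    hence "\<sigma> * (-1) ^ n = -1" using \<sigma> by (cases "even n") auto
    hence "complex_of_real (\<sigma> * (-1) ^ n) = -1" by simp
    hence s: "of_real \<sigma> * (-1) ^ n = (-1 :: complex)" by simp
    have "fps_nth P n = 0" using b_parity[of "int n"] s by (simp add: b_def)
    \<comment> \<open>If \<open>ap\<close> and \<open>am\<close> agree here, both are 0, so either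
      branch of the distillate gives 0.\<close>
    moreover have "am (int n) = - ap (int n)" using s by (simp add: am_def mult.assoc[symmetric])
    ultimately show ?thesis by auto
  qed
  have "is_analytic_distillate f P"
    unfolding is_analytic_distillate_def
    using fp fm P by (intro exI[of _ ap] exI[of _ am]) (auto simp: coeff has_fps_expansion_def fps_eq_iff)
  hence "distilled_value f z v \<longleftrightarrow> continues_to P z v"
    unfolding distilled_value_def using analytic_distillate_unique by blast
  also have "\<dots> \<longleftrightarrow> v = p z / q z" by (rule continues_to_quotient_iff[OF holo q z P])
  finally show ?thesis .
qed

section \<open>Logarithms in the odd mode sums\<close>

lemma one_minus_inverse_cube_le:
  assumes "u \<ge> (0 :: real)"
  shows "\<bar>1 / (1 + u) ^ 3 - 1\<bar> \<le> 3 * u"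
proof -
  define w where "w = 1 / (1 + u)"
  have w: "0 < w" "w \<le> 1" "1 - w \<le> u" using assms by (simp_all add: w_def field_simps)
  have "1 + real 3 * (w - 1) \<le> (1 + (w - 1)) ^ 3" using w by (intro Bernoulli_inequality) simp
  hence "1 - w ^ 3 \<le> 3 * u" using w by simp
  moreover have "w ^ 3 \<le> 1" using w by (simp add: power_le_one)
  ultimately have "\<bar>w ^ 3 - 1\<bar> \<le> 3 * u" by simp
  thus ?thesis by (simp add: w_def power_divide)
qed

text \<open>At \<phi> = 1 / M the part b / t^3, summed over all n, gives z M^3, and the part b' / t,
  summed over t \<le> 1, gives b' M times a harmonic number. Everything else adds up to O(M), and
  division by M leaves a bounded error.\<close>

lemma mode_sum_log_asymptotics:
  assumes bound: "\<And>t. \<bar>Q t\<bar> \<le> c * \<bar>t\<bar> ^ 3"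
    and exp: "\<And>t. 0 < t \<Longrightarrow> t \<le> 1 \<Longrightarrow> \<bar>Q t - b * t ^ 3 - b' * t ^ 5\<bar> \<le> c * t ^ 7"
  obtains C z where "\<And>M. M \<ge> 1 \<Longrightarrow>
     \<bar>real M ^ 3 * mode_sum \<rho> Q (1 / real M) - (z * real M ^ 2 + b' * harm M)\<bar> \<le> C"
proof -
  define z where "z = b * (\<Sum>n. 1 / real (Suc n) ^ 3)"
  define Z where "Z = (\<Sum>n. 1 / real (Suc n) ^ 2)"
  \<comment> \<open>Three errors: replacing (1 + u)^(-3) by 1, the Taylor remainders of the M terms
    with t \<le> 1, and the tail t > 1.\<close>
  define C where "C = 3 * c * \<rho>\<^sup>2 * Z + c + (c + \<bar>b\<bar>)"
  have c: "c \<ge> 0" using bound[of 1] by auto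
  show thesis
  proof (rule that[of z C])
    fix M :: nat assume M: "M \<ge> 1"
    define \<phi> where "\<phi> = 1 / real M"
    have \<phi>: "\<phi> > 0" using M by (simp add: \<phi>_def)
    define t where "t n = real (Suc n) * \<phi>" for n
    have t: "t n > 0" for n using \<phi> by (simp add: t_def)
    define u where "u n = \<rho>\<^sup>2 * \<phi>\<^sup>2 * sinc_sq (t n)" for n
    have u: "u n \<ge> 0" "u n \<le> \<rho>\<^sup>2 * \<phi>\<^sup>2" for n
      using sinc_sq_bounds[of "t n"] by (auto simp: u_def intro: mult_left_le)
    define H where "H n = Q (t n) / t n ^ 6 * (1 / (1 + u n) ^ 3)" for n
    have H_sums: "(\<lambda>n. \<phi> ^ 4 * H n) sums mode_sum \<rho> Q \<phi>"
    proof -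
      have "(\<lambda>n. \<phi> ^ 4 * H n) = (\<lambda>n. mode_term \<rho> Q \<phi> n)"
        using \<phi> by (intro ext, subst mode_term_eq) (auto simp only: H_def t_def u_def)
      moreover have "summable (\<lambda>n. mode_term \<rho> Q \<phi> n)"
        by (rule mode_sum_summable[of \<phi> Q c 3]) (use \<phi> bound in auto)
      ultimately show ?thesis using summable_sums by (simp only: mode_sum_def)
    qed
    from sums_mult[OF this, of "1 / \<phi> ^ 4"] have h1: "H sums (real M ^ 4 * mode_sum \<rho> Q \<phi>)"
      using \<phi> by (simp add: \<phi>_def power_divide)
    have h2: "(\<lambda>n. b * (1 / t n ^ 3)) sums (z * real M ^ 3)"
    proof -
      have "(\<lambda>n. b * real M ^ 3 * (1 / real (Suc n) ^ 3)) sums (b * real M ^ 3 * (\<Sum>n. 1 / real (Suc n) ^ 3))"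
        by (intro sums_mult summable_sums summable_inverse_Suc_power) simp
      thus ?thesis by (simp add: t_def \<phi>_def z_def power_divide mult_ac)
    qed
    have h3: "(\<lambda>n. if n \<in> {..<M} then b' / t n else 0) sums (\<Sum>n<M. b' / t n)"
      by (rule sums_If_finite_set) simp
    have "(\<Sum>n<M. b' / t n) = b' * real M * harm M"
      by (simp add: harm_def sum.atLeast1_atMost_eq sum_distrib_left t_def \<phi>_def field_simps)
    with sums_diff[OF sums_diff[OF h1 h2] h3] have d_sums: "(\<lambda>n. H n - b * (1 / t n ^ 3) - (if n \<in> {..<M} then b' / t n else 0)) sums
        (real M ^ 4 * mode_sum \<rho> Q \<phi> - z * real M ^ 3 - b' * real M * harm M)"
      by simp
    \<comment> \<open>A telescoping majorant of 1 / (n + 1)^2 for n \<ge> M, with sum 1 / M.\<close>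
    define e where "e n = (if n \<ge> M then 1 / real n - 1 / real (Suc n) else 0)" for n
    have e_sums: "e sums (1 / real M)"
    proof -
      have "(\<lambda>n. 1 / real (n + M)) \<longlonglongrightarrow> 0"
        by (rule LIMSEQ_ignore_initial_segment[OF lim_1_over_n])
      from telescope_sums'[OF this] have "(\<lambda>n. e (n + M)) sums (1 / real M)"
        by (simp add: e_def)
      thus ?thesis unfolding sums_iff_shift by (simp add: e_def)
    qed
    define g where "g n = 3 * c * \<rho>\<^sup>2 * real M * (1 / real (Suc n) ^ 2)
       + (if n \<in> {..<M} then c else 0) + (c + \<bar>b\<bar>) * real M ^ 2 * e n" for n
    have "g sums (3 * c * \<rho>\<^sup>2 * real M * Z + (\<Sum>n<M. c) + (c + \<bar>b\<bar>) * real M ^ 2 * (1 / real M))"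
      unfolding g_def[abs_def] Z_def
      by (intro sums_add sums_mult summable_sums summable_inverse_Suc_power sums_If_finite_set e_sums) auto
    also have "3 * c * \<rho>\<^sup>2 * real M * Z + (\<Sum>n<M. c) + (c + \<bar>b\<bar>) * real M ^ 2 * (1 / real M) = C * real M"
      using M by (simp add: C_def power2_eq_square algebra_simps)
    finally have g_sums: "g sums (C * real M)" .
    have "norm (H n - b * (1 / t n ^ 3) - (if n \<in> {..<M} then b' / t n else 0)) \<le> g n" for n
    proof -
      have tM: "1 / t n = real M / real (Suc n)" by (simp add: t_def \<phi>_def)
      have "\<bar>H n - Q (t n) / t n ^ 6\<bar> = \<bar>Q (t n)\<bar> / t n ^ 6 * \<bar>1 / (1 + u n) ^ 3 - 1\<bar>"
      proof -
        have "H n - Q (t n) / t n ^ 6 = Q (t n) / t n ^ 6 * (1 / (1 + u n) ^ 3 - 1)"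
          by (simp only: H_def right_diff_distrib mult_1_right)
        thus ?thesis using t[of n] by (simp only: abs_mult abs_divide power_abs abs_of_pos)
      qed
      also have "\<dots> \<le> (c * t n ^ 3) / t n ^ 6 * (3 * (\<rho>\<^sup>2 * \<phi>\<^sup>2))"
        using bound[of "t n"] one_minus_inverse_cube_le[OF u(1)[of n]] u(2)[of n] t[of n] c
        by (intro mult_mono divide_right_mono) auto
      also have "\<dots> = 3 * c * \<rho>\<^sup>2 * (\<phi>\<^sup>2 * (1 / t n) ^ 3)"
        using t[of n] by (simp add: power_numeral_reduce)
      also have "\<phi>\<^sup>2 * (1 / t n) ^ 3 = real M * (1 / real (Suc n) ^ 3)"
        unfolding tM using M by (simp add: \<phi>_def power_divide power_numeral_reduce)
      also have "3 * c * \<rho>\<^sup>2 * (real M * (1 / real (Suc n) ^ 3)) \<le> 3 * c * \<rho>\<^sup>2 * (real M * (1 / real (Suc n) ^ 2))"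
        using c by (intro mult_left_mono divide_left_mono power_increasing) auto
      finally have 1: "\<bar>H n - Q (t n) / t n ^ 6\<bar> \<le> 3 * c * \<rho>\<^sup>2 * real M * (1 / real (Suc n) ^ 2)"
        by (simp only: mult.assoc)
      show ?thesis
      proof (cases "n < M")
        case True
        have t1: "t n \<le> 1" using True M by (simp add: t_def \<phi>_def)
        have "\<bar>Q (t n) / t n ^ 6 - b * (1 / t n ^ 3) - b' / t n\<bar> = \<bar>Q (t n) - b * t n ^ 3 - b' * t n ^ 5\<bar> / t n ^ 6"
        proof -
          have "Q (t n) / t n ^ 6 - b * (1 / t n ^ 3) - b' / t n = (Q (t n) - b * t n ^ 3 - b' * t n ^ 5) / t n ^ 6"
            using t[of n] by (simp add: diff_divide_distrib power_numeral_reduce)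
          thus ?thesis using t[of n] by simp
        qed
        also have "\<dots> \<le> c * t n ^ 7 / t n ^ 6"
          using exp[OF t[of n] t1] t[of n] by (intro divide_right_mono) auto
        also have "\<dots> = c * t n" using t[of n] by (simp add: power_numeral_reduce)
        also have "\<dots> \<le> c" using t1 c by (simp add: mult_left_le)
        finally show ?thesis using 1 True by (simp add: g_def e_def)
      next
        case False
        have "\<bar>Q (t n) / t n ^ 6 - b * (1 / t n ^ 3)\<bar> \<le> \<bar>Q (t n)\<bar> / t n ^ 6 + \<bar>b\<bar> / t n ^ 3"
          using t[of n] by (intro order_trans[OF abs_triangle_ineq4]) (simp add: abs_mult)
        also have "\<dots> \<le> c * t n ^ 3 / t n ^ 6 + \<bar>b\<bar> / t n ^ 3"
          using bound[of "t n"] t[of n] by (intro add_right_mono divide_right_mono) auto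
        also have "\<dots> = (c + \<bar>b\<bar>) * (1 / t n) ^ 3"
          using t[of n] by (simp add: power_numeral_reduce distrib_right add_divide_distrib)
        also have "\<dots> \<le> (c + \<bar>b\<bar>) * (real M ^ 2 * e n)"
        proof (intro mult_left_mono)
          have Mn: "real M \<le> real n" "0 < real n" using False M by auto
          have "(1 / t n) ^ 3 = real M ^ 2 * (real M / real (Suc n) ^ 3)"
            unfolding tM by (simp add: power_divide power_numeral_reduce)
          also have "real M / real (Suc n) ^ 3 \<le> real (Suc n) / real (Suc n) ^ 3"
            using Mn by (intro divide_right_mono) auto
          also have "\<dots> = 1 / (real (Suc n) * real (Suc n))" by (simp add: power_numeral_reduce)
          also have "\<dots> \<le> 1 / (real n * real (Suc n))"
            using Mn by (intro divide_left_mono mult_right_mono) auto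
          also have "\<dots> = e n" using False Mn by (simp add: e_def field_simps)
          finally show "(1 / t n) ^ 3 \<le> real M ^ 2 * e n" by (simp add: mult_left_mono)
        qed (use c in auto)
        finally have "\<bar>Q (t n) / t n ^ 6 - b * (1 / t n ^ 3)\<bar> \<le> (c + \<bar>b\<bar>) * real M ^ 2 * e n"
          by (simp only: mult.assoc)
        thus ?thesis using 1 False by (simp add: g_def)
      qed
    qed
    from norm_sums_le[OF d_sums g_sums this]
    have "\<bar>real M ^ 4 * mode_sum \<rho> Q \<phi> - z * real M ^ 3 - b' * real M * harm M\<bar> \<le> C * real M" by simp
    also have "real M ^ 4 * mode_sum \<rho> Q \<phi> - z * real M ^ 3 - b' * real M * harm M
        = real M * (real M ^ 3 * mode_sum \<rho> Q \<phi> - (z * real M ^ 2 + b' * harm M))"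
      by (simp add: algebra_simps power_numeral_reduce)
    finally show "\<bar>real M ^ 3 * mode_sum \<rho> Q (1 / real M) - (z * real M ^ 2 + b' * harm M)\<bar> \<le> C"
      using M by (simp add: abs_mult \<phi>_def)
  qed
qed

text \<open>Harmonic numbers grow sublinearly, so p would be constant; but they are also
  unbounded.\<close>

lemma poly_not_close_to_harm:
  fixes p :: "complex poly"
  assumes "\<beta> \<noteq> 0" and close: "\<And>n. n \<ge> n0 \<Longrightarrow> norm (poly p (of_nat n) - \<beta> * of_real (harm n)) \<le> C"
  shows False
proof (cases p)
  case (pCons a q)
  have lim: "(\<lambda>n. ((norm a + C) + norm \<beta> * harm n) / real n) \<longlonglongrightarrow> 0"
  proof -
    have 1: "(\<lambda>n. harm n / real n :: real) \<longlonglongrightarrow> 0"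
    proof (rule tendsto_sandwich)
      show "eventually (\<lambda>n. 0 \<le> harm n / real n) sequentially"
        by (intro always_eventually allI divide_nonneg_nonneg harm_nonneg) auto
      have "harm n / real n \<le> (1 + ln (real n)) / real n" if "n > 0" for n
        using euler_mascheroni_sequence_decreasing[of 1 n] that
        by (intro divide_right_mono) (auto simp: harm_expand)
      thus "eventually (\<lambda>n. harm n / real n \<le> (1 + ln (real n)) / real n) sequentially"
        by (intro eventually_sequentiallyI[of 1]) auto
      show "(\<lambda>n. (1 + ln (real n)) / real n) \<longlonglongrightarrow> 0"
        unfolding add_divide_distrib using tendsto_add[OF lim_1_over_n lim_ln_over_n] by simp
    qed auto
    have "(\<lambda>n. (norm a + C) * (1 / real n) + norm \<beta> * (harm n / real n)) \<longlonglongrightarrow> (norm a + C) * 0 + norm \<beta> * 0"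
      by (intro tendsto_intros lim_1_over_n 1)
    thus ?thesis by (simp add: add_divide_distrib)
  qed
  have "(\<lambda>n. poly q (of_nat n)) \<longlonglongrightarrow> 0"
  proof (rule Lim_null_comparison[OF _ lim])
    show "eventually (\<lambda>n. norm (poly q (of_nat n)) \<le> ((norm a + C) + norm \<beta> * harm n) / real n) sequentially"
    proof (rule eventually_sequentiallyI[of "max 1 n0"])
      fix n assume n: "max 1 n0 \<le> n"
      have eq: "of_nat n * poly q (of_nat n) = (poly p (of_nat n) - \<beta> * of_real (harm n)) + \<beta> * of_real (harm n) - a"
        by (simp add: pCons)
      have "norm (of_nat n * poly q (of_nat n)) \<le> (C + norm (\<beta> * of_real (harm n))) + norm a"
      proof -
        have "norm (x + y - a) \<le> norm x + norm y + norm a" for x y :: complex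
          using norm_triangle_ineq4[of "x + y" a] norm_triangle_ineq[of x y] by linarith
        moreover have "norm (poly p (of_nat n) - \<beta> * of_real (harm n)) \<le> C" using close n by simp
        ultimately show ?thesis
          unfolding eq by (smt (verit))
      qed
      hence "real n * norm (poly q (of_nat n)) \<le> norm a + C + norm \<beta> * harm n"
        by (simp add: norm_mult harm_nonneg add_ac)
      thus "norm (poly q (of_nat n)) \<le> ((norm a + C) + norm \<beta> * harm n) / real n"
        using n by (simp add: field_simps)
    qed
  qed
  hence q: "q = 0" by (rule poly_of_nat_tendsto_0_imp_0)
  have *: "harm n \<le> (norm a + C) / norm \<beta>" if "n \<ge> n0" for n
  proof -
    have "norm (\<beta> * of_real (harm n)) \<le> norm (a - (a - \<beta> * of_real (harm n)))" by simp
    also have "\<dots> \<le> norm a + norm (a - \<beta> * of_real (harm n))" by (rule norm_triangle_ineq4)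
    also have "\<dots> \<le> norm a + C" using close[OF that] by (simp add: pCons q)
    finally show ?thesis using assms(1) by (simp add: norm_mult harm_nonneg field_simps)
  qed
  have "eventually (\<lambda>n. harm n > (norm a + C) / norm \<beta>) sequentially"
    using harm_at_top by (simp add: filterlim_at_top_dense)
  then obtain n1 where "\<And>n. n \<ge> n1 \<Longrightarrow> harm n > (norm a + C) / norm \<beta>"
    by (auto simp: eventually_sequentially)
  from this[of "max n0 n1"] show False using * [of "max n0 n1"] by simp
qed

text \<open>A truncated series at \<phi> = 1 / M, multiplied by M^(k + 3), becomes a polynomial in M
  and stays within 1 of the same multiple of f. That multiple is \<kappa> (z M^2 + b' harm M) up to
  a bounded error, which no polynomial can follow.\<close>

lemma no_asymptotic_series_log:
  assumes \<kappa>: "\<kappa> \<noteq> 0" and f: "\<And>\<phi>. \<phi> > 0 \<Longrightarrow> f \<phi> = \<kappa> * of_real (\<phi> ^ k * mode_sum \<rho> Q \<phi>)"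
    and bound: "\<And>t. \<bar>Q t\<bar> \<le> c * \<bar>t\<bar> ^ 3"
    and exp: "\<And>t. 0 < t \<Longrightarrow> t \<le> 1 \<Longrightarrow> \<bar>Q t - b * t ^ 3 - b' * t ^ 5\<bar> \<le> c * t ^ 7" and b': "b' \<noteq> 0"
  shows "\<not> has_asymptotic_series f a (at_right 0)"
proof
  assume "has_asymptotic_series f a (at_right 0)"
  from has_asymptotic_series_normalize[OF this at_le] obtain m where
    m: "\<And>m' N. m' \<le> m \<Longrightarrow> N \<ge> m' \<Longrightarrow>
     (\<lambda>\<phi>. f \<phi> - (\<Sum>n=m'..N. a n * of_real \<phi> powi n)) \<in> o[at_right 0](\<lambda>\<phi>. of_real \<phi> powi N)"
    by auto
  \<comment> \<open>The starting index might exceed N; lowering it to at most 0 rules this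
    out.\<close>
  define m' where "m' = min m 0"
  \<comment> \<open>M^k undoes the factor \<phi>^k, and M^3 is the normalisation of
    \<open>mode_sum_log_asymptotics\<close>; with this top exponent no negative power of M
    remains.\<close>
  define N where "N = int (k + 3)"
  have "(\<lambda>\<phi>. f \<phi> - (\<Sum>n=m'..N. a n * of_real \<phi> powi n)) \<in> o[at_right 0](\<lambda>\<phi>. of_real \<phi> powi N)"
    by (rule m) (auto simp: m'_def N_def)
  from landau_o.smallD[OF this, of 1]
  have "eventually (\<lambda>\<phi>. norm (f \<phi> - (\<Sum>n=m'..N. a n * of_real \<phi> powi n)) \<le> \<bar>\<phi>\<bar> ^ (k + 3)) (at_right 0)"
    by (simp add: N_def norm_power_int power_int_of_nat norm_power del: of_nat_add)
  then obtain d where d: "d > 0" "\<And>\<phi>. 0 < \<phi> \<Longrightarrow> \<phi> < d \<Longrightarrow>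
      norm (f \<phi> - (\<Sum>n=m'..N. a n * of_real \<phi> powi n)) \<le> \<phi> ^ (k + 3)"
    unfolding eventually_at_right_field by (auto simp: abs_of_pos)
  obtain n0 where n0: "n0 > 0" "inverse (real n0) < d" using ex_inverse_of_nat_less[OF d(1)] by blast
  obtain C z where Cz: "\<And>M. M \<ge> 1 \<Longrightarrow>
     \<bar>real M ^ 3 * mode_sum \<rho> Q (1 / real M) - (z * real M ^ 2 + b' * harm M)\<bar> \<le> C"
    using mode_sum_log_asymptotics[OF bound exp] by blast
  define p where "p = (\<Sum>n=m'..N. monom (a n) (nat (N - n))) - monom (\<kappa> * of_real z) 2"
  have "norm (poly p (of_nat M) - (\<kappa> * of_real b') * of_real (harm M)) \<le> 1 + norm \<kappa> * C" if M: "M \<ge> n0" for M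
  proof -
    have M0: "M \<ge> 1" using M n0 by simp
    define \<phi> where "\<phi> = 1 / real M"
    have \<phi>: "0 < \<phi>" "\<phi> < d"
    proof -
      show "0 < \<phi>" using M0 by (simp add: \<phi>_def)
      have "\<phi> \<le> inverse (real n0)" using M n0(1) by (simp add: \<phi>_def inverse_eq_divide frac_le)
      thus "\<phi> < d" using n0(2) by simp
    qed
    define S where "S = (\<Sum>n=m'..N. a n * of_real \<phi> powi n)"
    have Mnz: "(of_nat M :: complex) \<noteq> 0" using M0 by simp
    have "(\<Sum>n=m'..N. a n * of_nat M ^ nat (N - n)) = of_nat M ^ (k + 3) * S"
      unfolding S_def sum_distrib_left
    proof (intro sum.cong refl)
      fix n assume "n \<in> {m'..N}"
      hence "(of_nat M :: complex) ^ nat (N - n) = of_nat M powi (N - n)"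
        by (simp add: power_int_def)
      also have "\<dots> = of_nat M ^ (k + 3) / of_nat M powi n"
        using Mnz by (simp add: power_int_diff N_def power_int_of_nat del: of_nat_add)
      finally show "a n * of_nat M ^ nat (N - n) = of_nat M ^ (k + 3) * (a n * of_real \<phi> powi n)"
        by (simp add: \<phi>_def power_int_divide_distrib)
    qed
    hence poly_p: "poly p (of_nat M) = of_nat M ^ (k + 3) * S - \<kappa> * of_real z * of_nat M ^ 2"
      by (simp add: p_def poly_sum poly_monom)
    have "of_nat M ^ (k + 3) * f \<phi> = \<kappa> * of_real (real M ^ 3 * mode_sum \<rho> Q (1 / real M))"
      unfolding f[OF \<phi>(1)] using M0 by (simp add: \<phi>_def power_divide power_add)
    hence "poly p (of_nat M) - (\<kappa> * of_real b') * of_real (harm M)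
       = of_nat M ^ (k + 3) * (S - f \<phi>)
         + \<kappa> * of_real (real M ^ 3 * mode_sum \<rho> Q (1 / real M) - (z * real M ^ 2 + b' * harm M))"
      unfolding poly_p by (simp add: algebra_simps)
    also have "norm \<dots> \<le> real M ^ (k + 3) * norm (S - f \<phi>)
         + norm \<kappa> * \<bar>real M ^ 3 * mode_sum \<rho> Q (1 / real M) - (z * real M ^ 2 + b' * harm M)\<bar>"
      by (rule order_trans[OF norm_triangle_ineq]) (simp only: norm_mult norm_power norm_of_nat norm_of_real)
    also have "\<dots> \<le> real M ^ (k + 3) * \<phi> ^ (k + 3) + norm \<kappa> * C"
      using d(2)[OF \<phi>] Cz[OF M0] by (intro add_mono mult_left_mono) (auto simp: S_def norm_minus_commute)
    also have "real M ^ (k + 3) * \<phi> ^ (k + 3) = 1"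
      using M0 by (simp add: \<phi>_def power_mult_distrib[symmetric] del: power_add)
    finally show ?thesis .
  qed
  from poly_not_close_to_harm[OF _ this] show False using \<kappa> b' by simp
qed

section \<open>Distilled components\<close>

lemma expands_cong:
  assumes "\<And>t. 0 < t \<Longrightarrow> f t = g t"
  shows "expands f a b c \<longleftrightarrow> expands g a b c"
  unfolding expands_def
  by (intro filterlim_cong refl eventually_at_right_less[THEN eventually_mono]) (use assms in auto)

lemma expands_add:
  assumes "expands f a b c" "expands g a' b' c'"
  shows "expands (\<lambda>t. f t + g t) (a + a') (b + b') (c + c')"
proof -
  have "(f t + g t - (a + a' + (b + b') * t\<^sup>2 + (c + c') * t ^ 4)) / t ^ 4
      = (f t - (a + b * t\<^sup>2 + c * t ^ 4)) / t ^ 4 + (g t - (a' + b' * t\<^sup>2 + c' * t ^ 4)) / t ^ 4" for t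
    unfolding add_divide_distrib[symmetric] by (simp add: algebra_simps)
  thus ?thesis using tendsto_add[OF assms[unfolded expands_def]] by (simp add: expands_def)
qed

lemma expands_cmult:
  assumes "expands f a b c"
  shows "expands (\<lambda>t. d * f t) (d * a) (d * b) (d * c)"
proof -
  have eq: "(d * f t - (d * a + d * b * t\<^sup>2 + d * c * t ^ 4)) / t ^ 4
      = d * ((f t - (a + b * t\<^sup>2 + c * t ^ 4)) / t ^ 4)" for t
    by (simp add: algebra_simps)
  show ?thesis unfolding expands_def eq using tendsto_mult_left[OF assms[unfolded expands_def], of d] by simp
qed

lemma expands_const: "expands (\<lambda>_. a) a 0 0"
  by (simp add: expands_def)

lemma expands_double:
  assumes "expands f a b c"
  shows "expands (\<lambda>t. f (2 * t)) a (4 * b) (16 * c)"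
proof -
  have "filterlim (\<lambda>t::real. 2 * t) (at_right 0) (at_right 0)"
    unfolding filterlim_at by (auto intro!: tendsto_eq_intros eventually_at_right_less[THEN eventually_mono])
  from filterlim_compose[OF assms[unfolded expands_def] this]
  have lim: "((\<lambda>t. 16 * ((f (2 * t) - (a + b * (2 * t)\<^sup>2 + c * (2 * t) ^ 4)) / (2 * t) ^ 4)) \<longlongrightarrow> 16 * 0) (at_right 0)"
    by (intro tendsto_mult_left)
  have eq: "16 * ((f (2 * t) - (a + b * (2 * t)\<^sup>2 + c * (2 * t) ^ 4)) / (2 * t) ^ 4)
      = (f (2 * t) - (a + 4 * b * t\<^sup>2 + 16 * c * t ^ 4)) / t ^ 4" for t
  proof -
    have "(2 * t) ^ 4 = 16 * t ^ 4" "a + b * (2 * t)\<^sup>2 + c * (16 * t ^ 4) = a + 4 * b * t\<^sup>2 + 16 * c * t ^ 4"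
      by (simp_all add: power_mult_distrib)
    moreover have "16 * (X / (16 * t ^ 4)) = X / t ^ 4" for X by simp
    ultimately show ?thesis by (simp only:)
  qed
  show ?thesis using lim unfolding expands_def eq by simp
qed

lemma expands_cos: "expands cos 1 (- 1 / 2) (1 / 24)"
proof (rule expandsI[where C = 1])
  fix t :: real assume t: "0 < t" "t < 1"
  have "{..2::nat} = {0, 1, 2}" by auto
  moreover have "fact 4 = (24 :: real)" by (simp add: fact_numeral)
  ultimately show "\<bar>cos t - (1 + - 1 / 2 * t\<^sup>2 + 1 / 24 * t ^ 4)\<bar> \<le> 1 * t ^ 5"
    using cos_remainder[of t 2] t by (simp add: algebra_simps power2_eq_square)
qed

lemma expands_sin_over: "expands (\<lambda>t. sin t / t) 1 (- 1 / 6) (1 / 120)"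
proof (rule expandsI[where C = 1])
  fix t :: real assume t: "0 < t" "t < 1"
  have "{..2::nat} = {0, 1, 2}" by auto
  moreover have "fact 3 = (6 :: real)" "fact 4 = (24 :: real)" "fact 5 = (120 :: real)"
    by (simp_all add: fact_numeral)
  ultimately have "\<bar>sin t - (t - t ^ 3 / 6 + t ^ 5 / 120)\<bar> \<le> t ^ 6"
    using sin_remainder[of t 2] t by (simp add: algebra_simps power_numeral_reduce)
  hence "\<bar>sin t - (t - t ^ 3 / 6 + t ^ 5 / 120)\<bar> / t \<le> t ^ 6 / t"
    using t by (intro divide_right_mono) auto
  also have "t ^ 6 / t = t ^ 5" using t by (simp add: power_numeral_reduce)
  also have "\<bar>sin t - (t - t ^ 3 / 6 + t ^ 5 / 120)\<bar> / t = \<bar>(sin t - (t - t ^ 3 / 6 + t ^ 5 / 120)) / t\<bar>"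
    using t by simp
  also have "(sin t - (t - t ^ 3 / 6 + t ^ 5 / 120)) / t = sin t / t - (1 + - 1 / 6 * t\<^sup>2 + 1 / 120 * t ^ 4)"
    using t by (simp add: field_simps power_numeral_reduce)
  finally show "\<bar>sin t / t - (1 + - 1 / 6 * t\<^sup>2 + 1 / 120 * t ^ 4)\<bar> \<le> 1 * t ^ 5" by simp
qed

text \<open>All surviving parts of \<open>Theta\<close> fit this pattern. Constants are absorbed
  into 1 - cos because the numerators vanish to second order at t = 0.\<close>

definition even_numer :: "real \<Rightarrow> real \<Rightarrow> real \<Rightarrow> real \<Rightarrow> real \<Rightarrow> real \<Rightarrow> real" where
  "even_numer a0 a1 b1 b2 s t =
     a0 * t\<^sup>2 + a1 * (t\<^sup>2 * cos t) + b1 * (1 - cos t) + b2 * (1 - cos (2 * t)) + s * (t * sin t)"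

text \<open>The Taylor coefficients of \<open>even_numer\<close> at t^2, t^4 and t^6; the names
  count powers before the division by t^2.\<close>

definition coeff2 :: "real \<Rightarrow> real \<Rightarrow> real \<Rightarrow> real \<Rightarrow> real \<Rightarrow> real" where
  "coeff2 a0 a1 b1 b2 s = a0 + a1 + b1 / 2 + 2 * b2 + s"
definition coeff4 :: "real \<Rightarrow> real \<Rightarrow> real \<Rightarrow> real \<Rightarrow> real \<Rightarrow> real" where
  "coeff4 a0 a1 b1 b2 s = - a1 / 2 - b1 / 24 - 2 * b2 / 3 - s / 6"
definition coeff6 :: "real \<Rightarrow> real \<Rightarrow> real \<Rightarrow> real \<Rightarrow> real \<Rightarrow> real" where
  "coeff6 a0 a1 b1 b2 s = a1 / 24 + b1 / 720 + 4 * b2 / 45 + s / 120"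

lemma even_numer_expands:
  "expands (\<lambda>t. even_numer a0 a1 b1 b2 s t / t\<^sup>2)
     (coeff2 a0 a1 b1 b2 s) (coeff4 a0 a1 b1 b2 s) (coeff6 a0 a1 b1 b2 s)"
proof -
  \<comment> \<open>(1 - cos t) / t^2 is half of \<open>sinc_sq t\<close>, and (1 - cos (2 t)) / t^2
    is twice \<open>sinc_sq (2 * t)\<close>.\<close>
  have "expands (\<lambda>t. a0 + a1 * cos t + b1 / 2 * sinc_sq t + 2 * b2 * sinc_sq (2 * t) + s * (sin t / t))
     (a0 + a1 * 1 + b1 / 2 * 1 + 2 * b2 * 1 + s * 1)
     (0 + a1 * (- 1 / 2) + b1 / 2 * (- 1 / 12) + 2 * b2 * (4 * (- 1 / 12)) + s * (- 1 / 6))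
     (0 + a1 * (1 / 24) + b1 / 2 * (1 / 360) + 2 * b2 * (16 * (1 / 360)) + s * (1 / 120))"
    by (intro expands_add expands_cmult expands_const expands_cos expands_sinc_sq
          expands_double[OF expands_sinc_sq] expands_sin_over)
  also have "a0 + a1 * 1 + b1 / 2 * 1 + 2 * b2 * 1 + s * 1 = coeff2 a0 a1 b1 b2 s"
    by (simp add: coeff2_def)
  also have "0 + a1 * (- 1 / 2) + b1 / 2 * (- 1 / 12) + 2 * b2 * (4 * (- 1 / 12)) + s * (- 1 / 6) = coeff4 a0 a1 b1 b2 s"
    by (simp add: coeff4_def)
  also have "0 + a1 * (1 / 24) + b1 / 2 * (1 / 360) + 2 * b2 * (16 * (1 / 360)) + s * (1 / 120) = coeff6 a0 a1 b1 b2 s"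
    by (simp add: coeff6_def)
  also have "expands (\<lambda>t. a0 + a1 * cos t + b1 / 2 * sinc_sq t + 2 * b2 * sinc_sq (2 * t) + s * (sin t / t))
     (coeff2 a0 a1 b1 b2 s) (coeff4 a0 a1 b1 b2 s) (coeff6 a0 a1 b1 b2 s) \<longleftrightarrow> ?thesis"
    by (rule expands_cong) (simp add: even_numer_def sinc_sq_def field_simps power2_eq_square)
  finally show ?thesis .
qed

lemma even_numer_trig_laurent: "trig_laurent (\<lambda>t. even_numer a0 a1 b1 b2 s t / t ^ 6)"
proof -
  have eq: "(\<lambda>t. even_numer a0 a1 b1 b2 s t / t ^ 6) = (\<lambda>t. a0 * (cos (0 * t) / t ^ (2 * 2)) + (a1 * (cos (1 * t) / t ^ (2 * 2))
     + (b1 * (cos (0 * t) / t ^ (2 * 3)) + ((- b1) * (cos (1 * t) / t ^ (2 * 3)) + (b2 * (cos (0 * t) / t ^ (2 * 3))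
     + ((- b2) * (cos (2 * t) / t ^ (2 * 3)) + s * (sin (1 * t) / t ^ (2 * 2 + 1))))))))"
  proof
    fix t :: real
    show "even_numer a0 a1 b1 b2 s t / t ^ 6 = a0 * (cos (0 * t) / t ^ (2 * 2)) + (a1 * (cos (1 * t) / t ^ (2 * 2))
     + (b1 * (cos (0 * t) / t ^ (2 * 3)) + ((- b1) * (cos (1 * t) / t ^ (2 * 3)) + (b2 * (cos (0 * t) / t ^ (2 * 3))
     + ((- b2) * (cos (2 * t) / t ^ (2 * 3)) + s * (sin (1 * t) / t ^ (2 * 2 + 1)))))))"
      by (cases "t = 0") (simp_all add: even_numer_def field_simps power_numeral_reduce)
  qed
  show ?thesis unfolding eq
    by (intro trig_laurent.add trig_laurent.cmult trig_laurent.cos trig_laurent.sin) auto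
qed

lemma one_minus_cos_le: "1 - cos t \<le> (t :: real)\<^sup>2 / 2"
  using sinc_sq_bounds(2)[of t] by (cases "t = 0") (auto simp: sinc_sq_def divide_le_eq)

lemma even_numer_bound:
  "\<bar>even_numer a0 a1 b1 b2 s t\<bar> \<le> (\<bar>a0\<bar> + \<bar>a1\<bar> + \<bar>b1\<bar> + 2 * \<bar>b2\<bar> + \<bar>s\<bar>) * t\<^sup>2"
proof -
  have "\<bar>t\<^sup>2 * cos t\<bar> \<le> t\<^sup>2" using mult_left_mono[OF abs_cos_le_one[of t], of "t\<^sup>2"] by (simp add: abs_mult)
  hence 1: "\<bar>a1 * (t\<^sup>2 * cos t)\<bar> \<le> \<bar>a1\<bar> * t\<^sup>2" unfolding abs_mult[of a1] by (intro mult_left_mono) auto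
  have "\<bar>1 - cos t\<bar> \<le> t\<^sup>2" using one_minus_cos_le[of t] cos_le_one[of t] zero_le_power2[of t] by linarith
  hence 2: "\<bar>b1 * (1 - cos t)\<bar> \<le> \<bar>b1\<bar> * t\<^sup>2" unfolding abs_mult[of b1] by (intro mult_left_mono) auto
  have "\<bar>1 - cos (2 * t)\<bar> \<le> 2 * t\<^sup>2"
    using one_minus_cos_le[of "2 * t"] cos_le_one[of "2 * t"] by (simp add: power_mult_distrib)
  hence 3: "\<bar>b2 * (1 - cos (2 * t))\<bar> \<le> \<bar>b2\<bar> * (2 * t\<^sup>2)" unfolding abs_mult[of b2] by (intro mult_left_mono) auto
  have "\<bar>t * sin t\<bar> \<le> t\<^sup>2"
    unfolding abs_mult using mult_left_mono[OF abs_sin_x_le_abs_x[of t], of "\<bar>t\<bar>"] by (simp add: power2_eq_square)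
  hence 4: "\<bar>s * (t * sin t)\<bar> \<le> \<bar>s\<bar> * t\<^sup>2" unfolding abs_mult[of s] by (intro mult_left_mono) auto
  have "\<bar>a0 * t\<^sup>2\<bar> = \<bar>a0\<bar> * t\<^sup>2" by (simp add: abs_mult)
  with 1 2 3 4 show ?thesis unfolding even_numer_def distrib_right
    by (intro order_trans[OF abs_triangle_ineq] add_mono) (simp_all add: mult_ac)
qed

lemma even_numer_minus: "even_numer a0 a1 b1 b2 s (- t) = even_numer a0 a1 b1 b2 s t"
  by (simp add: even_numer_def)

lemma mode_sum_minus:
  assumes "\<And>t. E (- t) = \<sigma> * E t" "\<And>t. \<bar>E t\<bar> \<le> c * \<bar>t\<bar> ^ p" "p \<le> 4" "\<phi> \<noteq> 0"
  shows "mode_sum \<rho> E (- \<phi>) = \<sigma> * mode_sum \<rho> E \<phi>"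
proof -
  have "mode_sum \<rho> E (- \<phi>) = (\<Sum>n. \<sigma> * (mode_term \<rho> E \<phi> n))"
    unfolding mode_sum_def by (simp add: assms(1) mult_ac)
  also have "\<dots> = \<sigma> * mode_sum \<rho> E \<phi>"
    unfolding mode_sum_def by (rule suminf_mult) (rule mode_sum_summable[OF assms(4,2,3)])
  finally show ?thesis .
qed

text \<open>\<open>\<Gamma> = 1 / (1 + u)\<close> at \<open>s = \<i> \<tau>\<close>, \<open>\<tau> = \<omega> / T\<^sub>0\<close>: the square of the Lorentz factor.\<close>
definition rat_val :: "real \<Rightarrow> real \<Rightarrow> real \<Rightarrow> real \<Rightarrow> real \<Rightarrow> real" where
  "rat_val e2 e4 e6 \<tau> \<Gamma> = pi ^ 4 / 90 * e2 * \<Gamma> ^ 3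
     - pi\<^sup>2 / 6 * \<tau>\<^sup>2 * (e4 * \<Gamma> ^ 3 + e2 / 4 * (\<Gamma> ^ 3 - \<Gamma> ^ 4))
     - \<tau> ^ 4 / 2 * (e6 * \<Gamma> ^ 3 + e4 / 4 * (\<Gamma> ^ 3 - \<Gamma> ^ 4)
         + e2 * ((\<Gamma> ^ 3 - 2 * \<Gamma> ^ 4 + \<Gamma> ^ 5) / 24 - (\<Gamma> ^ 3 - \<Gamma> ^ 4) / 120))"

text \<open>At s = i \<tau> one has u = - \<rho>^2 \<tau>^2, so 1 + u = 1 / \<Gamma>, and only even
  powers of s occur, which are real.\<close>

lemma rat_num_imaginary:
  assumes "\<Gamma> * (1 - \<rho>\<^sup>2 * \<tau>\<^sup>2) = 1"
  shows "rat_num e2 e4 e6 \<rho> (\<i> * of_real \<tau>) / (1 + of_real (\<rho>\<^sup>2) * (\<i> * of_real \<tau>)\<^sup>2) ^ 5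
    = of_real (rat_val e2 e4 e6 \<tau> \<Gamma>)"
proof -
  define h where "h = 1 - \<rho>\<^sup>2 * \<tau>\<^sup>2"
  have h0: "h \<noteq> 0" using assms by (auto simp: h_def)
  have h: "\<Gamma> = 1 / h" "h \<noteq> 0" using h0 assms by (simp_all add: nonzero_eq_divide_eq h_def)
  have z2: "(\<i> * complex_of_real \<tau>)\<^sup>2 = of_real (- \<tau>\<^sup>2)" by (simp add: power_mult_distrib)
  have z4: "(\<i> * complex_of_real \<tau>) ^ 4 = of_real (\<tau> ^ 4)" by (simp add: power_mult_distrib)
  have u: "complex_of_real (\<rho>\<^sup>2) * (\<i> * of_real \<tau>)\<^sup>2 = of_real (h - 1)"
    unfolding z2 by (simp add: h_def)
  have one: "1 + complex_of_real (h - 1) = of_real h" by simp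
  have num: "rat_num e2 e4 e6 \<rho> (\<i> * complex_of_real \<tau>) = of_real (pi ^ 4 / 90 * e2 * h\<^sup>2
     - pi\<^sup>2 / 6 * \<tau>\<^sup>2 * (e4 * h\<^sup>2 + e2 / 4 * ((h - 1) * h))
     - \<tau> ^ 4 / 2 * (e6 * h\<^sup>2 + e4 / 4 * ((h - 1) * h) + e2 * ((h - 1)\<^sup>2 / 24 - (h - 1) * h / 120)))"
    unfolding rat_num_def Let_def u unfolding one z2 z4 by (simp add: field_simps)
  have val: "(pi ^ 4 / 90 * e2 * h\<^sup>2
     - pi\<^sup>2 / 6 * \<tau>\<^sup>2 * (e4 * h\<^sup>2 + e2 / 4 * ((h - 1) * h))
     - \<tau> ^ 4 / 2 * (e6 * h\<^sup>2 + e4 / 4 * ((h - 1) * h) + e2 * ((h - 1)\<^sup>2 / 24 - (h - 1) * h / 120))) / h ^ 5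
     = rat_val e2 e4 e6 \<tau> \<Gamma>"
  proof -
    have p: "h\<^sup>2 * \<Gamma> ^ 5 = \<Gamma> ^ 3" "(h - 1) * h * \<Gamma> ^ 5 = \<Gamma> ^ 3 - \<Gamma> ^ 4"
      "(h - 1)\<^sup>2 * \<Gamma> ^ 5 = \<Gamma> ^ 3 - 2 * \<Gamma> ^ 4 + \<Gamma> ^ 5"
      using h(2) unfolding h(1) by (simp_all add: field_simps power_numeral_reduce)
    have lin: "(pi ^ 4 / 90 * e2 * A - pi\<^sup>2 / 6 * \<tau>\<^sup>2 * (e4 * A + e2 / 4 * B)
     - \<tau> ^ 4 / 2 * (e6 * A + e4 / 4 * B + e2 * (D / 24 - B / 120))) * g
     = pi ^ 4 / 90 * e2 * (A * g) - pi\<^sup>2 / 6 * \<tau>\<^sup>2 * (e4 * (A * g) + e2 / 4 * (B * g))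
     - \<tau> ^ 4 / 2 * (e6 * (A * g) + e4 / 4 * (B * g) + e2 * ((D * g) / 24 - (B * g) / 120))" for A B D g
      by (simp add: algebra_simps)
    have "rat_val e2 e4 e6 \<tau> \<Gamma> = (pi ^ 4 / 90 * e2 * h\<^sup>2
     - pi\<^sup>2 / 6 * \<tau>\<^sup>2 * (e4 * h\<^sup>2 + e2 / 4 * ((h - 1) * h))
     - \<tau> ^ 4 / 2 * (e6 * h\<^sup>2 + e4 / 4 * ((h - 1) * h) + e2 * ((h - 1)\<^sup>2 / 24 - (h - 1) * h / 120))) * \<Gamma> ^ 5"
      unfolding lin p rat_val_def ..
    thus ?thesis by (simp add: h(1) power_divide)
  qed
  show ?thesis
    unfolding u one num of_real_power[symmetric] of_real_divide[symmetric] val ..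
qed

definition mode_val :: "real \<Rightarrow> real \<Rightarrow> real \<Rightarrow> real \<Rightarrow> real \<Rightarrow> real \<Rightarrow> real \<Rightarrow> real" where
  "mode_val a0 a1 b1 b2 s \<tau> \<Gamma> = rat_val (coeff2 a0 a1 b1 b2 s) (coeff4 a0 a1 b1 b2 s) (coeff6 a0 a1 b1 b2 s) \<tau> \<Gamma>"

text \<open>The first part of \<open>Theta\<close> survives when the real part is taken on the imaginary axis; the second
  one is the complementary part, whose expansion contains a logarithm.\<close>
lemma component_distilled:
  fixes T0 \<xi> x y \<omega> :: real and \<mu> \<nu> :: idx
  assumes pos: "T0 > 0" "\<omega> > 0" "cyl_radius x y * \<omega> < 1"
    and Theta: "\<And>\<phi> n. Theta T0 \<xi> x y \<phi> n \<mu> \<nu> =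
       K * of_real (\<phi> ^ j * (even_numer a0 a1 b1 b2 s (real n * \<phi>)
          + \<phi>\<^sup>2 * even_numer a0' a1' b1' b2' s' (real n * \<phi>)))
       + K' * of_real (\<phi> ^ k * Q (real n * \<phi>))"
    and K: "cnj K = (-1) ^ j * K" "cnj K' = (-1) ^ k * K'"
    and Q_odd: "\<And>t. Q (- t) = - Q t" and Q_bound: "\<And>t. \<bar>Q t\<bar> \<le> c * \<bar>t\<bar> ^ 3"
    and Q_exp: "\<And>t. 0 < t \<Longrightarrow> t \<le> 1 \<Longrightarrow> \<bar>Q t - b * t ^ 3 - b' * t ^ 5\<bar> \<le> c * t ^ 7" "b' \<noteq> 0"
    and \<tau>: "\<tau> = \<omega> / T0" and \<Gamma>: "\<Gamma> * (1 - (cyl_radius x y)\<^sup>2 * \<omega>\<^sup>2) = 1"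
    and val: "T0 ^ 4 / pi\<^sup>2 * (Re (K * (\<i> * of_real \<tau>) ^ j) *
       (mode_val a0 a1 b1 b2 s \<tau> \<Gamma>
        - \<tau>\<^sup>2 * mode_val a0' a1' b1' b2' s' \<tau> \<Gamma>)) = d"
  defines "f \<equiv> T_I T0 \<xi> x y \<mu> \<nu>" and "z \<equiv> \<i> * of_real (\<omega> / T0)"
  shows "(\<forall>v. distilled_value f z v \<longrightarrow> Re v = d) \<and>
     (\<exists>v. distilled_value (imag_axis_real_part f) z v) \<and>
     (\<forall>v. distilled_value (imag_axis_real_part f) z v \<longrightarrow> Re v = d)"
proof -
  define \<rho> where "\<rho> = cyl_radius x y * T0"
  define E where "E = even_numer a0 a1 b1 b2 s"
  define E' where "E' = even_numer a0' a1' b1' b2' s'"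
  define F where "F \<phi> = \<phi> ^ j * (mode_sum \<rho> E \<phi> + \<phi>\<^sup>2 * mode_sum \<rho> E' \<phi>)" for \<phi>
  define \<kappa> where "\<kappa> = of_real (T0 ^ 4 / pi\<^sup>2) * K"
  define \<kappa>' where "\<kappa>' = of_real (T0 ^ 4 / pi\<^sup>2) * K'"
  define mt where "mt N \<phi> n = mode_term \<rho> N \<phi> n" for N :: "real \<Rightarrow> real" and \<phi> n
  have E_bound: "\<And>t. \<bar>E t\<bar> \<le> (\<bar>a0\<bar> + \<bar>a1\<bar> + \<bar>b1\<bar> + 2 * \<bar>b2\<bar> + \<bar>s\<bar>) * t\<^sup>2"
    unfolding E_def by (rule even_numer_bound)
  have E'_bound: "\<And>t. \<bar>E' t\<bar> \<le> (\<bar>a0'\<bar> + \<bar>a1'\<bar> + \<bar>b1'\<bar> + 2 * \<bar>b2'\<bar> + \<bar>s'\<bar>) * t\<^sup>2"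
    unfolding E'_def by (rule even_numer_bound)
  have E_bound2: "\<And>t. \<bar>E t\<bar> \<le> (\<bar>a0\<bar> + \<bar>a1\<bar> + \<bar>b1\<bar> + 2 * \<bar>b2\<bar> + \<bar>s\<bar>) * \<bar>t\<bar> ^ 2"
    and E'_bound2: "\<And>t. \<bar>E' t\<bar> \<le> (\<bar>a0'\<bar> + \<bar>a1'\<bar> + \<bar>b1'\<bar> + 2 * \<bar>b2'\<bar> + \<bar>s'\<bar>) * \<bar>t\<bar> ^ 2"
    using E_bound E'_bound by simp_all
  have f_eq: "f \<phi> = \<kappa> * of_real (F \<phi>) + \<kappa>' * of_real (\<phi> ^ k * mode_sum \<rho> Q \<phi>)" if \<phi>: "\<phi> \<noteq> 0" for \<phi>
  proof -
    have sE: "mt E \<phi> sums mode_sum \<rho> E \<phi>"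
      unfolding mt_def mode_sum_def by (rule summable_sums, rule mode_sum_summable[OF \<phi> E_bound2]) simp
    have sE': "mt E' \<phi> sums mode_sum \<rho> E' \<phi>"
      unfolding mt_def mode_sum_def by (rule summable_sums, rule mode_sum_summable[OF \<phi> E'_bound2]) simp
    have sQ: "mt Q \<phi> sums mode_sum \<rho> Q \<phi>"
      unfolding mt_def mode_sum_def by (rule summable_sums, rule mode_sum_summable[OF \<phi> Q_bound]) simp
    have "(\<lambda>n. \<kappa> * of_real (\<phi> ^ j * (mt E \<phi> n + \<phi>\<^sup>2 * mt E' \<phi> n)) + \<kappa>' * of_real (\<phi> ^ k * mt Q \<phi> n)) sums
        (\<kappa> * of_real (F \<phi>) + \<kappa>' * of_real (\<phi> ^ k * mode_sum \<rho> Q \<phi>))"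
      unfolding F_def by (intro sums_add sums_mult sums_of_real sE sE' sQ)
    moreover have "\<kappa> * of_real (\<phi> ^ j * (mt E \<phi> n + \<phi>\<^sup>2 * mt E' \<phi> n)) + \<kappa>' * of_real (\<phi> ^ k * mt Q \<phi> n)
        = T_I_term T0 \<xi> x y \<mu> \<nu> \<phi> (Suc n)" for n
    proof -
      define X where "X = \<phi> ^ 4 / ((real (Suc n))\<^sup>2 * \<phi>\<^sup>2 + 4 * (sin (real (Suc n) * \<phi> / 2))\<^sup>2 * \<rho>\<^sup>2 * \<phi>\<^sup>2) ^ 3"
      have X: "mt N \<phi> n = X * N (real (Suc n) * \<phi>)" for N by (simp add: mt_def X_def)
      have "T_I_term T0 \<xi> x y \<mu> \<nu> \<phi> (Suc n) = of_real (T0 ^ 4 / pi\<^sup>2 * X) * Theta T0 \<xi> x y \<phi> (Suc n) \<mu> \<nu>"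
        unfolding T_I_term_def X_def \<rho>_def power_mult_distrib by (simp add: mult_ac del: of_nat_Suc)
      also have "\<dots> = \<kappa> * of_real (\<phi> ^ j * (mt E \<phi> n + \<phi>\<^sup>2 * mt E' \<phi> n)) + \<kappa>' * of_real (\<phi> ^ k * mt Q \<phi> n)"
        unfolding Theta X \<kappa>_def \<kappa>'_def E_def[symmetric] E'_def[symmetric] by (simp add: algebra_simps)
      finally show ?thesis by simp
    qed
    ultimately show ?thesis unfolding f_def T_I_def by (simp add: sums_iff)
  qed
  have E_minus: "E (- t) = 1 * E t" "E' (- t) = 1 * E' t" for t
    by (simp_all add: E_def E'_def even_numer_minus)
  define \<sigma> where "\<sigma> = (-1 :: real) ^ j"
  have \<sigma>: "\<sigma> = 1 \<or> \<sigma> = -1" by (cases "even j") (auto simp: \<sigma>_def)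
  have F_minus: "F (- \<phi>) = \<sigma> * F \<phi>" if "\<phi> \<noteq> 0" for \<phi>
    using mode_sum_minus[OF E_minus(1) E_bound2 _ that] mode_sum_minus[OF E_minus(2) E'_bound2 _ that]
    by (simp add: F_def \<sigma>_def power_minus[of \<phi> j])
  \<comment> \<open>The conditions on \<open>cnj K\<close> and \<open>cnj K'\<close> compensate the
    signs of (- \<phi>)^j and (- \<phi>)^k. The parity of the numerators decides the rest: even ones
    survive and the odd \<open>Q\<close> cancels.\<close>
  have real_part: "imag_axis_real_part f \<phi> = \<kappa> * of_real (F \<phi>)" if \<phi>: "\<phi> \<noteq> 0" for \<phi>
  proof -
    have Qm: "mode_sum \<rho> Q (- \<phi>) = - 1 * mode_sum \<rho> Q \<phi>"
      by (rule mode_sum_minus[OF _ Q_bound _ \<phi>]) (auto simp: Q_odd)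
    have c: "cnj \<kappa> = of_real \<sigma> * \<kappa>" "cnj \<kappa>' = (-1) ^ k * \<kappa>'" by (simp_all add: \<kappa>_def \<kappa>'_def K \<sigma>_def)
    have "cnj (f (- \<phi>)) = of_real \<sigma> * \<kappa> * (of_real \<sigma> * of_real (F \<phi>))
        + (-1) ^ k * \<kappa>' * ((-1) ^ k * of_real (\<phi> ^ k * (- mode_sum \<rho> Q \<phi>)))"
      using f_eq[of "- \<phi>"] \<phi> F_minus[OF \<phi>] by (simp add: c Qm power_minus[of \<phi> k])
    also have "\<dots> = \<kappa> * of_real (F \<phi>) - \<kappa>' * of_real (\<phi> ^ k * mode_sum \<rho> Q \<phi>)"
    proof -
      have m1: "of_real \<sigma> * of_real \<sigma> = (1 :: complex)" using \<sigma> by auto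
      have m2: "(-1) ^ k * (-1) ^ k = (1 :: complex)" by (simp flip: power_mult_distrib)
      define Y :: complex where "Y = of_real (\<phi> ^ k * mode_sum \<rho> Q \<phi>)"
      have Y: "complex_of_real (\<phi> ^ k * (- mode_sum \<rho> Q \<phi>)) = - Y" by (simp add: Y_def)
      have "of_real \<sigma> * \<kappa> * (of_real \<sigma> * of_real (F \<phi>)) + (-1) ^ k * \<kappa>' * ((-1) ^ k * (- Y))
          = (of_real \<sigma> * of_real \<sigma>) * (\<kappa> * of_real (F \<phi>)) - ((-1) ^ k * (-1) ^ k) * (\<kappa>' * Y)"
        by (simp only: mult_ac mult_minus_right) simp
      thus ?thesis unfolding m1 m2 Y Y_def[symmetric] by simp
    qed
    finally show ?thesis using f_eq[OF \<phi>] by (simp add: imag_axis_real_part_def)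
  qed
  define q :: "complex \<Rightarrow> complex" where "q s = (1 + of_real (\<rho>\<^sup>2) * s\<^sup>2) ^ 5" for s
  define R1 where "R1 = (rat_num (coeff2 a0 a1 b1 b2 s) (coeff4 a0 a1 b1 b2 s) (coeff6 a0 a1 b1 b2 s) \<rho> :: complex \<Rightarrow> complex)"
  define R2 where "R2 = (rat_num (coeff2 a0' a1' b1' b2' s') (coeff4 a0' a1' b1' b2' s') (coeff6 a0' a1' b1' b2' s') \<rho> :: complex \<Rightarrow> complex)"
  define r1 where "r1 = (rat_num (coeff2 a0 a1 b1 b2 s) (coeff4 a0 a1 b1 b2 s) (coeff6 a0 a1 b1 b2 s) \<rho> :: real \<Rightarrow> real)"
  define r2 where "r2 = (rat_num (coeff2 a0' a1' b1' b2' s') (coeff4 a0' a1' b1' b2' s') (coeff6 a0' a1' b1' b2' s') \<rho> :: real \<Rightarrow> real)"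
  define p where "p w = \<kappa> * (w ^ j * (R1 w + w\<^sup>2 * R2 w))" for w
  define g where "g \<phi> = \<phi> ^ j * (r1 \<phi> / (1 + \<rho>\<^sup>2 * \<phi>\<^sup>2) ^ 5 + \<phi>\<^sup>2 * (r2 \<phi> / (1 + \<rho>\<^sup>2 * \<phi>\<^sup>2) ^ 5))" for \<phi>
  have "\<exists>c. (\<forall>n. even n \<longrightarrow> c n = 0) \<and> asym_series (\<lambda>\<phi>. mode_sum \<rho> E \<phi> - r1 \<phi> / (1 + \<rho>\<^sup>2 * \<phi>\<^sup>2) ^ 5) c"
    unfolding E_def r1_def
    by (rule mode_sum_asym_series[OF even_numer_trig_laurent even_numer_bound even_numer_expands])
  then obtain c1 where c1: "\<forall>n. even n \<longrightarrow> c1 n = 0" "asym_series (\<lambda>\<phi>. mode_sum \<rho> E \<phi> - r1 \<phi> / (1 + \<rho>\<^sup>2 * \<phi>\<^sup>2) ^ 5) c1"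
    by (elim exE conjE)
  have "\<exists>c. (\<forall>n. even n \<longrightarrow> c n = 0) \<and> asym_series (\<lambda>\<phi>. mode_sum \<rho> E' \<phi> - r2 \<phi> / (1 + \<rho>\<^sup>2 * \<phi>\<^sup>2) ^ 5) c"
    unfolding E'_def r2_def
    by (rule mode_sum_asym_series[OF even_numer_trig_laurent even_numer_bound even_numer_expands])
  then obtain c2 where c2: "\<forall>n. even n \<longrightarrow> c2 n = 0" "asym_series (\<lambda>\<phi>. mode_sum \<rho> E' \<phi> - r2 \<phi> / (1 + \<rho>\<^sup>2 * \<phi>\<^sup>2) ^ 5) c2"
    by (elim exE conjE)
  define c3 where "c3 n = (if n < j then 0 else c1 (n - j) + (if n - j < 2 then 0 else c2 (n - j - 2)))" for n
  have series: "asym_series (\<lambda>\<phi>. F \<phi> - g \<phi>) c3"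
  proof -
    have "asym_series (\<lambda>\<phi>. \<phi> ^ j * ((mode_sum \<rho> E \<phi> - r1 \<phi> / (1 + \<rho>\<^sup>2 * \<phi>\<^sup>2) ^ 5)
        + \<phi> ^ 2 * (mode_sum \<rho> E' \<phi> - r2 \<phi> / (1 + \<rho>\<^sup>2 * \<phi>\<^sup>2) ^ 5))) c3"
      unfolding c3_def by (intro asym_series_mult_power asym_series_add c1 c2)
    thus ?thesis by (simp add: F_def g_def algebra_simps)
  qed
  have c3_zero: "c3 n = 0" if "\<sigma> * (-1) ^ n = 1" for n
  proof (cases "n < j")
    case False
    have "(-1 :: real) ^ (j + n) = 1" using that by (simp add: \<sigma>_def power_add)
    hence "even (j + n)" by (cases "even (j + n)") auto
    hence "even (n - j)" using False by auto
    hence "c1 (n - j) = 0" "n - j < 2 \<or> c2 (n - j - 2) = 0" using c1(1) c2(1) by auto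
    thus ?thesis by (auto simp: c3_def)
  qed (simp add: c3_def)
  have \<rho>_nonneg: "\<rho> \<ge> 0" using pos by (simp add: \<rho>_def cyl_radius_def)
  have \<tau>_pos: "\<tau> > 0" using pos by (simp add: \<tau>)
  have \<rho>\<tau>: "\<rho> * \<tau> = cyl_radius x y * \<omega>" using pos by (simp add: \<rho>_def \<tau>)
  \<comment> \<open>The distance from 0 to the poles \<plusminus> i / \<rho>; on the rotation axis
    there are none, and any radius beyond \<tau> serves.\<close>
  define R where "R = (if \<rho> = 0 then \<tau> + 1 else 1 / \<rho>)"
  have z_eq: "z = \<i> * of_real \<tau>" by (simp add: z_def \<tau>)
  have zR: "z \<in> ball 0 R"
    using \<rho>\<tau> pos(3) \<rho>_nonneg \<tau>_pos by (auto simp: z_eq norm_mult R_def field_simps)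
  have q_nz: "q w \<noteq> 0" if "w \<in> ball 0 R" for w
  proof
    assume "q w = 0"
    hence "of_real (\<rho>\<^sup>2) * w\<^sup>2 = -1" by (simp add: q_def add_eq_0_iff)
    hence "norm (of_real (\<rho>\<^sup>2) * w\<^sup>2) = 1" by simp
    hence "(\<rho> * norm w)\<^sup>2 = 1" by (simp add: norm_mult norm_power power_mult_distrib)
    moreover have "\<rho> * norm w \<ge> 0" using \<rho>_nonneg by simp
    ultimately have *: "\<rho> * norm w = 1" by (simp add: power2_eq_1_iff)
    hence "\<rho> \<noteq> 0" by auto
    hence "norm w < 1 / \<rho>" using that by (simp add: R_def)
    thus False using * \<open>\<rho> \<noteq> 0\<close> \<rho>_nonneg by (simp add: field_simps)
  qed
  have R_even: "R1 (- w) = R1 w" "R2 (- w) = R2 w" for w by (simp_all add: R1_def R2_def rat_num_def)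
  have R_of_real: "R1 (of_real \<phi>) = of_real (r1 \<phi>)" "R2 (of_real \<phi>) = of_real (r2 \<phi>)" for \<phi>
    by (simp_all add: R1_def R2_def r1_def r2_def rat_num_def Let_def)
  have R_holo: "R1 holomorphic_on UNIV" "R2 holomorphic_on UNIV"
    unfolding R1_def R2_def rat_num_def[abs_def] Let_def by (auto intro!: holomorphic_intros)
  have holo: "p holomorphic_on UNIV" "q holomorphic_on UNIV"
    unfolding p_def[abs_def] q_def[abs_def] by (auto intro!: holomorphic_intros R_holo)
  have pq: "\<kappa> * of_real (g \<phi>) = p (of_real \<phi>) / q (of_real \<phi>)" for \<phi>
    by (simp add: p_def q_def g_def R_of_real add_divide_distrib distrib_left)
  have pq_parity: "p (- w) / q (- w) = of_real \<sigma> * (p w / q w)" for w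
    by (simp add: p_def q_def R_even \<sigma>_def power_minus[of w j])
  have distilled: "distilled_value h z v \<longleftrightarrow> v = p z / q z"
    if "\<And>\<phi>. \<phi> \<noteq> 0 \<Longrightarrow> h \<phi> = \<kappa> * of_real (F \<phi>)" for h v
    by (rule distilled_value_quotient[OF that \<sigma> F_minus series c3_zero holo q_nz zR pq pq_parity])
  have val_eq: "Re (p z / q z) = d"
  proof -
    have G: "\<Gamma> * (1 - \<rho>\<^sup>2 * \<tau>\<^sup>2) = 1" using \<Gamma> \<rho>\<tau> by (simp flip: power_mult_distrib)
    define X where "X = mode_val a0 a1 b1 b2 s \<tau> \<Gamma>"
    define Y where "Y = mode_val a0' a1' b1' b2' s' \<tau> \<Gamma>"
    have XY: "R1 z / q z = of_real X" "R2 z / q z = of_real Y"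
      unfolding R1_def R2_def q_def z_eq X_def Y_def mode_val_def by (rule rat_num_imaginary[OF G])+
    have "p z / q z = \<kappa> * z ^ j * (R1 z / q z + z\<^sup>2 * (R2 z / q z))"
      by (simp add: p_def add_divide_distrib distrib_left mult.assoc)
    also have "z\<^sup>2 = - of_real (\<tau>\<^sup>2)" by (simp add: z_eq power_mult_distrib)
    also have "\<kappa> * z ^ j * (R1 z / q z + - of_real (\<tau>\<^sup>2) * (R2 z / q z))
       = of_real (T0 ^ 4 / pi\<^sup>2) * (K * z ^ j * of_real (X - \<tau>\<^sup>2 * Y))"
      unfolding XY \<kappa>_def by simp
    also have "Re \<dots> = T0 ^ 4 / pi\<^sup>2 * (Re (K * z ^ j) * (X - \<tau>\<^sup>2 * Y))"
    proof -
      have "Re (of_real b * (w * of_real c)) = b * (Re w * c)" for b c w by simp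
      thus ?thesis .
    qed
    finally show ?thesis using val unfolding z_eq X_def Y_def by simp
  qed
  have real_part_distilled: "distilled_value (imag_axis_real_part f) z v \<longleftrightarrow> v = p z / q z" for v
    by (rule distilled[OF real_part])
  \<comment> \<open>If K' = 0, then f agrees with its real part away from 0. Otherwise their
    difference, a non-zero multiple of the logarithmic mode sum, would inherit an asymptotic series,
    so f has no distilled value at all.\<close>
  have "Re v = d" if v: "distilled_value f z v" for v
  proof (cases "K' = 0")
    case True
    hence "f \<phi> = \<kappa> * of_real (F \<phi>)" if "\<phi> \<noteq> 0" for \<phi> using f_eq[OF that] by (simp add: \<kappa>'_def)
    from distilled[OF this] v val_eq show ?thesis by simp
  next
    case False
    obtain cf where cf: "has_asymptotic_series f cf (at_right 0)"
      using v unfolding distilled_value_def is_analytic_distillate_def by blast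
    have "distilled_value (imag_axis_real_part f) z (p z / q z)" by (simp add: real_part_distilled)
    then obtain cr where cr: "has_asymptotic_series (imag_axis_real_part f) cr (at_right 0)"
      unfolding distilled_value_def is_analytic_distillate_def by blast
    have le: "at_right 0 \<le> at (0 :: real)" by (rule at_le) simp
    have "\<kappa>' \<noteq> 0" using False pos by (simp add: \<kappa>'_def)
    moreover have "f \<phi> + (-1) * imag_axis_real_part f \<phi> = \<kappa>' * of_real (\<phi> ^ k * mode_sum \<rho> Q \<phi>)" if "\<phi> > 0" for \<phi>
      using f_eq[of \<phi>] real_part[of \<phi>] that by simp
    ultimately have "\<not> has_asymptotic_series (\<lambda>\<phi>. f \<phi> + (-1) * imag_axis_real_part f \<phi>) (\<lambda>n. cf n + (-1) * cr n) (at_right 0)"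
      by (rule no_asymptotic_series_log[OF _ _ Q_bound Q_exp])
    with has_asymptotic_series_lincomb[OF cf cr le, of "-1"] show ?thesis by blast
  qed
  thus ?thesis using real_part_distilled val_eq by auto
qed

section \<open>Evaluation on the imaginary axis\<close>

lemma rat_val_scale: "rat_val (m * e2) (m * e4) (m * e6) \<tau> \<Gamma> = m * rat_val e2 e4 e6 \<tau> \<Gamma>"
  unfolding rat_val_def by (simp add: algebra_simps)

lemma mode_val_scale:
  "mode_val (m * a0) (m * a1) (m * b1) (m * b2) (m * s) \<tau> \<Gamma> = m * mode_val a0 a1 b1 b2 s \<tau> \<Gamma>"
  unfolding mode_val_def rat_val_scale[symmetric] coeff2_def coeff4_def coeff6_def
  by (simp add: algebra_simps)

lemmas val_defs = mode_val_def rat_val_def coeff2_def coeff4_def coeff6_def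

context
  fixes \<xi> T0 \<tau> \<Gamma> :: real
  fixes b2 a2 w2 \<rho> p Wc Ac Gl Gc :: real
  assumes nz: "T0 \<noteq> 0" "\<Gamma> \<noteq> 0"
  defines "b2 \<equiv> 1 / (T0\<^sup>2 * \<Gamma>)" and "a2 \<equiv> - ((\<Gamma> - 1) * \<tau>\<^sup>2)" and "w2 \<equiv> - (\<Gamma> * \<tau>\<^sup>2)"
  defines "\<rho> \<equiv> rho_coeff \<xi> b2 a2 w2" and "p \<equiv> p_coeff \<xi> b2 a2 w2" and "Wc \<equiv> W_coeff \<xi> b2 a2 w2"
    and "Ac \<equiv> A_coeff \<xi> b2 a2 w2" and "Gl \<equiv> Gl_coeff \<xi> b2" and "Gc \<equiv> G_coeff \<xi> b2 a2 w2"
begin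

lemma inverse_b2_sq: "1 / b2\<^sup>2 = T0 ^ 4 * \<Gamma>\<^sup>2"
  using nz by (simp add: b2_def power_divide power_mult_distrib flip: power_mult)

text \<open>With the factor T0^4 / pi^2 pulled out, the comparisons that follow become rational
  identities in pi, \<xi>, \<Gamma> and \<tau>.\<close>

lemma coeffs_expand:
  "\<rho> = T0 ^ 4 / pi\<^sup>2 * (\<Gamma>\<^sup>2 * (pi ^ 4 / 30 + pi\<^sup>2 * ((4 * \<xi> - 1) / 12 * w2 + (6 * \<xi> - 1) / 12 * a2)
      + (4 * \<xi> - 1) / 48 * w2\<^sup>2 + (60 * \<xi> - 11) / 480 * a2\<^sup>2 + (270 * \<xi> - 61) / 720 * (a2 * w2)))" (is ?\<rho>)
  "p = T0 ^ 4 / pi\<^sup>2 * (\<Gamma>\<^sup>2 * (pi ^ 4 / 90 + pi\<^sup>2 * (- \<xi> / 6 * w2 + (1 - 6 * \<xi>) / 18 * a2)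
      - \<xi> / 24 * w2\<^sup>2 + (19 - 120 * \<xi>) / 1440 * a2\<^sup>2))" (is ?p)
  "Wc = T0 ^ 4 / pi\<^sup>2 * (\<Gamma>\<^sup>2 * (pi\<^sup>2 * (2 * \<xi> - 1) / 12 + (2 * \<xi> - 1) / 48 * w2 + (120 * \<xi> - 29) / 360 * a2))" (is ?W)
  "Ac = T0 ^ 4 / pi\<^sup>2 * (\<Gamma>\<^sup>2 * (pi\<^sup>2 * (1 - 6 * \<xi>) / 12 + w2 / 360 + (1 - 6 * \<xi>) / 48 * a2))" (is ?A)
  "Gl = T0 ^ 4 / pi\<^sup>2 * (\<Gamma>\<^sup>2 * ((1 - 70 * \<xi>) / 240))" (is ?l)
  "Gc = T0 ^ 4 / pi\<^sup>2 * (\<Gamma>\<^sup>2 * (pi\<^sup>2 * (6 * \<xi> + 1) / 36 + (10 * \<xi> - 1) / 240 * w2 + (30 * \<xi> - 7) / 720 * a2))" (is ?G)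
proof -
  have Gl: "Gl_coeff \<xi> b2 = 1 / b2\<^sup>2 * ((1 - 70 * \<xi>) / (240 * pi\<^sup>2))" by (simp add: Gl_coeff_def)
  have pull: "1 / b2\<^sup>2 * x = T0 ^ 4 / pi\<^sup>2 * (\<Gamma>\<^sup>2 * y)" if "pi\<^sup>2 * x = y" for x y
    unfolding inverse_b2_sq that[symmetric] by simp
  show ?\<rho> and ?p and ?W and ?A and ?l and ?G
    unfolding \<rho>_def p_def Wc_def Ac_def Gl_def Gl Gc_def
      rho_coeff_def p_coeff_def W_coeff_def A_coeff_def G_coeff_def
    by (rule pull, simp add: field_simps power_numeral_reduce)+
qed

text \<open>Here S stands for r^2 \<omega>^2; the right-hand side is the tt component of the tetrad
  decomposition, with \<gamma>^2 written as \<Gamma>.\<close>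

lemma val_tt:
  assumes "S = 1 - 1 / \<Gamma>"
  shows "T0 ^ 4 / pi\<^sup>2 * (mode_val (4 * \<xi> + 2) (1 - 4 * \<xi>) 0 0 0 \<tau> \<Gamma>
     - S * mode_val 0 0 (- 2 * (8 * \<xi> - 1)) (4 * \<xi> - 1) 0 \<tau> \<Gamma>)
     = \<rho> * \<Gamma> - p * (1 - \<Gamma>) + Gl * \<Gamma> * (\<Gamma> - 1)\<^sup>2 * \<tau> ^ 4 + 2 * Gc * \<Gamma> * (\<Gamma> - 1) * \<tau>\<^sup>2"
proof -
  define k where "k = T0 ^ 4 / pi\<^sup>2"
  show ?thesis
    unfolding assms coeffs_expand k_def[symmetric] unfolding a2_def w2_def val_defs using nz(2)
    by (simp add: field_simps power_numeral_reduce)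
qed

lemma val_zz:
  assumes "S = 1 - 1 / \<Gamma>"
  shows "T0 ^ 4 / pi\<^sup>2 * (mode_val (2 - 4 * \<xi>) (- (1 - 4 * \<xi>)) 0 0 0 \<tau> \<Gamma>
     - S * mode_val 0 0 (2 * (8 * \<xi> - 1)) (- (4 * \<xi> - 1)) 0 \<tau> \<Gamma>)
     = p + Wc * \<Gamma> * \<tau>\<^sup>2"
proof -
  define k where "k = T0 ^ 4 / pi\<^sup>2"
  show ?thesis
    unfolding assms coeffs_expand k_def[symmetric] unfolding a2_def w2_def val_defs using nz(2)
    by (simp add: field_simps power_numeral_reduce)
qed

text \<open>A and B stand for x^2 \<omega>^2 and y^2 \<omega>^2; exchanging them gives the yy
  component.\<close>

lemma val_xx:
  assumes "A + B = 1 - 1 / \<Gamma>"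
  shows "T0 ^ 4 / pi\<^sup>2 * (mode_val (1 - 2 * \<xi>) (2 * \<xi>) 0 0 0 \<tau> \<Gamma>
     - (A - 3 * B) * mode_val 0 0 (- 2 * (4 * \<xi> - 1)) (2 * \<xi>) 0 \<tau> \<Gamma>)
     = \<rho> * \<Gamma> * B + p * (1 + \<Gamma> * B) + Ac * \<Gamma> * A * \<tau>\<^sup>2 + Gl * \<Gamma> ^ 3 * B * \<tau> ^ 4 + 2 * Gc * \<Gamma>\<^sup>2 * B * \<tau>\<^sup>2"
proof -
  define k where "k = T0 ^ 4 / pi\<^sup>2"
  have A: "A = 1 - 1 / \<Gamma> - B" using assms by simp
  show ?thesis
    unfolding A coeffs_expand k_def[symmetric] unfolding a2_def w2_def val_defs using nz(2)
    by (simp add: field_simps power_numeral_reduce)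
qed

text \<open>The xy component with the factor x y \<omega>^2 removed.\<close>

lemma val_xy:
  "- (T0 ^ 4 / pi\<^sup>2 * mode_val 0 0 (8 * (1 - 4 * \<xi>)) (8 * \<xi>) 0 \<tau> \<Gamma>)
     = - (\<rho> + p) * \<Gamma> + Ac * \<Gamma> * \<tau>\<^sup>2 - Gl * \<Gamma> ^ 3 * \<tau> ^ 4 - 2 * Gc * \<Gamma>\<^sup>2 * \<tau>\<^sup>2"
proof -
  define k where "k = T0 ^ 4 / pi\<^sup>2"
  show ?thesis
    unfolding coeffs_expand k_def[symmetric] unfolding a2_def w2_def val_defs using nz(2)
    by (simp add: field_simps power_numeral_reduce)
qed

text \<open>The factor shared by the tx and ty components, whose prefactors are - y \<omega> and x
  \<omega>; it arises from the single numerator t sin t.\<close>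

lemma val_tx:
  "4 * (T0 ^ 4 / pi\<^sup>2 * mode_val 0 0 0 0 1 \<tau> \<Gamma>)
     = (\<rho> + p) * \<Gamma> + Gl * \<Gamma>\<^sup>2 * (\<Gamma> - 1) * \<tau> ^ 4 + Gc * (\<Gamma> * (\<Gamma> - 1) + \<Gamma>\<^sup>2) * \<tau>\<^sup>2"
proof -
  define k where "k = T0 ^ 4 / pi\<^sup>2"
  show ?thesis
    unfolding coeffs_expand k_def[symmetric] unfolding a2_def w2_def val_defs using nz(2)
    by (simp add: field_simps power_numeral_reduce)
qed

end

text \<open>The odd numerator of the xx, yy and xy components, equal to 2 sin t (1 - cos t);
  \<open>odd_numer'\<close> is that of tx and ty.\<close>

definition odd_numer :: "real \<Rightarrow> real" where
  "odd_numer t = 2 * sin t - sin (2 * t)"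

definition odd_numer' :: "real \<Rightarrow> real" where
  "odd_numer' t = t * (1 - cos t)"

lemma odd_numer_minus: "odd_numer (- t) = - odd_numer t" "odd_numer' (- t) = - odd_numer' t"
  by (simp_all add: odd_numer_def odd_numer'_def)

text \<open>One constant must serve here and in \<open>odd_numer_expansion\<close>, because
  \<open>no_asymptotic_series_log\<close> uses the same c in both hypotheses. Its size is dictated
  there by the remainder of sin (2 t), which contributes 2^8.\<close>

lemma odd_numer_bound: "\<bar>odd_numer t\<bar> \<le> 300 * \<bar>t\<bar> ^ 3" "\<bar>odd_numer' t\<bar> \<le> 300 * \<bar>t\<bar> ^ 3"
proof -
  have 1: "\<bar>1 - cos t\<bar> \<le> \<bar>t\<bar>\<^sup>2"
    using one_minus_cos_le[of t] cos_le_one[of t] zero_le_power2[of t] by (simp only: power2_abs)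
  have p3: "\<bar>t\<bar> * \<bar>t\<bar>\<^sup>2 = \<bar>t\<bar> ^ 3" by (simp add: power_numeral_reduce)
  have nn: "\<bar>t\<bar> ^ 3 \<ge> 0" by simp
  have "odd_numer t = 2 * (sin t * (1 - cos t))"
    unfolding odd_numer_def sin_double by (simp add: algebra_simps)
  hence "\<bar>odd_numer t\<bar> = 2 * (\<bar>sin t\<bar> * \<bar>1 - cos t\<bar>)" by (simp add: abs_mult)
  also have "\<dots> \<le> 2 * (\<bar>t\<bar> * \<bar>t\<bar>\<^sup>2)"
    using 1 abs_sin_x_le_abs_x[of t] by (intro mult_left_mono mult_mono) auto
  finally show "\<bar>odd_numer t\<bar> \<le> 300 * \<bar>t\<bar> ^ 3" using p3 nn by linarith
  have "\<bar>odd_numer' t\<bar> \<le> \<bar>t\<bar> * \<bar>t\<bar>\<^sup>2"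
    unfolding odd_numer'_def abs_mult using 1 by (intro mult_left_mono) auto
  thus "\<bar>odd_numer' t\<bar> \<le> 300 * \<bar>t\<bar> ^ 3" using p3 nn by linarith
qed

text \<open>After division by t^6 the coefficients -1/4 and -1/24 at t^5 produce the harmonic sums;
  their being non-zero excludes an asymptotic series.\<close>

lemma odd_numer_expansion:
  assumes t: "0 < t" "t \<le> 1"
  shows "\<bar>odd_numer t - 1 * t ^ 3 - (- 1 / 4) * t ^ 5\<bar> \<le> 300 * t ^ 7"
    and "\<bar>odd_numer' t - 1 / 2 * t ^ 3 - (- 1 / 24) * t ^ 5\<bar> \<le> 300 * t ^ 7"
proof -
  have set: "{..3::nat} = {0, 1, 2, 3}" by auto
  have facts: "fact 3 = (6 :: real)" "fact 4 = (24 :: real)" "fact 5 = (120 :: real)" "fact 6 = (720 :: real)" "fact 7 = (5040 :: real)"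
    by (simp_all add: fact_numeral)
  have sin3: "\<bar>sin x - (x - x ^ 3 / 6 + x ^ 5 / 120 - x ^ 7 / 5040)\<bar> \<le> \<bar>x\<bar> ^ 8" for x :: real
  proof -
    have "(\<Sum>i\<le>3. (-1) ^ i * x ^ (2 * i + 1) / fact (2 * i + 1)) = x - x ^ 3 / 6 + x ^ 5 / 120 - x ^ 7 / 5040"
      unfolding set by (simp del: fact_Suc add: facts power_numeral_reduce)
    thus ?thesis using sin_remainder[of x 3] by simp
  qed
  have cos3: "\<bar>cos x - (1 - x ^ 2 / 2 + x ^ 4 / 24 - x ^ 6 / 720)\<bar> \<le> \<bar>x\<bar> ^ 7" for x :: real
  proof -
    have "(\<Sum>i\<le>3. (-1) ^ i * x ^ (2 * i) / fact (2 * i)) = 1 - x ^ 2 / 2 + x ^ 4 / 24 - x ^ 6 / 720"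
      unfolding set by (simp del: fact_Suc add: facts)
    thus ?thesis using cos_remainder[of x 3] by simp
  qed
  have t8: "t ^ 8 \<le> t ^ 7" using t by (intro power_decreasing) auto
  have t7: "t ^ 7 \<ge> 0" using t by simp
  have s1: "\<bar>sin t - (t - t ^ 3 / 6 + t ^ 5 / 120 - t ^ 7 / 5040)\<bar> \<le> t ^ 7"
    using sin3[of t] t t8 by simp
  have s2: "\<bar>sin (2 * t) - (2 * t - 8 * t ^ 3 / 6 + 32 * t ^ 5 / 120 - 128 * t ^ 7 / 5040)\<bar> \<le> 256 * t ^ 7"
    using sin3[of "2 * t"] t t8 by (simp add: power_mult_distrib)
  show "\<bar>odd_numer t - 1 * t ^ 3 - (- 1 / 4) * t ^ 5\<bar> \<le> 300 * t ^ 7"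
    using s1 s2 t7 unfolding odd_numer_def by linarith
  have eq: "odd_numer' t - 1 / 2 * t ^ 3 - (- 1 / 24) * t ^ 5
     = t ^ 7 / 720 - t * (cos t - (1 - t ^ 2 / 2 + t ^ 4 / 24 - t ^ 6 / 720))"
    by (simp add: odd_numer'_def algebra_simps power_numeral_reduce)
  have "t * \<bar>cos t - (1 - t ^ 2 / 2 + t ^ 4 / 24 - t ^ 6 / 720)\<bar> \<le> t * t ^ 7"
    using cos3[of t] t by (intro mult_left_mono) auto
  also have "\<dots> \<le> 1 * t ^ 7" using t by (intro mult_right_mono) auto
  finally have "\<bar>t * (cos t - (1 - t ^ 2 / 2 + t ^ 4 / 24 - t ^ 6 / 720))\<bar> \<le> t ^ 7"
    using t by (simp add: abs_mult)
  thus "\<bar>odd_numer' t - 1 / 2 * t ^ 3 - (- 1 / 24) * t ^ 5\<bar> \<le> 300 * t ^ 7"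
    unfolding eq using t7 by linarith
qed

theorem mainTheorem11:
  fixes T0 \<xi> x y \<omega> :: real
  assumes "T0 > 0" and "\<omega> > 0" and "cyl_radius x y * \<omega> < 1"
  shows
    "let b2 = \<beta>_sq T0 \<omega> x y; a2 = \<alpha>_sq T0 \<omega> x y; w2 = w_sq T0 \<omega> x y;
         D = decomposition (u_vec \<omega> x y) (\<alpha>_vec T0 \<omega> x y) (w_vec T0 \<omega> x y) (l_vec T0 \<omega> x y)
               (rho_coeff \<xi> b2 a2 w2) (p_coeff \<xi> b2 a2 w2)
               (W_coeff \<xi> b2 a2 w2) (A_coeff \<xi> b2 a2 w2)
               (Gl_coeff \<xi> b2) (G_coeff \<xi> b2 a2 w2)
               0 0 0 0 0;
         z = \<i> * of_real (\<omega> / T0)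
     in \<forall>\<mu> \<nu>.
          (\<forall>v. distilled_value (T_I T0 \<xi> x y \<mu> \<nu>) z v \<longrightarrow> Re v = D \<mu> \<nu>) \<and>
          (\<exists>v. distilled_value (imag_axis_real_part (T_I T0 \<xi> x y \<mu> \<nu>)) z v) \<and>
          (\<forall>v. distilled_value (imag_axis_real_part (T_I T0 \<xi> x y \<mu> \<nu>)) z v
                 \<longrightarrow> Re v = D \<mu> \<nu>)"
proof -
  define \<tau> where "\<tau> = \<omega> / T0"
  define \<gamma> where "\<gamma> = lorentz_gamma \<omega> x y"
  define X where "X = x * \<omega>"
  define Y where "Y = y * \<omega>"
  define h where "h = 1 - (cyl_radius x y)\<^sup>2 * \<omega>\<^sup>2"
  \<comment> \<open>The square of the Lorentz factor. Non-zero tetrad components are odd in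
    \<gamma>, so their products involve only \<Gamma>, and the square root disappears.\<close>
  define \<Gamma> where "\<Gamma> = 1 / h"
  have r2: "(cyl_radius x y)\<^sup>2 = x\<^sup>2 + y\<^sup>2" by (simp add: cyl_radius_def)
  have "(cyl_radius x y * \<omega>)\<^sup>2 < 1\<^sup>2"
    using assms by (intro power_strict_mono) (auto simp: cyl_radius_def)
  hence h: "h > 0" by (simp add: h_def power_mult_distrib)
  have \<Gamma>: "\<Gamma> \<noteq> 0" "\<Gamma> * (1 - (cyl_radius x y)\<^sup>2 * \<omega>\<^sup>2) = 1"
    using h by (simp_all add: \<Gamma>_def flip: h_def)
  have \<gamma>2: "\<gamma> * \<gamma> = \<Gamma>" "\<gamma>\<^sup>2 = \<Gamma>"
    using h by (simp_all add: \<gamma>_def lorentz_gamma_def \<Gamma>_def power_divide flip: h_def power2_eq_square)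
  have XY: "X\<^sup>2 + Y\<^sup>2 = 1 - 1 / \<Gamma>" "Y\<^sup>2 + X\<^sup>2 = 1 - 1 / \<Gamma>"
    by (simp_all add: X_def Y_def \<Gamma>_def h_def r2 algebra_simps)
  have nz: "T0 \<noteq> 0" using assms by simp
  define b2 where "b2 = 1 / (T0\<^sup>2 * \<Gamma>)"
  define a2 where "a2 = - ((\<Gamma> - 1) * \<tau>\<^sup>2)"
  define w2 where "w2 = - (\<Gamma> * \<tau>\<^sup>2)"
  have scalars: "\<beta>_sq T0 \<omega> x y = b2" "\<alpha>_sq T0 \<omega> x y = a2" "w_sq T0 \<omega> x y = w2"
    using \<gamma>2(2) unfolding \<gamma>_def
    by (simp_all add: \<beta>_sq_def \<alpha>_sq_def w_sq_def b2_def a2_def w2_def \<tau>_def power_divide)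
  define \<rho> where "\<rho> = rho_coeff \<xi> b2 a2 w2"
  define p where "p = p_coeff \<xi> b2 a2 w2"
  define Wc where "Wc = W_coeff \<xi> b2 a2 w2"
  define Ac where "Ac = A_coeff \<xi> b2 a2 w2"
  define Gl where "Gl = Gl_coeff \<xi> b2"
  define Gc where "Gc = G_coeff \<xi> b2 a2 w2"
  define D where "D = decomposition (u_vec \<omega> x y) (\<alpha>_vec T0 \<omega> x y) (w_vec T0 \<omega> x y) (l_vec T0 \<omega> x y)
      \<rho> p Wc Ac Gl Gc 0 0 0 0 0"
  note vals = val_tt[OF nz \<Gamma>(1)] val_zz[OF nz \<Gamma>(1)] val_xx[OF nz \<Gamma>(1)] val_xy[OF nz \<Gamma>(1)] val_tx[OF nz \<Gamma>(1)]
  note vals = vals[where \<tau> = \<tau> and \<xi> = \<xi>, folded b2_def a2_def w2_def, folded \<rho>_def p_def Wc_def Ac_def Gl_def Gc_def]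
  note val_tt = vals(1) and val_zz = vals(2) and val_xx = vals(3) and val_xy = vals(4) and val_tx = vals(5)
  have \<gamma>3: "\<gamma> ^ 3 = \<gamma> * \<Gamma>" by (simp add: power_numeral_reduce flip: \<gamma>2)
  have vecs: "u_vec \<omega> x y = four_vec \<gamma> (- (\<gamma> * Y)) (\<gamma> * X) 0"
    "\<alpha>_vec T0 \<omega> x y = four_vec 0 (- (\<gamma> * X * \<tau>)) (- (\<gamma> * Y * \<tau>)) 0"
    "w_vec T0 \<omega> x y = four_vec 0 0 0 (\<gamma> * \<tau>)"
    "l_vec T0 \<omega> x y = four_vec (\<gamma> * (\<Gamma> - 1) * \<tau>\<^sup>2) (- (\<gamma> * \<Gamma> * Y * \<tau>\<^sup>2)) (\<gamma> * \<Gamma> * X * \<tau>\<^sup>2) 0"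
    by (simp_all add: u_vec_def \<alpha>_vec_def w_vec_def l_vec_def Let_def X_def Y_def \<tau>_def power2_eq_square
          power_numeral_reduce mult_ac flip: \<gamma>_def \<gamma>3 \<gamma>2)
  have \<gamma>\<gamma>: "\<gamma> * (\<gamma> * c) = \<Gamma> * c" for c by (simp add: \<gamma>2(1) flip: mult.assoc)
  have D_sym: "D \<nu> \<mu> = D \<mu> \<nu>" for \<mu> \<nu>
    by (simp add: D_def decomposition_def metric_def mult_ac)
  have D_tt: "D It It = \<rho> * \<Gamma> - p * (1 - \<Gamma>) + Gl * \<Gamma> * (\<Gamma> - 1)\<^sup>2 * \<tau> ^ 4 + 2 * Gc * \<Gamma> * (\<Gamma> - 1) * \<tau>\<^sup>2"
    and D_xx: "D Ix Ix = \<rho> * \<Gamma> * Y\<^sup>2 + p * (1 + \<Gamma> * Y\<^sup>2) + Ac * \<Gamma> * X\<^sup>2 * \<tau>\<^sup>2 + Gl * \<Gamma> ^ 3 * Y\<^sup>2 * \<tau> ^ 4 + 2 * Gc * \<Gamma>\<^sup>2 * Y\<^sup>2 * \<tau>\<^sup>2"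
    and D_yy: "D Iy Iy = \<rho> * \<Gamma> * X\<^sup>2 + p * (1 + \<Gamma> * X\<^sup>2) + Ac * \<Gamma> * Y\<^sup>2 * \<tau>\<^sup>2 + Gl * \<Gamma> ^ 3 * X\<^sup>2 * \<tau> ^ 4 + 2 * Gc * \<Gamma>\<^sup>2 * X\<^sup>2 * \<tau>\<^sup>2"
    and D_zz: "D Iz Iz = p + Wc * \<Gamma> * \<tau>\<^sup>2"
    and D_tx: "D It Ix = - Y * ((\<rho> + p) * \<Gamma> + Gl * \<Gamma>\<^sup>2 * (\<Gamma> - 1) * \<tau> ^ 4 + Gc * (\<Gamma> * (\<Gamma> - 1) + \<Gamma>\<^sup>2) * \<tau>\<^sup>2)"
    and D_ty: "D It Iy = X * ((\<rho> + p) * \<Gamma> + Gl * \<Gamma>\<^sup>2 * (\<Gamma> - 1) * \<tau> ^ 4 + Gc * (\<Gamma> * (\<Gamma> - 1) + \<Gamma>\<^sup>2) * \<tau>\<^sup>2)"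
    and D_xy: "D Ix Iy = X * Y * (- (\<rho> + p) * \<Gamma> + Ac * \<Gamma> * \<tau>\<^sup>2 - Gl * \<Gamma> ^ 3 * \<tau> ^ 4 - 2 * Gc * \<Gamma>\<^sup>2 * \<tau>\<^sup>2)"
    and D_0: "D It Iz = 0" "D Ix Iz = 0" "D Iy Iz = 0"
    unfolding D_def decomposition_def vecs metric_def
    by (simp_all add: algebra_simps \<gamma>\<gamma> \<gamma>2(1) power2_eq_square power_numeral_reduce)
  define R where "R = (x\<^sup>2 + y\<^sup>2) * T0\<^sup>2"
  \<comment> \<open>The position-dependent factor of the \<phi>^2 part leaves
    \<open>mode_val\<close> by linearity and combines with \<tau>^2 into an expression in X and
    Y.\<close>
  have scale: "\<tau>\<^sup>2 * mode_val 0 0 (c * m) (d * m) 0 \<tau> \<Gamma> = (\<tau>\<^sup>2 * m) * mode_val 0 0 c d 0 \<tau> \<Gamma>" for c d m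
    using mode_val_scale[of m 0 0 c d 0 \<tau> \<Gamma>] by (simp add: mult_ac)
  have \<tau>R: "\<tau>\<^sup>2 * R = 1 - 1 / \<Gamma>" "\<tau>\<^sup>2 * (T0\<^sup>2 * (x\<^sup>2 - 3 * y\<^sup>2)) = X\<^sup>2 - 3 * Y\<^sup>2"
    "\<tau>\<^sup>2 * (T0\<^sup>2 * (y\<^sup>2 - 3 * x\<^sup>2)) = Y\<^sup>2 - 3 * X\<^sup>2" "\<tau>\<^sup>2 * (T0\<^sup>2 * (x * y)) = X * Y"
  proof -
    have \<omega>: "\<omega> = \<tau> * T0" using nz by (simp add: \<tau>_def)
    show "\<tau>\<^sup>2 * R = 1 - 1 / \<Gamma>"
      unfolding XY(1)[symmetric] X_def Y_def R_def \<omega> by (simp add: algebra_simps power2_eq_square)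
  qed (simp_all add: X_def Y_def \<tau>_def nz power2_eq_square field_simps)
  define P where "P \<mu> \<nu> \<longleftrightarrow> (\<forall>v. distilled_value (T_I T0 \<xi> x y \<mu> \<nu>) (\<i> * of_real (\<omega> / T0)) v \<longrightarrow> Re v = D \<mu> \<nu>) \<and>
          (\<exists>v. distilled_value (imag_axis_real_part (T_I T0 \<xi> x y \<mu> \<nu>)) (\<i> * of_real (\<omega> / T0)) v) \<and>
          (\<forall>v. distilled_value (imag_axis_real_part (T_I T0 \<xi> x y \<mu> \<nu>)) (\<i> * of_real (\<omega> / T0)) v
                 \<longrightarrow> Re v = D \<mu> \<nu>)" for \<mu> \<nu>
  \<comment> \<open>Two instances: an odd part with prefactor \<phi>^2 and \<open>odd_numer\<close>
    for the diagonal, xy and vanishing components, and one with prefactor \<phi> and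
    \<open>odd_numer'\<close> for tx and ty.\<close>
  note comp = component_distilled[OF assms _ _ _ odd_numer_minus(1) odd_numer_bound(1) odd_numer_expansion(1) _ \<tau>_def \<Gamma>(2), where k = 2]
    and comp' = component_distilled[OF assms _ _ _ odd_numer_minus(2) odd_numer_bound(2) odd_numer_expansion(2) _ \<tau>_def \<Gamma>(2), where k = 1]
  \<comment> \<open>Everything is reduced to sin N and cos N, so that matching \<open>Theta\<close>
    with the chosen numerators is pure algebra.\<close>
  have cos2: "cos (2 * N) = 2 * (cos N)\<^sup>2 - 1" "sin (2 * N) = 2 * sin N * cos N" "(sin (N / 2))\<^sup>2 = (1 - cos N) / 2" for N :: real
    using cos_double_sin[of "N / 2"] by (simp_all add: cos_double_cos sin_double)
  have ss: "(sin N)\<^sup>2 = 1 - (cos N)\<^sup>2" for N :: real by (simp add: sin_squared_eq)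
  have mode_val_zero: "mode_val 0 0 0 0 0 t g = 0" for t g
    by (simp add: val_defs)
  have P_tt: "P It It"
    unfolding P_def
  \<comment> \<open>No odd part occurs, hence K' = 0. The \<phi>^2 part carries R = \<rho>^2, and
    its constants recombine into 1 - cos N and 1 - cos (2 N).\<close>
  proof (rule comp[where K = "1" and K' = "0" and j = 0 and ?a0.0 = "4 * \<xi> + 2" and ?a1.0 = "1 - 4 * \<xi>" and ?b1.0 = "0" and ?b2.0 = "0" and s = "0" and a0' = "0" and a1' = "0" and b1' = "- 2 * (8 * \<xi> - 1) * R" and b2' = "(4 * \<xi> - 1) * R" and s' = "0"])
    show "Theta T0 \<xi> x y \<phi> n It It = 1 * of_real (\<phi> ^ 0 * (even_numer (4 * \<xi> + 2) (1 - 4 * \<xi>) 0 0 0 (real n * \<phi>)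
         + \<phi>\<^sup>2 * even_numer 0 0 (- 2 * (8 * \<xi> - 1) * R) ((4 * \<xi> - 1) * R) 0 (real n * \<phi>)))
         + 0 * of_real (\<phi> ^ 2 * odd_numer (real n * \<phi>))" for \<phi> n
      unfolding Theta_def Let_def r2 even_numer_def odd_numer_def odd_numer'_def cos2 R_def
      by (simp add: algebra_simps ss power2_eq_square)
    show "T0 ^ 4 / pi\<^sup>2 * (Re (1 * (\<i> * of_real \<tau>) ^ 0) *
       (mode_val (4 * \<xi> + 2) (1 - 4 * \<xi>) 0 0 0 \<tau> \<Gamma>
        - \<tau>\<^sup>2 * mode_val 0 0 (- 2 * (8 * \<xi> - 1) * R) ((4 * \<xi> - 1) * R) 0 \<tau> \<Gamma>)) = D It It"
      unfolding scale \<tau>R D_tt using val_tt[OF refl] by simp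
  qed simp_all
  have P_zz: "P Iz Iz"
    unfolding P_def
  proof (rule comp[where K = "1" and K' = "0" and j = 0 and ?a0.0 = "2 - 4 * \<xi>" and ?a1.0 = "- (1 - 4 * \<xi>)" and ?b1.0 = "0" and ?b2.0 = "0" and s = "0" and a0' = "0" and a1' = "0" and b1' = "2 * (8 * \<xi> - 1) * R" and b2' = "- (4 * \<xi> - 1) * R" and s' = "0"])
    show "Theta T0 \<xi> x y \<phi> n Iz Iz = 1 * of_real (\<phi> ^ 0 * (even_numer (2 - 4 * \<xi>) (- (1 - 4 * \<xi>)) 0 0 0 (real n * \<phi>)
         + \<phi>\<^sup>2 * even_numer 0 0 (2 * (8 * \<xi> - 1) * R) (- (4 * \<xi> - 1) * R) 0 (real n * \<phi>)))
         + 0 * of_real (\<phi> ^ 2 * odd_numer (real n * \<phi>))" for \<phi> n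
      unfolding Theta_def Let_def r2 even_numer_def odd_numer_def odd_numer'_def cos2 R_def
      by (simp add: algebra_simps ss power2_eq_square)
    show "T0 ^ 4 / pi\<^sup>2 * (Re (1 * (\<i> * of_real \<tau>) ^ 0) *
       (mode_val (2 - 4 * \<xi>) (- (1 - 4 * \<xi>)) 0 0 0 \<tau> \<Gamma>
        - \<tau>\<^sup>2 * mode_val 0 0 (2 * (8 * \<xi> - 1) * R) (- (4 * \<xi> - 1) * R) 0 \<tau> \<Gamma>)) = D Iz Iz"
      unfolding scale \<tau>R D_zz using val_zz[OF refl] by simp
  qed simp_all
  have P_xx: "P Ix Ix"
    unfolding P_def
  \<comment> \<open>K' collects the term x y (sin (2 N) - 2 sin N), which is a source of the
    logarithm off the coordinate axes.\<close>
  proof (rule comp[where K = "1" and K' = "of_real (- 2 * T0\<^sup>2 * (x * y))" and j = 0 and ?a0.0 = "1 - 2 * \<xi>" and ?a1.0 = "2 * \<xi>" and ?b1.0 = "0" and ?b2.0 = "0" and s = "0" and a0' = "0" and a1' = "0" and b1' = "- 2 * (4 * \<xi> - 1) * (T0\<^sup>2 * (x\<^sup>2 - 3 * y\<^sup>2))" and b2' = "2 * \<xi> * (T0\<^sup>2 * (x\<^sup>2 - 3 * y\<^sup>2))" and s' = "0"])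
    show "Theta T0 \<xi> x y \<phi> n Ix Ix = 1 * of_real (\<phi> ^ 0 * (even_numer (1 - 2 * \<xi>) (2 * \<xi>) 0 0 0 (real n * \<phi>)
         + \<phi>\<^sup>2 * even_numer 0 0 (- 2 * (4 * \<xi> - 1) * (T0\<^sup>2 * (x\<^sup>2 - 3 * y\<^sup>2))) (2 * \<xi> * (T0\<^sup>2 * (x\<^sup>2 - 3 * y\<^sup>2))) 0 (real n * \<phi>)))
         + of_real (- 2 * T0\<^sup>2 * (x * y)) * of_real (\<phi> ^ 2 * odd_numer (real n * \<phi>))" for \<phi> n
      unfolding Theta_def Let_def r2 even_numer_def odd_numer_def odd_numer'_def cos2 R_def
      by (simp add: algebra_simps ss power2_eq_square)
    show "T0 ^ 4 / pi\<^sup>2 * (Re (1 * (\<i> * of_real \<tau>) ^ 0) *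
       (mode_val (1 - 2 * \<xi>) (2 * \<xi>) 0 0 0 \<tau> \<Gamma>
        - \<tau>\<^sup>2 * mode_val 0 0 (- 2 * (4 * \<xi> - 1) * (T0\<^sup>2 * (x\<^sup>2 - 3 * y\<^sup>2))) (2 * \<xi> * (T0\<^sup>2 * (x\<^sup>2 - 3 * y\<^sup>2))) 0 \<tau> \<Gamma>)) = D Ix Ix"
      unfolding scale \<tau>R D_xx using val_xx[OF XY(1)] by simp
  qed simp_all
  have P_yy: "P Iy Iy"
    unfolding P_def
  proof (rule comp[where K = "1" and K' = "of_real (2 * T0\<^sup>2 * (x * y))" and j = 0 and ?a0.0 = "1 - 2 * \<xi>" and ?a1.0 = "2 * \<xi>" and ?b1.0 = "0" and ?b2.0 = "0" and s = "0" and a0' = "0" and a1' = "0" and b1' = "- 2 * (4 * \<xi> - 1) * (T0\<^sup>2 * (y\<^sup>2 - 3 * x\<^sup>2))" and b2' = "2 * \<xi> * (T0\<^sup>2 * (y\<^sup>2 - 3 * x\<^sup>2))" and s' = "0"])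
    show "Theta T0 \<xi> x y \<phi> n Iy Iy = 1 * of_real (\<phi> ^ 0 * (even_numer (1 - 2 * \<xi>) (2 * \<xi>) 0 0 0 (real n * \<phi>)
         + \<phi>\<^sup>2 * even_numer 0 0 (- 2 * (4 * \<xi> - 1) * (T0\<^sup>2 * (y\<^sup>2 - 3 * x\<^sup>2))) (2 * \<xi> * (T0\<^sup>2 * (y\<^sup>2 - 3 * x\<^sup>2))) 0 (real n * \<phi>)))
         + of_real (2 * T0\<^sup>2 * (x * y)) * of_real (\<phi> ^ 2 * odd_numer (real n * \<phi>))" for \<phi> n
      unfolding Theta_def Let_def r2 even_numer_def odd_numer_def odd_numer'_def cos2 R_def
      by (simp add: algebra_simps ss power2_eq_square)
    show "T0 ^ 4 / pi\<^sup>2 * (Re (1 * (\<i> * of_real \<tau>) ^ 0) *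
       (mode_val (1 - 2 * \<xi>) (2 * \<xi>) 0 0 0 \<tau> \<Gamma>
        - \<tau>\<^sup>2 * mode_val 0 0 (- 2 * (4 * \<xi> - 1) * (T0\<^sup>2 * (y\<^sup>2 - 3 * x\<^sup>2))) (2 * \<xi> * (T0\<^sup>2 * (y\<^sup>2 - 3 * x\<^sup>2))) 0 \<tau> \<Gamma>)) = D Iy Iy"
      unfolding scale \<tau>R D_yy using val_xx[OF XY(2)] by simp
  qed simp_all
  have P_xy: "P Ix Iy"
    unfolding P_def
  \<comment> \<open>By 4 sin^2 (N/2) = 2 (1 - cos N), the even part without x y is 8 (1 - 4 \<xi>)
    (1 - cos N) + 8 \<xi> (1 - cos (2 N)), and 2 (1 - cos N) sin N is the odd numerator.\<close>
  proof (rule comp[where K = "1" and K' = "of_real (T0\<^sup>2 * ((x - y) * (x + y)))" and j = 0 and ?a0.0 = "0" and ?a1.0 = "0" and ?b1.0 = "0" and ?b2.0 = "0" and s = "0" and a0' = "0" and a1' = "0" and b1' = "8 * (1 - 4 * \<xi>) * (T0\<^sup>2 * (x * y))" and b2' = "8 * \<xi> * (T0\<^sup>2 * (x * y))" and s' = "0"])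
    show "Theta T0 \<xi> x y \<phi> n Ix Iy = 1 * of_real (\<phi> ^ 0 * (even_numer 0 0 0 0 0 (real n * \<phi>)
         + \<phi>\<^sup>2 * even_numer 0 0 (8 * (1 - 4 * \<xi>) * (T0\<^sup>2 * (x * y))) (8 * \<xi> * (T0\<^sup>2 * (x * y))) 0 (real n * \<phi>)))
         + of_real (T0\<^sup>2 * ((x - y) * (x + y))) * of_real (\<phi> ^ 2 * odd_numer (real n * \<phi>))" for \<phi> n
      unfolding Theta_def Let_def r2 even_numer_def odd_numer_def odd_numer'_def cos2 R_def
      by (simp add: algebra_simps ss power2_eq_square add_divide_distrib diff_divide_distrib)
    show "T0 ^ 4 / pi\<^sup>2 * (Re (1 * (\<i> * of_real \<tau>) ^ 0) *
       (mode_val 0 0 0 0 0 \<tau> \<Gamma>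
        - \<tau>\<^sup>2 * mode_val 0 0 (8 * (1 - 4 * \<xi>) * (T0\<^sup>2 * (x * y))) (8 * \<xi> * (T0\<^sup>2 * (x * y))) 0 \<tau> \<Gamma>)) = D Ix Iy"
      unfolding scale \<tau>R D_xy val_xy[symmetric] by (simp add: mode_val_zero)
  qed simp_all
  have P_tx: "P It Ix"
    unfolding P_def
  \<comment> \<open>The single power of \<phi> contributes i \<tau>, which turns the imaginary
    prefactor into the real number - 4 y \<omega>.\<close>
  proof (rule comp'[where K = "(4 * \<i> * of_real (y * T0))" and K' = "(2 * \<i> * of_real (x * T0))" and j = 1 and ?a0.0 = "0" and ?a1.0 = "0" and ?b1.0 = "0" and ?b2.0 = "0" and s = "1" and a0' = "0" and a1' = "0" and b1' = "0" and b2' = "0" and s' = "0"])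
    show "Theta T0 \<xi> x y \<phi> n It Ix = (4 * \<i> * of_real (y * T0)) * of_real (\<phi> ^ 1 * (even_numer 0 0 0 0 1 (real n * \<phi>)
         + \<phi>\<^sup>2 * even_numer 0 0 0 0 0 (real n * \<phi>)))
         + (2 * \<i> * of_real (x * T0)) * of_real (\<phi> ^ 1 * odd_numer' (real n * \<phi>))" for \<phi> n
      unfolding Theta_def Let_def r2 even_numer_def odd_numer_def odd_numer'_def cos2 R_def
      by (simp add: algebra_simps ss power2_eq_square)
    show "T0 ^ 4 / pi\<^sup>2 * (Re ((4 * \<i> * of_real (y * T0)) * (\<i> * of_real \<tau>) ^ 1) *
       (mode_val 0 0 0 0 1 \<tau> \<Gamma>
        - \<tau>\<^sup>2 * mode_val 0 0 0 0 0 \<tau> \<Gamma>)) = D It Ix"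
      unfolding scale \<tau>R D_tx val_tx[symmetric] using nz by (simp add: mode_val_zero Y_def \<tau>_def)
  qed simp_all
  have P_ty: "P It Iy"
    unfolding P_def
  proof (rule comp'[where K = "(- 4 * \<i> * of_real (x * T0))" and K' = "(2 * \<i> * of_real (y * T0))" and j = 1 and ?a0.0 = "0" and ?a1.0 = "0" and ?b1.0 = "0" and ?b2.0 = "0" and s = "1" and a0' = "0" and a1' = "0" and b1' = "0" and b2' = "0" and s' = "0"])
    show "Theta T0 \<xi> x y \<phi> n It Iy = (- 4 * \<i> * of_real (x * T0)) * of_real (\<phi> ^ 1 * (even_numer 0 0 0 0 1 (real n * \<phi>)
         + \<phi>\<^sup>2 * even_numer 0 0 0 0 0 (real n * \<phi>)))
         + (2 * \<i> * of_real (y * T0)) * of_real (\<phi> ^ 1 * odd_numer' (real n * \<phi>))" for \<phi> n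
      unfolding Theta_def Let_def r2 even_numer_def odd_numer_def odd_numer'_def cos2 R_def
      by (simp add: algebra_simps ss power2_eq_square)
    show "T0 ^ 4 / pi\<^sup>2 * (Re ((- 4 * \<i> * of_real (x * T0)) * (\<i> * of_real \<tau>) ^ 1) *
       (mode_val 0 0 0 0 1 \<tau> \<Gamma>
        - \<tau>\<^sup>2 * mode_val 0 0 0 0 0 \<tau> \<Gamma>)) = D It Iy"
      unfolding scale \<tau>R D_ty val_tx[symmetric] using nz by (simp add: mode_val_zero X_def \<tau>_def)
  qed simp_all
  have P_0: "P \<mu> \<nu>" if "(\<mu>, \<nu>) \<in> {(It, Iz), (Ix, Iz), (Iy, Iz)}" for \<mu> \<nu>
    unfolding P_def
  proof (rule comp[where K = 0 and K' = 0 and j = 0 and ?a0.0 = 0 and ?a1.0 = 0 and ?b1.0 = 0 and ?b2.0 = 0 and s = 0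
        and a0' = 0 and a1' = 0 and b1' = 0 and b2' = 0 and s' = 0])
    show "Theta T0 \<xi> x y \<phi> n \<mu> \<nu> = 0 * of_real (\<phi> ^ 0 * (even_numer 0 0 0 0 0 (real n * \<phi>)
         + \<phi>\<^sup>2 * even_numer 0 0 0 0 0 (real n * \<phi>))) + 0 * of_real (\<phi> ^ 2 * odd_numer (real n * \<phi>))" for \<phi> n
      using that by (auto simp: Theta_def Let_def)
    show "T0 ^ 4 / pi\<^sup>2 * (Re (0 * (\<i> * of_real \<tau>) ^ 0) *
       (mode_val 0 0 0 0 0 \<tau> \<Gamma>
        - \<tau>\<^sup>2 * mode_val 0 0 0 0 0 \<tau> \<Gamma>)) = D \<mu> \<nu>"
      using that by (auto simp: D_0)
  qed simp_all
  \<comment> \<open>Symmetry reduces the sixteen index pairs to the ten treated above.\<close>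
  have "Theta T0 \<xi> x y \<phi> n \<mu> \<nu> = Theta T0 \<xi> x y \<phi> n \<nu> \<mu>" for \<phi> n \<mu> \<nu>
    by (cases \<mu>; cases \<nu>) (simp_all add: Theta_def Let_def)
  hence P_sym: "P \<mu> \<nu> \<longleftrightarrow> P \<nu> \<mu>" for \<mu> \<nu>
    by (simp add: P_def D_sym[of \<nu> \<mu>] T_I_def[abs_def] T_I_term_def)
  have "P \<mu> \<nu>" for \<mu> \<nu>
    by (cases \<mu>; cases \<nu>)
       (use P_tt P_xx P_yy P_zz P_xy P_tx P_ty P_0[of It Iz] P_0[of Ix Iz] P_0[of Iy Iz]
          P_sym[of Ix It] P_sym[of Iy It] P_sym[of Iz It] P_sym[of Iy Ix] P_sym[of Iz Ix] P_sym[of Iz Iy] in simp_all)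
  thus ?thesis
    unfolding Let_def scalars P_def D_def \<rho>_def p_def Wc_def Ac_def Gl_def Gc_def by blast
qed

end
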